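(* Let $\Gamma$ be a cyclic group of order $n$, and let $r(n)=\prod_{p\mid n}p$ be the radical of $n$. (i) If $4\nmid n$, then $e_{\mathrm{nil}}(\Gamma)=e_{\mathrm{ab}}(\Gamma)=e(\Gamma,\Gamma)=n/r(n)$. (ii) If $n\equiv 4\pmod 8$, then $e_{\mathrm{nil}}(\Gamma)=e_{\mathrm{ab}}(\Gamma)=n/r(n)$, and $e(\Gamma,\Gamma)=e(\Gamma,C_2\times C_{n/2})=n/(2r(n))$. (iii) If $8\mid n$, write $n=2^v n'$ with $v\ge 3$ and $n'$ odd. Then $e_{\mathrm{nil}}(\Gamma)=3n/(2r(n))$ and $e_{\mathrm{ab}}(\Gamma)=e(\Gamma,\Gamma)=n/(2r(n))$, and moreover $e(\Gamma,D_{2^v}\times C_{n'})=e(\Gamma,Q_{2^v}\times C_{n'})=n/(2r(n))$.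
   Context: $C_m$ is the cyclic group of order $m$; for $v\ge 3$, $D_{2^v}$ and $Q_{2^v}$ are the dihedral and generalized quaternion groups of order $2^v$. For finite groups $\Gamma,G$ of the same order, $e(\Gamma,G)$ is the number of Hopf-Galois structures of type $G$ on a Galois field extension with Galois group $\Gamma$; equivalently, the number of $\mathrm{Aut}(G)$-conjugacy classes of injective homomorphisms $\beta:\Gamma\to\mathrm{Hol}(G)$ whose image acts regularly on $G$, where $\mathrm{Hol}(G)=\rho(G)\cdot\mathrm{Aut}(G)\subseteq\mathrm{Perm}(G)$ and $\rho(g)(x)=xg^{-1}$. Also $e_{\mathrm{ab}}(\Gamma)=\sum_{G \text{ abelian}} e(\Gamma,G)$ and $e_{\mathrm{nil}}(\Gamma)=\sum_{G\text{ nilpotent}} e(\Gamma,G)$, sums over isomorphism classes of abelian (resp. nilpotent) groups $G$ of order $|\Gamma|$. *)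

theory Defs
  imports "HOL-Algebra.Algebra" "HOL-Computational_Algebra.Primes"
begin

text \<open>Perm(G) is the library group BijGroup (carrier G) (extensional bijections,
  multiplication = composition).  rho(g)(x) = x * inv g.  Hol(G) = rho(G) Aut(G).\<close>

definition rho :: "('g, 'x) monoid_scheme \<Rightarrow> 'g \<Rightarrow> ('g \<Rightarrow> 'g)" where
  "rho G g = (\<lambda>x \<in> carrier G. x \<otimes>\<^bsub>G\<^esub> inv\<^bsub>G\<^esub> g)"

definition Hol :: "('g, 'x) monoid_scheme \<Rightarrow> ('g \<Rightarrow> 'g) set" where
  "Hol G = {compose (carrier G) (rho G g) \<sigma> | g \<sigma>. g \<in> carrier G \<and> \<sigma> \<in> auto G}"

text \<open>Injective homomorphisms Gamma -> Hol(G) whose image acts regularly on G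
  (extensional outside the carrier of Gamma, so that they are determined by
  their values on Gamma).\<close>

definition reg_embeddings ::
    "('c, 'y) monoid_scheme \<Rightarrow> ('g, 'x) monoid_scheme \<Rightarrow> ('c \<Rightarrow> 'g \<Rightarrow> 'g) set" where
  "reg_embeddings Gam G =
     {\<beta>. \<beta> \<in> hom Gam (BijGroup (carrier G)) \<and> \<beta> \<in> extensional (carrier Gam)
        \<and> \<beta> ` carrier Gam \<subseteq> Hol G \<and> inj_on \<beta> (carrier Gam)
        \<and> (\<forall>x \<in> carrier G. \<forall>y \<in> carrier G. \<exists>!h. h \<in> \<beta> ` carrier Gam \<and> h x = y)}"

definition aut_conj ::
    "('c, 'y) monoid_scheme \<Rightarrow> ('g, 'x) monoid_scheme \<Rightarrow> (('c \<Rightarrow> 'g \<Rightarrow> 'g) \<times> ('c \<Rightarrow> 'g \<Rightarrow> 'g)) set" where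
  "aut_conj Gam G =
     {(\<beta>, \<beta>'). \<beta> \<in> reg_embeddings Gam G \<and> \<beta>' \<in> reg_embeddings Gam G \<and>
        (\<exists>\<alpha> \<in> auto G. \<forall>a \<in> carrier Gam.
           \<beta>' a = \<alpha> \<otimes>\<^bsub>BijGroup (carrier G)\<^esub> \<beta> a \<otimes>\<^bsub>BijGroup (carrier G)\<^esub> inv\<^bsub>BijGroup (carrier G)\<^esub> \<alpha>)}"

definition e_HG :: "('c, 'y) monoid_scheme \<Rightarrow> ('g, 'x) monoid_scheme \<Rightarrow> nat" where
  "e_HG Gam G = card (reg_embeddings Gam G // aut_conj Gam G)"

definition commutator_subgroup :: "('g, 'x) monoid_scheme \<Rightarrow> 'g set \<Rightarrow> 'g set \<Rightarrow> 'g set" where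
  "commutator_subgroup G H K =
     generate G {inv\<^bsub>G\<^esub> h \<otimes>\<^bsub>G\<^esub> inv\<^bsub>G\<^esub> k \<otimes>\<^bsub>G\<^esub> h \<otimes>\<^bsub>G\<^esub> k | h k. h \<in> H \<and> k \<in> K}"

fun lower_central :: "('g, 'x) monoid_scheme \<Rightarrow> nat \<Rightarrow> 'g set" where
  "lower_central G 0 = carrier G"
| "lower_central G (Suc i) = commutator_subgroup G (lower_central G i) (carrier G)"

definition nilpotent_group :: "('g, 'x) monoid_scheme \<Rightarrow> bool" where
  "nilpotent_group G \<longleftrightarrow> group G \<and> (\<exists>i. lower_central G i = {\<one>\<^bsub>G\<^esub>})"

text \<open>Every group of order n is isomorphic to one with carrier {0..<n}.\<close>

definition groups_of_order :: "nat \<Rightarrow> nat monoid set" where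
  "groups_of_order n = {G. group G \<and> carrier G = {..<n}}"

definition iso_classes :: "nat \<Rightarrow> nat monoid set set" where
  "iso_classes n = groups_of_order n //
     {(G, H). G \<in> groups_of_order n \<and> H \<in> groups_of_order n \<and> G \<cong> H}"

definition e_ab :: "('c, 'y) monoid_scheme \<Rightarrow> nat" where
  "e_ab Gam = (\<Sum>C \<in> {C \<in> iso_classes (card (carrier Gam)). \<exists>G \<in> C. comm_group G}.
                  e_HG Gam (SOME G. G \<in> C))"

definition e_nil :: "('c, 'y) monoid_scheme \<Rightarrow> nat" where
  "e_nil Gam = (\<Sum>C \<in> {C \<in> iso_classes (card (carrier Gam)). \<exists>G \<in> C. nilpotent_group G}.
                  e_HG Gam (SOME G. G \<in> C))"

abbreviation cyc :: "nat \<Rightarrow> int monoid" where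
  "cyc m \<equiv> integer_mod_group m"

text \<open>Dihedral group of order 2^v (v >= 3): pairs (a,s) standing for x^a y^s,
  x of order m = 2^(v-1), y^2 = 1, y x y^-1 = x^-1.\<close>
definition dihedral_group :: "nat \<Rightarrow> (int \<times> int) monoid" where
  "dihedral_group v =
    (let m = (2::int) ^ (v - 1) in
     \<lparr>carrier = {0..<m} \<times> {0..<2},
      monoid.mult = (\<lambda>(a, s) (b, t). ((a + (if s = 0 then b else - b)) mod m, (s + t) mod 2)),
      one = (0, 0)\<rparr>)"

text \<open>Generalized quaternion group of order 2^v (v >= 3): pairs (a,s) standing for
  x^a y^s, x of order m = 2^(v-1), y^2 = x^(m/2), y x y^-1 = x^-1.\<close>
definition quaternion_group :: "nat \<Rightarrow> (int \<times> int) monoid" where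
  "quaternion_group v =
    (let m = (2::int) ^ (v - 1) in
     \<lparr>carrier = {0..<m} \<times> {0..<2},
      monoid.mult = (\<lambda>(a, s) (b, t).
                ((a + (if s = 0 then b else - b) + (if s = 1 \<and> t = 1 then m div 2 else 0)) mod m,
                 (s + t) mod 2)),
      one = (0, 0)\<rparr>)"

definition radical :: "nat \<Rightarrow> nat" where
  "radical n = (\<Prod>p \<in> prime_factors n. p)"

end

theory Submission
  imports Defs "HOL-Number_Theory.Cong"
begin

text \<open>
  A regular embedding of a cyclic group of order \<open>n\<close> into \<open>Hol(G)\<close> is given by an \<open>n\<close>-cycle
  \<open>x \<mapsto> \<sigma>(x) a\<close> on \<open>G\<close>, where \<open>\<sigma> \<in> Aut(G)\<close> and \<open>a \<in> G\<close>. Let \<open>g k\<close> be the image of \<open>1\<close> under its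
  \<open>k\<close>-th power, so that \<open>g (k + l) = \<sigma>\<^sup>k(g l) g k\<close>. A \<open>\<sigma>\<close>-invariant subgroup of \<open>G\<close> is of the
  form \<open>H d = {g k | d divides k}\<close>.

  Let \<open>G\<close> be nilpotent. For each prime \<open>p\<close> dividing \<open>n\<close>, the central elements of order dividing
  \<open>p\<close> that are fixed by a suitable power of \<open>\<sigma>\<close> form a non-trivial invariant subgroup, on which a
  power of the cycle is a translation; hence this subgroup has order \<open>p\<close> and is \<open>H (n / p)\<close>. Passing
  to quotients, every \<open>H d\<close> with \<open>d\<close> dividing \<open>n\<close> is normal. The sections of order \<open>p\<^sup>2\<close> of the
  chain \<open>H (p\<^sup>j)\<close> are cyclic, except possibly the top one for \<open>p = 2\<close>. Therefore \<open>G\<close> is generated by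
  \<open>a\<close> if \<open>4\<close> does not divide \<open>n\<close>, and \<open>w = g 2\<close> generates a cyclic subgroup of index \<open>2\<close> if
  \<open>4\<close> divides \<open>n\<close>.

  In the second case put \<open>N = n / 2\<close> and write \<open>a w a\<^sup>-\<^sup>1 = w\<^sup>t\<close>, \<open>a\<^sup>2 = w\<^sup>e\<close>, \<open>\<sigma>(w) = w\<^sup>i\<close>. Since
  \<open>\<sigma>(a) a = w\<close>, one finds \<open>e (i + 1) = 1 + t\<close> modulo \<open>N\<close>. Together with \<open>t\<^sup>2 = 1\<close>, \<open>t e = e\<close> and
  \<open>t = i = 1\<close> modulo each prime divisor of \<open>N\<close>, this leaves only the cyclic group, the dihedral
  type and, for \<open>8\<close> dividing \<open>n\<close>, the quaternion type. In each type \<open>i\<close> is a complete invariant of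
  the cycle up to \<open>Aut(G)\<close>, and the possible values of \<open>i\<close> are determined by the Hull--Dobell theorem.
\<close>

text \<open>Suppose 4 divides n. That all types have the same count is not one phenomenon. In a
  cyclic group with \<sigma>(a) = a^i one has g k = a^(1 + i + ... + i^(k-1)), so a full cycle
  forces i = 1 modulo 4, with i taken modulo n. In the other types only the even-indexed terms lie
  in <w>; they follow the multiplier i^2, for which the condition modulo 4 is automatic because i is
  odd, but i lives modulo n / 2. Either way a factor 2 is lost, each admissible type contributes n /
  (2 r(n)), and the totals merely count types.

  The exception at p = 2 comes from the exponent p (p - 1) / 2 of the correction term in a p-th
  power. The term is central of order dividing p, so it disappears for odd p. For p = 2 it
  disappears only below the top section, which is why w = g 2 and not a generates the large cyclic
  subgroup.

  The power of \<sigma> in the descent is \<sigma>^m with m the prime-to-p part of n: since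
  \<sigma>^n = 1, it has p-power order, and the number of its fixed points in a p-group is divisible
  by p.\<close>

hide_const (open) Divisibility.prime

section \<open>Geometric sums and linear congruential sequences\<close>

text \<open>If \<sigma>(a) = a^u, then \<open>g k\<close> is a to the power
  \<open>geom u k\<close>.\<close>

definition geom :: "nat \<Rightarrow> nat \<Rightarrow> nat" where
  "geom u k = (\<Sum>j<k. u ^ j)"

lemma geom_0 [simp]: "geom u 0 = 0"
  by (simp add: geom_def)

lemma geom_Suc: "geom u (Suc k) = geom u k + u ^ k"
  by (simp add: geom_def)

lemma geom_Suc_shift: "geom u (Suc k) = u * geom u k + 1"
  by (simp only: geom_def sum.lessThan_Suc_shift) (simp add: sum_distrib_left)

lemma geom_add: "geom u (k + l) = geom u k + u ^ k * geom u l"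
  by (induction l) (simp_all add: geom_Suc power_add algebra_simps)

text \<open>The \<open>k * l\<close> summands fall into \<open>l\<close> blocks of length
  \<open>k\<close>, and each block is \<open>u ^ k\<close> times the preceding one.\<close>

lemma geom_mult: "geom u (k * l) = geom u k * geom (u ^ k) l"
proof (induction l)
  case (Suc l)
  then show ?case
    by (simp add: geom_add geom_Suc_shift algebra_simps)
qed simp

lemma geom_minus_one: "(int u - 1) * int (geom u k) = int u ^ k - 1"
  by (induction k) (simp_all add: geom_Suc algebra_simps)

lemma geom_cong_arg:
  assumes "[u = w] (mod m)"
  shows "[geom u k = geom w k] (mod m)"
  unfolding geom_def using assms by (intro cong_sum cong_pow)

lemma geom_one: "geom 1 k = k"
  by (simp add: geom_def)

text \<open>The binomial expansion; all terms after the first two are divisible by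
  \<open>p ^ 2\<close>.\<close>

lemma one_add_power_cong:
  "[(1 + p * z) ^ l = 1 + l * p * z] (mod p ^ 2)" for p z l :: nat
proof (induction l)
  case (Suc l)
  have "[(1 + p * z) ^ Suc l = (1 + p * z) * (1 + l * p * z)] (mod p ^ 2)"
    using cong_scalar_left[OF Suc.IH, of "1 + p * z"] by simp
  also have "(1 + p * z) * (1 + l * p * z) = (1 + Suc l * p * z) + p ^ 2 * (l * z * z)"
    by (simp add: algebra_simps power2_eq_square)
  also have "[\<dots> = 1 + Suc l * p * z] (mod p ^ 2)"
    by (simp add: cong_def)
  finally show ?case .
qed simp

lemma double_sum_lessThan: "2 * (\<Sum>l<p. l) = p * (p - 1)" for p :: nat
proof (induction p)
  case (Suc p)
  then show ?case by (cases p) (auto simp: algebra_simps)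
qed simp

text \<open>Modulo \<open>p ^ 2\<close> the summands are 1 + l p z, and the terms l p z add up to p
  z p (p - 1) / 2, a multiple of \<open>p ^ 2\<close> for odd p. For p = 2 the sum is just 1 + w, so
  w has to be known modulo 4.\<close>

lemma geom_prime_cong:
  assumes "prime p" "[w = 1] (mod p)" "p = 2 \<Longrightarrow> [w = 1] (mod 4)" "w > 0"
  shows "[geom w p = p] (mod p ^ 2)"
proof (cases "p = 2")
  case True
  then have "[1 + w = 1 + 1] (mod 4)"
    using assms(3) by (intro cong_add) auto
  then show ?thesis
    using True by (simp add: geom_def numeral_2_eq_2[symmetric] lessThan_nat_numeral)
next
  case False
  then have "odd p"
    using assms(1) prime_odd_nat[of p] prime_ge_2_nat[of p] by force
  have "p dvd w - 1"
    using assms(2,4) cong_altdef_nat[of 1 w p] by simp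
  then obtain z where z: "w = 1 + p * z"
    using assms(4) by (metis One_nat_def Suc_leI dvdE le_add_diff_inverse)
  have "[geom w p = (\<Sum>l<p. 1 + l * p * z)] (mod p ^ 2)"
    unfolding geom_def z by (intro cong_sum one_add_power_cong)
  also have "(\<Sum>l<p. 1 + l * p * z) = p + (\<Sum>l<p. l) * p * z"
    by (simp add: sum.distrib sum_distrib_right del: plus_nat.simps add_Suc One_nat_def Suc_eq_plus1_left)
  also have "(\<Sum>l<p. l) = p * ((p - 1) div 2)"
    using double_sum_lessThan[of p] \<open>odd p\<close> by (simp add: div_mult_swap)
  also have "[p + p * ((p - 1) div 2) * p * z = p] (mod p ^ 2)"
  proof -
    have "p + p * ((p - 1) div 2) * p * z = p + p ^ 2 * (((p - 1) div 2) * z)"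
      by (simp add: power2_eq_square)
    then show ?thesis
      by (metis cong_add_lcancel_0_nat cong_0_iff dvd_triv_left)
  qed
  finally show ?thesis .
qed

text \<open>Lifting the exponent: \<open>geom u (l * p)\<close> is \<open>geom u l\<close> times
  \<open>geom (u ^ l) p\<close>, and the second factor contains p exactly once. So each step of the
  induction on s trades one factor p of k for one factor p of the sum.\<close>

lemma prime_power_dvd_geom:
  assumes "prime p" "[u = 1] (mod p)" "p = 2 \<Longrightarrow> s \<ge> 2 \<Longrightarrow> [u = 1] (mod 4)" "u > 0"
  shows "p ^ s dvd geom u k \<longleftrightarrow> p ^ s dvd k"
  using assms(3)
proof (induction s arbitrary: k)
  case (Suc s)
  have *: "[geom u l = l] (mod p)" for l
    using geom_cong_arg[OF assms(2), of l] by (simp only: geom_one)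
  then have dvd1: "p dvd geom u l \<longleftrightarrow> p dvd l" for l
    using cong_dvd_iff by blast
  show ?case
  proof (cases "p dvd k")
    case False
    then show ?thesis
      using dvd1[of k] dvd_mult_left[of p "p ^ s"] by (auto simp only: power_Suc)
  next
    case True
    then obtain l where l: "k = l * p"
      by (metis dvd_def mult.commute)
    show ?thesis
    proof (cases "s = 0")
      case True
      then show ?thesis using dvd1 by simp
    next
      case False
      have "[u ^ l = 1 ^ l] (mod p)"
        using assms(2) by (rule cong_pow)
      moreover have "[u ^ l = 1 ^ l] (mod 4)" if "p = 2"
        using Suc.prems that False by (intro cong_pow) auto
      ultimately have "[geom (u ^ l) p = p] (mod p ^ 2)"
        using assms(1,4) by (intro geom_prime_cong) auto
      then obtain q where q: "geom (u ^ l) p = p * q" and "\<not> p dvd q"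
      proof -
        assume a: "\<And>q. geom (u ^ l) p = p * q \<Longrightarrow> \<not> p dvd q \<Longrightarrow> thesis"
        assume c: "[geom (u ^ l) p = p] (mod p ^ 2)"
        then have "p dvd geom (u ^ l) p"
          by (metis cong_dvd_iff cong_modulus_mult_nat dvd_refl power2_eq_square)
        then obtain q where q: "geom (u ^ l) p = p * q" by blast
        have "\<not> p ^ 2 dvd p"
          using assms(1) prime_gt_1_nat[of p] by (auto simp: power2_eq_square)
        then have "\<not> p ^ 2 dvd geom (u ^ l) p"
          using c cong_dvd_iff by blast
        then show thesis using a[OF q] q assms(1) by (auto simp: power2_eq_square prime_gt_0_nat)
      qed
      then have "coprime (p ^ s) q"
        using assms(1) prime_imp_coprime by auto
      have "p ^ Suc s dvd geom u k \<longleftrightarrow> p ^ s dvd geom u l * q"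
        using assms(1) prime_gt_0_nat[of p] unfolding l geom_mult q by (auto simp: mult.left_commute)
      also have "\<dots> \<longleftrightarrow> p ^ s dvd geom u l"
        using \<open>coprime (p ^ s) q\<close> by (simp add: coprime_dvd_mult_left_iff)
      also have "\<dots> \<longleftrightarrow> p ^ s dvd l"
        using Suc by auto
      also have "\<dots> \<longleftrightarrow> p ^ Suc s dvd k"
        using assms(1) prime_gt_0_nat[of p] by (auto simp: l mult.commute)
      finally show ?thesis .
    qed
  qed
qed simp

text \<open>The Hull--Dobell conditions on the multiplier of x -> u x + 1; the increment 1 is a unit
  for every modulus.\<close>

definition lcg_unit :: "nat \<Rightarrow> nat \<Rightarrow> bool" where
  "lcg_unit n u \<longleftrightarrow> (\<forall>p. prime p \<and> p dvd n \<longrightarrow> [u = 1] (mod p)) \<and> (4 dvd n \<longrightarrow> [u = 1] (mod 4))"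

lemma dvd_prime_powersI:
  fixes n x :: nat
  assumes "n > 0" "\<And>p s. prime p \<Longrightarrow> p ^ s dvd n \<Longrightarrow> p ^ s dvd x"
  shows "n dvd x"
proof (cases "x = 0")
  case False
  show ?thesis
  proof (rule multiplicity_le_imp_dvd)
    fix p :: nat assume "prime p"
    then have "p ^ multiplicity p n dvd x"
      using assms(2) multiplicity_dvd by blast
    then show "multiplicity p n \<le> multiplicity p x"
      using \<open>prime p\<close> False not_prime_unit[of p] by (intro multiplicity_geI) auto
  qed (use assms in auto)
qed auto

text \<open>The Hull--Dobell theorem on the maximal period of \<open>x \<mapsto> u x + 1\<close> modulo \<open>n\<close>,
  whose iterates of \<open>0\<close> are the values \<open>geom u k\<close>.\<close>

lemma dvd_geom_iff:
  assumes "lcg_unit n u" "n > 0" "u > 0"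
  shows "n dvd geom u k \<longleftrightarrow> n dvd k"
proof -
  have *: "p ^ s dvd geom u k \<longleftrightarrow> p ^ s dvd k" if "prime p" "p ^ s dvd n" for p s
  proof (cases "s = 0")
    case False
    then have "p dvd n" using dvd_trans[OF dvd_power that(2)] by simp
    moreover have "4 dvd n" if "p = 2" "s \<ge> 2"
    proof -
      have "2 ^ 2 dvd (2::nat) ^ s"
        using that(2) by (rule le_imp_power_dvd)
      also have "2 ^ s dvd n"
        using \<open>p ^ s dvd n\<close> that(1) by simp
      finally show ?thesis by simp
    qed
    ultimately show ?thesis
      using assms that by (intro prime_power_dvd_geom) (auto simp: lcg_unit_def)
  qed simp
  show ?thesis
  proof
    assume a: "n dvd geom u k"
    show "n dvd k"
    proof (rule dvd_prime_powersI[OF assms(2)])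
      fix p s assume "prime p" "p ^ s dvd n"
      then show "p ^ s dvd k"
        using *[of p s] dvd_trans[of "p ^ s" n "geom u k"] a by fast
    qed
  next
    assume a: "n dvd k"
    show "n dvd geom u k"
    proof (rule dvd_prime_powersI[OF assms(2)])
      fix p s assume "prime p" "p ^ s dvd n"
      then show "p ^ s dvd geom u k"
        using *[of p s] dvd_trans[of "p ^ s" n "k"] a by fast
    qed
  qed
qed

text \<open>The difference of two values is \<open>u ^ j * geom u l\<close>, and
  \<open>u ^ j\<close> is a unit modulo n.\<close>

lemma geom_cong_iff:
  assumes "lcg_unit n u" "n > 0" "u > 0" "coprime u n"
  shows "[geom u j = geom u k] (mod n) \<longleftrightarrow> [j = k] (mod n)"
proof -
  have *: "[geom u (j + l) = geom u j] (mod n) \<longleftrightarrow> [j + l = j] (mod n)" for j l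
  proof -
    have "[geom u (j + l) = geom u j] (mod n) \<longleftrightarrow> n dvd u ^ j * geom u l"
      unfolding geom_add cong_add_lcancel_0_nat cong_0_iff ..
    also have "\<dots> \<longleftrightarrow> n dvd geom u l"
      using assms(4) by (simp add: coprime_dvd_mult_right_iff coprime_commute)
    also have "\<dots> \<longleftrightarrow> [j + l = j] (mod n)"
      unfolding dvd_geom_iff[OF assms(1-3)] cong_add_lcancel_0_nat cong_0_iff ..
    finally show ?thesis .
  qed
  show ?thesis
  proof (cases "j \<le> k")
    case True
    then show ?thesis
      using *[of j "k - j"] by (metis cong_sym le_add_diff_inverse)
  next
    case False
    then show ?thesis
      using *[of k "j - k"] by simp
  qed
qed

text \<open>An injective self-map of the n residues is onto.\<close>

lemma geom_onto:
  assumes "lcg_unit n u" "n > 0" "u > 0" "coprime u n"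
  shows "\<exists>k. [geom u k = c] (mod n)"
proof -
  have "inj_on (\<lambda>k. geom u k mod n) {..<n}"
    using geom_cong_iff[OF assms] by (auto simp: inj_on_def cong_def)
  moreover have "(\<lambda>k. geom u k mod n) ` {..<n} \<subseteq> {..<n}"
    using assms(2) by auto
  ultimately have "(\<lambda>k. geom u k mod n) ` {..<n} = {..<n}"
    by (simp add: endo_inj_surj)
  then have "c mod n \<in> (\<lambda>k. geom u k mod n) ` {..<n}"
    using assms(2) by simp
  then show ?thesis by (auto simp: cong_def)
qed

text \<open>Two obstructions to reaching all residues. If u differs from 1 modulo p, then x -> u x +
  1 has a fixed point modulo p, which the iterates of 0 could only meet if p divided u. If u = 3
  modulo 4, the values alternate between 0 and 1 modulo 4 and miss 2.\<close>

lemma lcg_unit_if_geom_onto: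
  assumes "\<And>c. \<exists>k. [geom u k = c] (mod n)" "coprime u n"
  shows "lcg_unit n u"
  unfolding lcg_unit_def
proof (intro conjI allI impI)
  fix p assume p: "prime p \<and> p dvd n"
  have npu: "\<not> p dvd u"
    using coprime_common_divisor[OF assms(2), of p] p not_prime_unit[of p] by blast
  show "[u = 1] (mod p)"
  proof (rule ccontr)
    assume "\<not> [u = 1] (mod p)"
    then have "\<not> int p dvd int u - 1"
      using cong_int_iff[of u 1 p] by (simp add: cong_iff_dvd_diff)
    then have "coprime (int u - 1) (int p)"
      using p prime_imp_coprime[of "int p" "int u - 1"] by (simp add: coprime_commute)
    then obtain c where c: "[(int u - 1) * c = 1] (mod int p)"
      using cong_solve_coprime_int by blast
    \<comment> \<open>Minus the inverse of u - 1: the fixed point of x -> u x + 1 modulo p.\<close>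
    define c' where "c' = nat ((- c) mod int p)"
    have c': "[int c' = - c] (mod int p)"
      using p by (simp add: c'_def prime_gt_0_nat)
    obtain k where "[geom u k = c'] (mod n)"
      using assms(1) by blast
    then have "[geom u k = c'] (mod p)"
      using p cong_dvd_modulus_nat[of "geom u k" c' n p] by blast
    then have "[int (geom u k) = - c] (mod int p)"
      using c' cong_int_iff[of "geom u k" c' p] cong_trans by blast
    then have "[(int u - 1) * int (geom u k) = (int u - 1) * (- c)] (mod int p)"
      by (rule cong_scalar_left)
    moreover have "[(int u - 1) * (- c) = - 1] (mod int p)"
      using cong_scalar_left[OF c, of "- 1"] by simp
    ultimately have "[int u ^ k - 1 = - 1] (mod int p)"
      unfolding geom_minus_one by (rule cong_trans)
    then have "int p dvd int u ^ k"
      by (simp add: cong_iff_dvd_diff)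
    then have "p dvd u ^ k"
      unfolding of_nat_power[symmetric] int_dvd_int_iff .
    then show False
      using p npu prime_dvd_power[of p u k] by blast
  qed
next
  assume n4: "4 dvd n"
  have "odd u"
  proof
    assume "even u"
    moreover have "even n"
      using n4 by presburger
    ultimately show False
      using coprime_common_divisor[OF assms(2), of 2] by simp
  qed
  show "[u = 1] (mod 4)"
  proof (rule ccontr)
    assume "\<not> [u = 1] (mod 4)"
    with \<open>odd u\<close> have u3: "u mod 4 = 3"
      unfolding cong_def by presburger
    have *: "geom u k mod 4 \<in> {0, 1}" for k
    proof (induction k)
      case (Suc k)
      have "geom u (Suc k) mod 4 = ((u mod 4) * (geom u k mod 4) + 1) mod 4"
        unfolding geom_Suc_shift by (metis mod_add_left_eq mod_mult_eq)
      then show ?case using Suc u3 by auto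
    qed simp
    obtain k where "[geom u k = 2] (mod n)"
      using assms(1) by blast
    then have "[geom u k = 2] (mod 4)"
      using n4 cong_dvd_modulus_nat[of "geom u k" 2 n 4] by blast
    then show False
      using *[of k] by (auto simp: cong_def)
  qed
qed

section \<open>Cycles in the holomorph\<close>

fun orb :: "('g, 'x) monoid_scheme \<Rightarrow> ('g \<Rightarrow> 'g) \<Rightarrow> 'g \<Rightarrow> nat \<Rightarrow> 'g" where
  "orb G \<sigma> a 0 = \<one>\<^bsub>G\<^esub>"
| "orb G \<sigma> a (Suc k) = \<sigma> (orb G \<sigma> a k) \<otimes>\<^bsub>G\<^esub> a"

lemma (in group) subgroup_mult_right_mem_iff:
  assumes "subgroup S G" "s \<in> S" "x \<in> carrier G"
  shows "x \<otimes> s \<in> S \<longleftrightarrow> x \<in> S"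
proof
  assume "x \<otimes> s \<in> S"
  then have "x \<otimes> s \<otimes> inv s \<in> S"
    by (rule subgroup.m_closed[OF assms(1) _ subgroup.m_inv_closed[OF assms(1,2)]])
  then show "x \<in> S"
    using assms subgroup.mem_carrier[OF assms(1,2)] by (simp add: m_assoc)
qed (rule subgroup.m_closed[OF assms(1) _ assms(2)])

lemma (in group) subgroup_pow_mem:
  assumes "subgroup S G" "x \<in> S"
  shows "x [^] (k::nat) \<in> S"
  using assms by (induction k) (auto simp: subgroup.one_closed subgroup.m_closed)

text \<open>Bezout in natural numbers. With S trivial: an element killed by two coprime exponents is
  trivial.\<close>

lemma (in group) subgroup_pow_gcd_mem:
  assumes S: "subgroup S G" and x: "x \<in> carrier G"
    and "x [^] (u::nat) \<in> S" "x [^] (w::nat) \<in> S"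
  shows "x [^] gcd u w \<in> S"
proof (cases "u = 0")
  case True
  then show ?thesis using assms by simp
next
  case False
  then obtain s r where sr: "u * s = w * r + gcd u w"
    using bezout_nat by blast
  have "x [^] gcd u w \<otimes> (x [^] w) [^] r = (x [^] u) [^] s"
    using x by (simp add: nat_pow_pow nat_pow_mult sr add.commute)
  also have "\<dots> \<in> S"
    using assms by (simp add: subgroup_pow_mem)
  finally show ?thesis
    using subgroup_mult_right_mem_iff[OF S, of "(x [^] w) [^] r" "x [^] gcd u w"] assms
    by (simp add: subgroup_pow_mem)
qed

text \<open>Stated with \<open>hom\<close> and \<open>bij_betw\<close> instead of
  \<open>auto\<close>, so that the map induced on cosets, which is not extensional, again gives an
  instance. Only transitivity is demanded; that the period is the order of G follows in
  \<open>g_eq_one_iff\<close>.\<close>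

locale hol_cycle = group G for G (structure) +
  fixes \<sigma> :: "'a \<Rightarrow> 'a" and a :: 'a
  assumes fin: "finite (carrier G)"
    and hom: "\<sigma> \<in> hom G G"
    and bij: "bij_betw \<sigma> (carrier G) (carrier G)"
    and a_closed [simp]: "a \<in> carrier G"
    and orb_onto: "carrier G \<subseteq> range (orb G \<sigma> a)"
begin

abbreviation g :: "nat \<Rightarrow> 'a" where "g \<equiv> orb G \<sigma> a"

abbreviation n :: nat where "n \<equiv> order G"

lemma sigma_closed [simp]: "x \<in> carrier G \<Longrightarrow> \<sigma> x \<in> carrier G"
  using hom by (auto simp: hom_def)

lemma sigma_mult [simp]:
  "x \<in> carrier G \<Longrightarrow> y \<in> carrier G \<Longrightarrow> \<sigma> (x \<otimes> y) = \<sigma> x \<otimes> \<sigma> y"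
  using hom by (auto simp: hom_def)

sublocale sig: group_hom G G \<sigma>
  using hom is_group by (simp add: group_hom_def group_hom_axioms_def)

lemma sigma_inj: "x \<in> carrier G \<Longrightarrow> y \<in> carrier G \<Longrightarrow> \<sigma> x = \<sigma> y \<longleftrightarrow> x = y"
  using bij by (auto simp: bij_betw_def inj_on_def)

lemma iter_closed [simp]: "x \<in> carrier G \<Longrightarrow> (\<sigma> ^^ k) x \<in> carrier G"
  by (induction k) auto

lemma iter_mult [simp]:
  "x \<in> carrier G \<Longrightarrow> y \<in> carrier G \<Longrightarrow> (\<sigma> ^^ k) (x \<otimes> y) = (\<sigma> ^^ k) x \<otimes> (\<sigma> ^^ k) y"
  by (induction k) auto

lemma iter_one [simp]: "(\<sigma> ^^ k) \<one> = \<one>"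
  by (induction k) auto

lemma iter_inj: "x \<in> carrier G \<Longrightarrow> y \<in> carrier G \<Longrightarrow> (\<sigma> ^^ k) x = (\<sigma> ^^ k) y \<longleftrightarrow> x = y"
  by (induction k) (auto simp: sigma_inj)

lemma iter_pow:
  "x \<in> carrier G \<Longrightarrow> (\<sigma> ^^ k) (x [^] (l::nat)) = (\<sigma> ^^ k) x [^] l"
  by (induction l) auto

lemma g_closed [simp]: "g k \<in> carrier G"
  by (induction k) auto

lemma g_1 [simp]: "g (Suc 0) = a"
  by (simp add: l_one)

lemma g_add: "g (k + l) = (\<sigma> ^^ k) (g l) \<otimes> g k"
  by (induction k) (simp_all add: m_assoc)

lemma g_obtain:
  assumes "x \<in> carrier G"
  obtains k where "x = g k"
  using assms orb_onto by blast

lemma n_pos: "n > 0"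
  using fin order_gt_0_iff_finite by blast

text \<open>\<sigma> is injective and S is finite, so \<sigma> permutes S and maps no element from
  outside into S.\<close>

lemma iter_mem_iff:
  assumes "subgroup S G" "\<sigma> ` S \<subseteq> S" "x \<in> carrier G"
  shows "(\<sigma> ^^ k) x \<in> S \<longleftrightarrow> x \<in> S"
proof -
  have "S \<subseteq> carrier G" "finite S"
    using subgroup.subset[OF assms(1)] fin by (auto intro: finite_subset)
  moreover have "inj_on \<sigma> S"
    using bij_betw_imp_inj_on[OF bij] \<open>S \<subseteq> carrier G\<close> by (rule inj_on_subset)
  ultimately have "\<sigma> ` S = S"
    using assms(2) endo_inj_surj[of S \<sigma>] by simp
  have *: "\<sigma> y \<in> S \<longleftrightarrow> y \<in> S" if "y \<in> carrier G" for y
  proof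
    assume "\<sigma> y \<in> S"
    then obtain z where "z \<in> S" "\<sigma> y = \<sigma> z"
      using \<open>\<sigma> ` S = S\<close> by (metis imageE)
    then show "y \<in> S"
      using sigma_inj[of y z] that \<open>S \<subseteq> carrier G\<close> by auto
  qed (use assms(2) in auto)
  show ?thesis
    by (induction k) (use * assms(3) in auto)
qed

text \<open>By \<open>g_add\<close>, if \<open>g k\<close> is in S, then \<open>g (k + l)\<close> is
  in S exactly if \<open>g l\<close> is. So the indices of elements of S are the multiples of the
  least positive one, which exists because g must repeat a value.\<close>

lemma invariant_subgroup_index:
  assumes "subgroup S G" "\<sigma> ` S \<subseteq> S"
  obtains d where "d > 0" "\<And>k. g k \<in> S \<longleftrightarrow> d dvd k"
proof -
  have mem_add: "g (k + l) \<in> S \<longleftrightarrow> g l \<in> S" if "g k \<in> S" for k l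
    using subgroup_mult_right_mem_iff[OF assms(1) that] iter_mem_iff[OF assms, of "g l"]
    by (simp add: g_add)
  have diff: "g l \<in> S" if "g k = g (k + l)" for k l
  proof -
    have "(\<sigma> ^^ k) (g l) \<otimes> g k = \<one> \<otimes> g k"
      using that by (simp add: g_add)
    then have "(\<sigma> ^^ k) (g l) = (\<sigma> ^^ k) \<one>"
      by (simp add: r_cancel del: l_one)
    then have "g l = \<one>"
      by (subst (asm) iter_inj) auto
    then show ?thesis
      using assms(1) subgroup.one_closed by auto
  qed
  have "finite (range g)"
    using fin by (rule finite_subset[rotated]) auto
  then have "\<not> inj g"
    using finite_imageD infinite_UNIV_nat by blast
  then obtain j k where jk: "g j = g k" "j < k"
    by (metis injI linorder_neqE_nat)
  then have ex: "\<exists>d. d > 0 \<and> g d \<in> S"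
    using diff[of j "k - j"] by (intro exI[of _ "k - j"]) auto
  define d where "d = (LEAST d. d > 0 \<and> g d \<in> S)"
  have d: "d > 0" "g d \<in> S" and least: "\<And>k. k > 0 \<Longrightarrow> k < d \<Longrightarrow> g k \<notin> S"
    using LeastI_ex[OF ex] not_less_Least[of _ "\<lambda>d. d > 0 \<and> g d \<in> S"] unfolding d_def by auto
  have red: "g (q * d + r) \<in> S \<longleftrightarrow> g r \<in> S" for q r
  proof (induction q)
    case (Suc q)
    then show ?case using mem_add[OF d(2), of "q * d + r"] by (simp add: add.assoc)
  qed simp
  have "g k \<in> S \<longleftrightarrow> d dvd k" for k
  proof -
    have "g k \<in> S \<longleftrightarrow> g (k mod d) \<in> S"
      using red[of "k div d" "k mod d"] by simp
    also have "\<dots> \<longleftrightarrow> k mod d = 0"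
      using least[of "k mod d"] d(1) subgroup.one_closed[OF assms(1)] by (cases "k mod d = 0") auto
    finally show ?thesis by (simp add: dvd_eq_mod_eq_0)
  qed
  with d(1) that show thesis by blast
qed

lemma g_eq_add_iff: "g (k + l) = g k \<longleftrightarrow> g l = \<one>"
proof -
  have "g (k + l) = g k \<longleftrightarrow> (\<sigma> ^^ k) (g l) \<otimes> g k = \<one> \<otimes> g k"
    by (simp add: g_add)
  also have "\<dots> \<longleftrightarrow> (\<sigma> ^^ k) (g l) = (\<sigma> ^^ k) \<one>"
    by (simp add: r_cancel del: l_one)
  also have "\<dots> \<longleftrightarrow> g l = \<one>"
    by (subst iter_inj) auto
  finally show ?thesis .
qed

text \<open>The trivial subgroup is invariant, so the indices of 1 are the multiples of some d. The
  first d terms are distinct and exhaust G, hence d is the order.\<close>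

lemma g_eq_one_iff: "g k = \<one> \<longleftrightarrow> n dvd k"
proof -
  have "subgroup {\<one>} G"
    using one_is_normal normal_imp_subgroup by blast
  then obtain d where d: "d > 0" "\<And>k. g k \<in> {\<one>} \<longleftrightarrow> d dvd k"
    using invariant_subgroup_index[of "{\<one>}"] by auto
  have "inj_on g {..<d}"
  proof (rule linorder_inj_onI)
    fix j k assume "j < k" "j \<in> {..<d}" "k \<in> {..<d}"
    then show "g j \<noteq> g k"
      using g_eq_add_iff[of j "k - j"] d(2)[of "k - j"] by (auto dest: dvd_imp_le)
  qed auto
  moreover have "g ` {..<d} = carrier G"
  proof
    show "carrier G \<subseteq> g ` {..<d}"
    proof
      fix x assume "x \<in> carrier G"
      then obtain k where k: "x = g k" by (rule g_obtain)
      have "g k = g (k mod d + d * (k div d))" by simp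
      also have "\<dots> = g (k mod d)"
        unfolding g_eq_add_iff using d(2)[of "d * (k div d)"] by simp
      finally show "x \<in> g ` {..<d}"
        using k d(1) by auto
    qed
  qed auto
  ultimately have "n = d"
    unfolding order_def by (metis card_image card_lessThan)
  then show ?thesis using d(2) by auto
qed

lemma g_n [simp]: "g n = \<one>"
  by (simp add: g_eq_one_iff)

lemma g_eq_iff: "g j = g k \<longleftrightarrow> [j = k] (mod n)"
proof -
  have *: "g (j + l) = g j \<longleftrightarrow> [j + l = j] (mod n)" for j l
    unfolding g_eq_add_iff g_eq_one_iff cong_add_lcancel_0_nat cong_0_iff ..
  show ?thesis
  proof (cases "j \<le> k")
    case True
    then show ?thesis
      using *[of j "k - j"] by (auto intro: cong_sym)
  next
    case False
    then show ?thesis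
      using *[of k "j - k"] by simp
  qed
qed

text \<open>Since \<open>g n\<close> is 1, adding n to an index amounts to applying
  \<sigma>^n.\<close>

lemma iter_n: "x \<in> carrier G \<Longrightarrow> (\<sigma> ^^ n) x = x"
proof -
  assume "x \<in> carrier G"
  then obtain k where k: "x = g k" by (rule g_obtain)
  have "(\<sigma> ^^ n) (g k) = g (n + k)"
    by (simp add: g_add)
  then show ?thesis using k by (simp add: g_eq_iff cong_def)
qed

text \<open>For d dividing n this set has n / d elements but need not be a subgroup; nilpotency of G
  makes it a normal subgroup in \<open>H_normal_invariant\<close>.\<close>

definition H :: "nat \<Rightarrow> 'a set" where "H d = g ` {k. d dvd k}"

lemma H_subset: "H d \<subseteq> carrier G"
  by (auto simp: H_def)

lemma H_n [simp]: "H n = {\<one>}"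
  unfolding H_def using g_eq_one_iff by (auto intro: image_eqI[of _ _ n])

lemma mem_H_iff:
  assumes "d dvd n"
  shows "g k \<in> H d \<longleftrightarrow> d dvd k"
proof
  assume "g k \<in> H d"
  then obtain l where "g k = g l" "d dvd l" by (auto simp: H_def)
  then have "[k = l] (mod d)"
    using assms cong_dvd_modulus_nat[of k l n d] by (simp add: g_eq_iff)
  then show "d dvd k"
    using \<open>d dvd l\<close> cong_dvd_iff by blast
qed (auto simp: H_def)

lemma card_H:
  assumes "d dvd n"
  shows "card (H d) * d = n"
proof -
  obtain c where c: "n = d * c" using assms by blast
  then have pos: "d > 0" using n_pos by (cases d) auto
  have "H d = (\<lambda>j. g (d * j)) ` {..<c}"
  proof
    show "H d \<subseteq> (\<lambda>j. g (d * j)) ` {..<c}"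
    proof
      fix x assume "x \<in> H d"
      then obtain j where j: "x = g (d * j)" by (auto simp: H_def)
      have "[d * j = d * (j mod c)] (mod n)"
        unfolding c mult_mod_right by (simp add: cong_def)
      then have "x = g (d * (j mod c))"
        using j by (simp only: g_eq_iff)
      moreover have "c > 0" using c n_pos by (cases c) auto
      ultimately show "x \<in> (\<lambda>j. g (d * j)) ` {..<c}" by auto
    qed
  qed (auto simp: H_def)
  moreover have "inj_on (\<lambda>j. g (d * j)) {..<c}"
  proof (rule inj_onI)
    fix i j assume ij: "i \<in> {..<c}" "j \<in> {..<c}" "g (d * i) = g (d * j)"
    then have "[d * i = d * j] (mod d * c)"
      by (simp add: g_eq_iff c)
    then show "i = j"
      using ij pos by (simp add: cong_def mult_mod_right[symmetric])
  qed
  ultimately have "card (H d) = c"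
    by (simp add: card_image)
  then show ?thesis using c by simp
qed

lemma invariant_subgroup_eq_H:
  assumes "subgroup S G" "\<sigma> ` S \<subseteq> S"
  obtains d where "d dvd n" "S = H d" "card S * d = n"
proof -
  obtain d where d: "d > 0" "\<And>k. g k \<in> S \<longleftrightarrow> d dvd k"
    using invariant_subgroup_index[OF assms] by blast
  have "d dvd n"
    using d(2)[of n] subgroup.one_closed[OF assms(1)] by simp
  moreover have "S = H d"
    using d(2) subgroup.subset[OF assms(1)] orb_onto unfolding H_def by blast
  ultimately show thesis
    using card_H that by blast
qed

end

section \<open>Nilpotent groups\<close>

lemma (in group) pow_card_subgroup:
  assumes "subgroup S G" "x \<in> S"
  shows "x [^] card S = \<one>"
proof -
  interpret S: group "G\<lparr>carrier := S\<rparr>"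
    using assms(1) is_group by (rule subgroup.subgroup_is_group)
  show ?thesis
    using S.pow_order_eq_1[of x] assms(2) nat_pow_consistent[of x "card S" S]
    by (simp add: order_def)
qed

lemma (in group) cauchy_subgroup:
  assumes "subgroup S G" "finite S" "prime q" "q dvd card S"
  obtains x where "x \<in> S" "x \<noteq> \<one>" "x [^] q = \<one>"
proof -
  interpret S: group "G\<lparr>carrier := S\<rparr>"
    using assms(1) is_group by (rule subgroup.subgroup_is_group)
  obtain m where m: "card S = q ^ 1 * m"
    using assms(4) by auto
  obtain T where T: "subgroup T (G\<lparr>carrier := S\<rparr>)" "card T = q ^ 1"
    using sylow_thm[OF assms(3) S.is_group, of 1 m] m assms(2) by (auto simp: order_def)
  then have "card T > 1"
    using assms(3) prime_gt_1_nat by simp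
  then obtain x where x: "x \<in> T" "x \<noteq> \<one>"
    by (metis card_le_Suc0_iff_eq card.infinite not_less One_nat_def zero_le_one)
  have "x \<in> S"
    using subgroup.subset[OF T(1)] x(1) by auto
  moreover have "x [^] q = \<one>"
    using S.pow_card_subgroup[OF T(1) x(1)] T(2) nat_pow_consistent[of x q S] by simp
  ultimately show thesis
    using that x by blast
qed

lemma (in group) conj_pow:
  assumes "x \<in> carrier G" "y \<in> carrier G"
  shows "(inv y \<otimes> x \<otimes> y) [^] (k::nat) = inv y \<otimes> x [^] k \<otimes> y"
proof (induction k)
  case (Suc k)
  have "inv y \<otimes> x [^] k \<otimes> y \<otimes> (inv y \<otimes> x \<otimes> y) = inv y \<otimes> x [^] k \<otimes> (y \<otimes> inv y) \<otimes> x \<otimes> y"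
    using assms by (simp only: m_assoc inv_closed nat_pow_closed m_closed)
  then show ?case
    using Suc assms by (simp add: m_assoc)
qed (use assms in simp)

lemma (in normal) rcoset_eq_iff:
  assumes "x \<in> carrier G" "y \<in> carrier G"
  shows "H #> x = H #> y \<longleftrightarrow> x \<otimes> inv y \<in> H"
  by (metis assms is_group rcos_module rcos_self repr_independence subgroup_axioms)

lemma (in normal) rcoset_eq_self_iff:
  assumes "x \<in> carrier G"
  shows "H #> x = H \<longleftrightarrow> x \<in> H"
  using coset_join1[OF _ assms subgroup_axioms] coset_join2[OF assms subgroup_axioms] by blast

section \<open>The lower central series and its homomorphic images\<close>

lemma (in group) lower_central_normal: "lower_central G i \<lhd> G"
proof (induction i)
  case 0
  show ?case
    using normal_inv_iff[of "carrier G"] subgroup_self by simp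
next
  case (Suc i)
  interpret L: normal "lower_central G i" G by (rule Suc)
  show ?case
    unfolding lower_central.simps commutator_subgroup_def
  proof (rule normal_generateI)
    fix c y assume "c \<in> {inv h \<otimes> inv k \<otimes> h \<otimes> k |h k. h \<in> lower_central G i \<and> k \<in> carrier G}"
      and y: "y \<in> carrier G"
    then obtain h k where hk: "c = inv h \<otimes> inv k \<otimes> h \<otimes> k" "h \<in> lower_central G i" "k \<in> carrier G"
      by blast
    have h: "h \<in> carrier G" using hk(2) by (rule L.mem_carrier)
    have conj_mult: "y \<otimes> (u \<otimes> w) \<otimes> inv y = (y \<otimes> u \<otimes> inv y) \<otimes> (y \<otimes> w \<otimes> inv y)"
      if "u \<in> carrier G" "w \<in> carrier G" for u w
      using that y by (simp add: m_assoc inv_solve_left)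
    have conj_inv: "y \<otimes> inv u \<otimes> inv y = inv (y \<otimes> u \<otimes> inv y)" if "u \<in> carrier G" for u
      using that y by (simp add: inv_mult_group m_assoc)
    have "y \<otimes> c \<otimes> inv y =
        inv (y \<otimes> h \<otimes> inv y) \<otimes> inv (y \<otimes> k \<otimes> inv y) \<otimes> (y \<otimes> h \<otimes> inv y) \<otimes> (y \<otimes> k \<otimes> inv y)"
      using h hk(1,3) y by (simp only: conj_mult conj_inv m_closed inv_closed)
    moreover have "y \<otimes> h \<otimes> inv y \<in> lower_central G i"
      using hk(2) y by (rule L.inv_op_closed2[rotated])
    ultimately show "y \<otimes> c \<otimes> inv y \<in> {inv h \<otimes> inv k \<otimes> h \<otimes> k |h k. h \<in> lower_central G i \<and> k \<in> carrier G}"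
      using hk(3) y by blast
  qed (auto dest: L.mem_carrier)
qed

lemma (in group) commutator_mem_lower_central:
  assumes "x \<in> lower_central G i" "y \<in> carrier G"
  shows "inv x \<otimes> inv y \<otimes> x \<otimes> y \<in> lower_central G (Suc i)"
  unfolding lower_central.simps commutator_subgroup_def using assms by (intro generate.incl) blast

lemma (in group_hom) lower_central_image:
  assumes "h ` carrier G = carrier H"
  shows "h ` lower_central G i = lower_central H i"
proof (induction i)
  case (Suc i)
  let ?C = "{inv u \<otimes> inv k \<otimes> u \<otimes> k |u k. u \<in> lower_central G i \<and> k \<in> carrier G}"
  have L: "lower_central G i \<subseteq> carrier G"
    using G.lower_central_normal normal_imp_subgroup subgroup.subset by blast
  have "h ` ?C = {inv\<^bsub>H\<^esub> u \<otimes>\<^bsub>H\<^esub> inv\<^bsub>H\<^esub> k \<otimes>\<^bsub>H\<^esub> u \<otimes>\<^bsub>H\<^esub> k |u k. u \<in> h ` lower_central G i \<and> k \<in> h ` carrier G}"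
    (is "_ = ?D")
  proof
    show "h ` ?C \<subseteq> ?D"
    proof
      fix z assume "z \<in> h ` ?C"
      then obtain u k where "z = h (inv u \<otimes> inv k \<otimes> u \<otimes> k)" "u \<in> lower_central G i" "k \<in> carrier G"
        by blast
      moreover from this L have "h (inv u \<otimes> inv k \<otimes> u \<otimes> k)
          = inv\<^bsub>H\<^esub> h u \<otimes>\<^bsub>H\<^esub> inv\<^bsub>H\<^esub> h k \<otimes>\<^bsub>H\<^esub> h u \<otimes>\<^bsub>H\<^esub> h k"
        by (simp add: subset_iff)
      ultimately show "z \<in> ?D" by auto
    qed
    show "?D \<subseteq> h ` ?C"
    proof
      fix z assume "z \<in> ?D"
      then obtain u k where "z = inv\<^bsub>H\<^esub> h u \<otimes>\<^bsub>H\<^esub> inv\<^bsub>H\<^esub> h k \<otimes>\<^bsub>H\<^esub> h u \<otimes>\<^bsub>H\<^esub> h k"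
          "u \<in> lower_central G i" "k \<in> carrier G"
        by blast
      moreover from this L have "h (inv u \<otimes> inv k \<otimes> u \<otimes> k)
          = inv\<^bsub>H\<^esub> h u \<otimes>\<^bsub>H\<^esub> inv\<^bsub>H\<^esub> h k \<otimes>\<^bsub>H\<^esub> h u \<otimes>\<^bsub>H\<^esub> h k"
        by (simp add: subset_iff)
      ultimately show "z \<in> h ` ?C"
        by (intro image_eqI[of _ _ "inv u \<otimes> inv k \<otimes> u \<otimes> k"]) auto
    qed
  qed
  moreover have "?C \<subseteq> carrier G"
    using L by auto
  ultimately show ?case
    unfolding lower_central.simps commutator_subgroup_def
    using generate_img[of ?C] Suc assms by simp
qed (use assms in simp)

lemma nilpotent_group_hom_image:
  fixes G (structure)
  assumes "nilpotent_group G" "group H" "h \<in> hom G H" "h ` carrier G = carrier H"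
  shows "nilpotent_group H"
proof -
  interpret group_hom G H h
    using assms by (simp add: group_hom_def group_hom_axioms_def nilpotent_group_def)
  obtain i where "lower_central G i = {\<one>}"
    using assms(1) by (auto simp: nilpotent_group_def)
  then have "lower_central H i = {\<one>\<^bsub>H\<^esub>}"
    using lower_central_image[OF assms(4), of i] by simp
  then show ?thesis
    using assms(2) by (auto simp: nilpotent_group_def)
qed

lemma nilpotent_group_FactGroup:
  assumes "nilpotent_group G" "N \<lhd> G"
  shows "nilpotent_group (G Mod N)"
  using assms(1) normal.factorgroup_is_group[OF assms(2)] normal.r_coset_hom_Mod[OF assms(2)]
  by (rule nilpotent_group_hom_image) (simp add: carrier_FactGroup)

text \<open>If \<open>x\<close> of order \<open>p\<close> lies in a term of the lower central series whose successor has order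
  prime to \<open>p\<close>, then \<open>x\<close> is central: a commutator \<open>[x, y]\<close> has order prime to \<open>p\<close>, but its
  \<open>p\<close>-th power vanishes modulo each term of the series in turn.\<close>

lemma nilpotent_central_prime_order:
  fixes G (structure)
  assumes nil: "nilpotent_group G" and fin: "finite (carrier G)"
    and p: "prime p" "p dvd order G"
  obtains x where "x \<in> carrier G" "x \<noteq> \<one>" "x [^] p = \<one>"
    "\<And>y. y \<in> carrier G \<Longrightarrow> x \<otimes> y = y \<otimes> x"
proof -
  interpret group G using nil by (simp add: nilpotent_group_def)
  let ?L = "lower_central G"
  obtain e where e: "?L e = {\<one>}"
    using nil by (auto simp: nilpotent_group_def)
  have ex: "\<exists>j. \<not> p dvd card (?L j)"
    using p(1) not_prime_unit[of p] by (intro exI[of _ e]) (auto simp: e)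
  \<comment> \<open>So p divides the order of the term just before j, and x is taken from that
    term.\<close>
  define j where "j = (LEAST j. \<not> p dvd card (?L j))"
  have j: "\<not> p dvd card (?L j)"
    unfolding j_def using ex by (rule LeastI_ex)
  have "j \<noteq> 0"
    using j p(2) by (cases "j = 0") (auto simp: order_def)
  then obtain i where i: "j = Suc i" by (cases j) auto
  have "p dvd card (?L i)"
    using not_less_Least[of i "\<lambda>j. \<not> p dvd card (?L j)"] i by (auto simp: j_def)
  have sub: "subgroup (?L k) G" for k
    using lower_central_normal normal_imp_subgroup by blast
  have "finite (?L i)"
    using subgroup.subset[OF sub] fin by (rule finite_subset)
  then obtain x where x: "x \<in> ?L i" "x \<noteq> \<one>" "x [^] p = \<one>"
    using cauchy_subgroup[OF sub _ p(1) \<open>p dvd card (?L i)\<close>] by blast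
  have xc [simp]: "x \<in> carrier G"
    using x(1) by (rule subgroup.mem_carrier[OF sub])
  have "x \<otimes> y = y \<otimes> x" if y: "y \<in> carrier G" for y
  proof -
    define c where "c = inv x \<otimes> inv y \<otimes> x \<otimes> y"
    have cj: "c \<in> ?L j"
      unfolding c_def i using x(1) y by (rule commutator_mem_lower_central)
    then have cc [simp]: "c \<in> carrier G"
      by (rule subgroup.mem_carrier[OF sub])
    have xcy: "x \<otimes> c = inv y \<otimes> x \<otimes> y"
      using y by (simp add: c_def m_assoc[symmetric])
    \<comment> \<open>Modulo the next term c commutes with x, so there 1 = (x c)^p = x^p c^p = c^p;
      note that x c is a conjugate of x. As c is also killed by the order of \<open>?L j\<close>,
      which is prime to p, it lies in the next term itself.\<close>
    have "c \<in> ?L (j + k)" for k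
    proof (induction k)
      case (Suc k)
      interpret N: normal "?L (j + Suc k)" G by (rule lower_central_normal)
      interpret q: group_hom G "G Mod ?L (j + Suc k)" "\<lambda>z. ?L (j + Suc k) #> z"
        using N.r_coset_hom_Mod N.factorgroup_is_group is_group
        by (simp add: group_hom_def group_hom_axioms_def)
      let ?q = "\<lambda>z. ?L (j + Suc k) #> z"
      define w where "w = inv c \<otimes> inv x \<otimes> c \<otimes> x"
      have w: "w \<in> ?L (j + Suc k)"
        unfolding w_def add_Suc_right using Suc xc by (rule commutator_mem_lower_central)
      have wc [simp]: "w \<in> carrier G"
        using w by (rule N.mem_carrier)
      have "c \<otimes> x = x \<otimes> c \<otimes> w"
        by (simp add: w_def m_assoc[symmetric]) (simp add: m_assoc)
      then have "?q (c \<otimes> x) = ?q (x \<otimes> c) \<otimes>\<^bsub>G Mod ?L (j + Suc k)\<^esub> ?q w"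
        by (simp only: q.hom_mult xc cc wc m_closed)
      also have "?q w = \<one>\<^bsub>G Mod ?L (j + Suc k)\<^esub>"
        using N.rcoset_eq_self_iff[OF wc] w by simp
      finally have comm: "?q x \<otimes>\<^bsub>G Mod ?L (j + Suc k)\<^esub> ?q c = ?q c \<otimes>\<^bsub>G Mod ?L (j + Suc k)\<^esub> ?q x"
        by (simp only: q.hom_mult xc cc m_closed q.H.m_closed q.H.r_one q.hom_closed)
      have "(x \<otimes> c) [^] p = \<one>"
        unfolding xcy using y x(3) by (simp add: conj_pow)
      then have "?q (x \<otimes> c) [^]\<^bsub>G Mod ?L (j + Suc k)\<^esub> p = \<one>\<^bsub>G Mod ?L (j + Suc k)\<^esub>"
        by (metis q.hom_nat_pow q.hom_one m_closed xc cc)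
      then have "?q x [^]\<^bsub>G Mod ?L (j + Suc k)\<^esub> p \<otimes>\<^bsub>G Mod ?L (j + Suc k)\<^esub> ?q c [^]\<^bsub>G Mod ?L (j + Suc k)\<^esub> p = \<one>\<^bsub>G Mod ?L (j + Suc k)\<^esub>"
        using q.H.pow_mult_distrib[OF comm, of p] by (simp only: q.hom_mult xc cc q.hom_closed)
      then have "?q (x [^] p) \<otimes>\<^bsub>G Mod ?L (j + Suc k)\<^esub> ?q (c [^] p) = \<one>\<^bsub>G Mod ?L (j + Suc k)\<^esub>"
        by (simp only: q.hom_nat_pow xc cc)
      then have "?q (c [^] p) = \<one>\<^bsub>G Mod ?L (j + Suc k)\<^esub>"
        by (simp only: x(3) q.hom_one q.H.l_one q.hom_closed nat_pow_closed cc)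
      then have "c [^] p \<in> ?L (j + Suc k)"
        using N.rcoset_eq_self_iff[of "c [^] p"] by simp
      moreover have "c [^] card (?L j) \<in> ?L (j + Suc k)"
        using pow_card_subgroup[OF sub cj] N.one_closed by simp
      ultimately have "c [^] gcd p (card (?L j)) \<in> ?L (j + Suc k)"
        by (rule subgroup_pow_gcd_mem[OF N.subgroup_axioms cc])
      moreover have "gcd p (card (?L j)) = 1"
        using prime_imp_coprime[OF p(1) j] by (simp add: coprime_iff_gcd_eq_1)
      ultimately show ?case by simp
    qed (use cj in simp)
    \<comment> \<open>Both claims meet at index j + e, where the series is already trivial.\<close>
    moreover have "?L (e + k) = {\<one>}" for k
    proof (induction k)
      case (Suc k)
      have "{inv h \<otimes> inv k \<otimes> h \<otimes> k |h k. h \<in> {\<one>} \<and> k \<in> carrier G} = {\<one>}"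
        by (auto intro!: exI[of _ "\<one>"])
      then show ?case
        using Suc generate_one by (simp add: commutator_subgroup_def)
    qed (use e in simp)
    ultimately have "c = \<one>"
      using add.commute[of e j] by (metis singletonD)
    then have "inv y \<otimes> x \<otimes> y = x"
      using xcy by simp
    then have "y \<otimes> (inv y \<otimes> x \<otimes> y) = y \<otimes> x"
      by simp
    then show ?thesis
      using y by (simp add: m_assoc[symmetric])
  qed
  then show thesis
    using that x xc by blast
qed

text \<open>The class equation for the cyclic group generated by \<tau>: orbit lengths divide
  \<open>p ^ k\<close>, so every orbit with more than one element has length divisible by p.\<close>

lemma prime_dvd_card_fixed_points:
  assumes fin: "finite S" and maps: "\<tau> ` S \<subseteq> S" and p: "prime p"
    and per: "\<And>x. x \<in> S \<Longrightarrow> (\<tau> ^^ (p ^ k)) x = x" and dvd: "p dvd card S"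
  shows "p dvd card {x \<in> S. \<tau> x = x}"
proof -
  define orbit where "orbit = (\<lambda>x. range (\<lambda>j. (\<tau> ^^ j) x))"
  let ?T = "{x \<in> S. \<tau> x \<noteq> x}"
  have it: "(\<tau> ^^ j) x \<in> S" if "x \<in> S" for x j
    using that maps by (induction j) auto
  have per': "(\<tau> ^^ (q * p ^ k + j)) x = (\<tau> ^^ j) x" if "x \<in> S" for x q j
    using that per it by (induction q) (auto simp: funpow_add add.assoc)
  have orbit_eq: "orbit y = orbit x" if xS: "x \<in> S" and y: "y \<in> orbit x" for x y
  proof -
    obtain j where j: "y = (\<tau> ^^ j) x" using y by (auto simp: orbit_def)
    \<comment> \<open>The number of steps from y back to x: \<open>r + j\<close> is a multiple of
      the period \<open>p ^ k\<close>.\<close>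
    define r where "r = j * p ^ k - j"
    have "r + j = j * p ^ k + 0"
      using p prime_gt_0_nat[of p] by (simp add: r_def)
    then have x: "(\<tau> ^^ r) y = x"
      using per'[OF xS, of j 0] funpow_add[of r j \<tau>] by (simp add: j)
    have "(\<tau> ^^ i) y = (\<tau> ^^ (i + j)) x" "(\<tau> ^^ i) x = (\<tau> ^^ (i + r)) y" for i
      by (simp_all add: funpow_add j[symmetric] x)
    then show ?thesis
      unfolding orbit_def by (metis (no_types, lifting) image_subset_iff rangeI subset_antisym)
  qed
  have card_orbit: "p dvd card (orbit x)" if "x \<in> ?T" for x
  proof -
    have ex: "\<exists>d. d > 0 \<and> (\<tau> ^^ d) x = x"
      using per that p prime_gt_0_nat[of p] by (intro exI[of _ "p ^ k"]) auto
    define d where "d = (LEAST d. d > 0 \<and> (\<tau> ^^ d) x = x)"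
    have d: "d > 0" "(\<tau> ^^ d) x = x" and least: "\<And>i. i > 0 \<Longrightarrow> i < d \<Longrightarrow> (\<tau> ^^ i) x \<noteq> x"
      using LeastI_ex[OF ex] not_less_Least[of _ "\<lambda>d. d > 0 \<and> (\<tau> ^^ d) x = x"] unfolding d_def by auto
    have red: "(\<tau> ^^ i) x = (\<tau> ^^ (i mod d)) x" for i
    proof -
      have "(\<tau> ^^ (r + q * d)) x = (\<tau> ^^ r) x" for q r
        using d(2) by (induction q) (auto simp: funpow_add add.assoc[symmetric] add.commute[of d])
      then show ?thesis by (metis mod_div_mult_eq)
    qed
    have "(\<tau> ^^ (p ^ k mod d)) x = x"
      using red[of "p ^ k"] per that by simp
    then have "d dvd p ^ k"
      using least[of "p ^ k mod d"] d(1) by (cases "p ^ k mod d = 0") auto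
    moreover have "d \<noteq> 1"
      using d(2) that by auto
    ultimately have "p dvd d"
      using p by (metis divides_primepow_nat dvd_power gr0I power_0)
    moreover have "orbit x = (\<lambda>i. (\<tau> ^^ i) x) ` {..<d}"
      unfolding orbit_def
    proof
      show "range (\<lambda>i. (\<tau> ^^ i) x) \<subseteq> (\<lambda>i. (\<tau> ^^ i) x) ` {..<d}"
      proof
        fix y assume "y \<in> range (\<lambda>i. (\<tau> ^^ i) x)"
        then obtain i where "y = (\<tau> ^^ (i mod d)) x" using red by blast
        then show "y \<in> (\<lambda>i. (\<tau> ^^ i) x) ` {..<d}" using d(1) by auto
      qed
    qed auto
    moreover have "inj_on (\<lambda>i. (\<tau> ^^ i) x) {..<d}"
    proof (rule linorder_inj_onI)
      fix i j assume ij: "i < j" "i \<in> {..<d}" "j \<in> {..<d}"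
      show "(\<tau> ^^ i) x \<noteq> (\<tau> ^^ j) x"
      proof
        assume "(\<tau> ^^ i) x = (\<tau> ^^ j) x"
        then have "(\<tau> ^^ (d - j)) ((\<tau> ^^ i) x) = (\<tau> ^^ (d - j)) ((\<tau> ^^ j) x)" by simp
        then have "(\<tau> ^^ (d - j + i)) x = (\<tau> ^^ (d - j + j)) x" by (simp only: funpow_add o_apply)
        then have "(\<tau> ^^ (d - j + i)) x = x" using d ij by simp
        moreover have "0 < d - j + i" "d - j + i < d" using ij by auto
        then have "(\<tau> ^^ (d - j + i)) x \<noteq> x" by (rule least)
        ultimately show False by contradiction
      qed
    qed auto
    ultimately show ?thesis by (simp add: card_image)
  qed
  have "\<Union> (orbit ` ?T) = ?T"
  proof
    show "?T \<subseteq> \<Union> (orbit ` ?T)"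
    proof
      fix x assume "x \<in> ?T"
      moreover have "x \<in> orbit x"
        unfolding orbit_def by (rule range_eqI[of _ _ 0]) simp
      ultimately show "x \<in> \<Union> (orbit ` ?T)" by blast
    qed
    show "\<Union> (orbit ` ?T) \<subseteq> ?T"
    proof clarify
      fix x y assume x: "x \<in> S" "\<tau> x \<noteq> x" and y: "y \<in> orbit x"
      have "y \<in> S" using y it[OF x(1)] by (auto simp: orbit_def)
      moreover have "\<tau> y \<noteq> y"
      proof
        assume "\<tau> y = y"
        then have "(\<tau> ^^ j) y = y" for j by (induction j) auto
        then have "orbit y = {y}" by (auto simp: orbit_def)
        then have "orbit x = {y}" using orbit_eq[OF x(1) y] by simp
        moreover have "x \<in> orbit x" "\<tau> x \<in> orbit x"
          unfolding orbit_def by (rule range_eqI[of _ _ 0], simp, rule range_eqI[of _ _ 1], simp)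
        ultimately show False using x(2) by auto
      qed
      ultimately show "y \<in> S \<and> \<tau> y \<noteq> y" by blast
    qed
  qed
  moreover have "p dvd card (\<Union> (orbit ` ?T))"
  proof (rule dvd_partition)
    show "finite (\<Union> (orbit ` ?T))"
      using \<open>\<Union> (orbit ` ?T) = ?T\<close> fin by simp
    show "\<forall>c\<in>orbit ` ?T. p dvd card c"
      using card_orbit by blast
    show "\<forall>c1\<in>orbit ` ?T. \<forall>c2\<in>orbit ` ?T. c1 \<noteq> c2 \<longrightarrow> c1 \<inter> c2 = {}"
      using orbit_eq by blast
  qed
  moreover have "card S = card ?T + card {x \<in> S. \<tau> x = x}"
    using fin card_Un_disjoint[of ?T "{x \<in> S. \<tau> x = x}"]
    by (simp add: Un_def disjoint_iff Collect_conj_eq[symmetric] conj_disj_distribL[symmetric])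
  ultimately show ?thesis
    using dvd by (simp add: dvd_add_right_iff)
qed

section \<open>Invariant subgroups of a cycle\<close>

context hol_cycle
begin

lemma iter_fixed_mult:
  assumes "(\<sigma> ^^ m) x = x"
  shows "(\<sigma> ^^ (m * r)) x = x"
  using assms by (induction r) (simp_all add: funpow_add)

lemma iter_commute: "(\<sigma> ^^ m) (\<sigma> x) = \<sigma> ((\<sigma> ^^ m) x)"
  by (induction m) auto

text \<open>F is not trivial because \<sigma>^m has p-power order on \<open>Om\<close>, whose
  cardinality is divisible by p. F has exponent p and hence order prime to m; with F =
  \<open>H d\<close> and |F| d = n this forces m to divide d. Therefore \<sigma>^d is the identity
  on F, the terms \<open>g (j * d)\<close> are the powers of \<open>g d\<close>, and F is cyclic of
  order p.\<close>

lemma central_prime_subgroup: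
  assumes nil: "nilpotent_group G" and p: "prime p" and n: "n = p ^ k * m" "k > 0" "\<not> p dvd m"
  shows "subgroup (H (n div p)) G"
    and "\<And>x y. x \<in> H (n div p) \<Longrightarrow> y \<in> carrier G \<Longrightarrow> x \<otimes> y = y \<otimes> x"
    and "\<And>x. x \<in> H (n div p) \<Longrightarrow> (\<sigma> ^^ m) x = x"
    and "\<sigma> ` H (n div p) \<subseteq> H (n div p)"
proof -
  define Om where "Om = {z \<in> carrier G. z [^] p = \<one> \<and> (\<forall>y\<in>carrier G. z \<otimes> y = y \<otimes> z)}"
  define F where "F = {z \<in> Om. (\<sigma> ^^ m) z = z}"
  have mult_central: "u \<otimes> w \<otimes> y = y \<otimes> (u \<otimes> w)"
    if "u \<in> Om" "w \<in> Om" "y \<in> carrier G" for u w y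
  proof -
    have c: "u \<in> carrier G" "w \<in> carrier G" and "w \<otimes> y = y \<otimes> w" "u \<otimes> y = y \<otimes> u"
      using that by (auto simp: Om_def)
    then show ?thesis
      using that(3) by (metis m_assoc)
  qed
  have subOm: "subgroup Om G"
  proof (rule subgroupI)
    show "Om \<subseteq> carrier G" by (auto simp: Om_def)
    show "Om \<noteq> {}" by (auto simp: Om_def intro!: exI[of _ \<one>])
    fix u assume u: "u \<in> Om"
    then have uc: "u \<in> carrier G" by (simp add: Om_def)
    have "inv u \<otimes> y = y \<otimes> inv u" if "y \<in> carrier G" for y
    proof -
      have "inv u \<otimes> y = inv u \<otimes> (y \<otimes> u) \<otimes> inv u"
        using uc that by (simp add: m_assoc)
      also have "y \<otimes> u = u \<otimes> y"
        using u that by (simp add: Om_def)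
      also have "inv u \<otimes> (u \<otimes> y) \<otimes> inv u = y \<otimes> inv u"
        using uc that by (simp add: m_assoc[symmetric])
      finally show ?thesis .
    qed
    moreover have "inv u [^] p = \<one>"
      using u by (simp add: Om_def nat_pow_inv)
    ultimately show "inv u \<in> Om"
      using uc by (simp add: Om_def)
    fix w assume w: "w \<in> Om"
    then have wc: "w \<in> carrier G"
      unfolding Om_def by blast
    have "u \<otimes> w = w \<otimes> u" "u [^] p = \<one>" "w [^] p = \<one>"
      using u w wc unfolding Om_def by blast+
    then have "(u \<otimes> w) [^] p = \<one>"
      using pow_mult_distrib[of u w p] uc wc by simp
    then show "u \<otimes> w \<in> Om"
      unfolding Om_def using uc wc mult_central[OF u w] by blast
  qed
  have sigOm: "\<sigma> z \<in> Om" if "z \<in> Om" for z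
  proof -
    have zc: "z \<in> carrier G" using that by (simp add: Om_def)
    have "\<sigma> z \<otimes> y = y \<otimes> \<sigma> z" if y: "y \<in> carrier G" for y
    proof -
      obtain y' where y': "y' \<in> carrier G" "y = \<sigma> y'"
        using y bij by (metis bij_betw_def imageE)
      then have "\<sigma> (z \<otimes> y') = \<sigma> (y' \<otimes> z)"
        using \<open>z \<in> Om\<close> by (simp add: Om_def)
      then show ?thesis using y' zc by simp
    qed
    moreover have "\<sigma> z [^] p = \<one>"
      using iter_pow[OF zc, of 1 p] that by (simp add: Om_def)
    ultimately show ?thesis using zc by (simp add: Om_def)
  qed
  then have itOm: "(\<sigma> ^^ j) z \<in> Om" if "z \<in> Om" for z j
    using that by (induction j) auto
  have subF: "subgroup F G"
  proof (rule subgroupI)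
    show "F \<subseteq> carrier G" by (auto simp: F_def Om_def)
    show "F \<noteq> {}" using subgroup.one_closed[OF subOm] by (auto simp: F_def)
    fix u assume u: "u \<in> F"
    then have uc: "u \<in> carrier G" by (simp add: F_def Om_def)
    have "(\<sigma> ^^ m) (inv u) \<otimes> (\<sigma> ^^ m) u = \<one>"
      using uc by (simp flip: iter_mult)
    then have "(\<sigma> ^^ m) (inv u) = inv u"
      using u uc by (simp add: F_def inv_equality[symmetric])
    then show "inv u \<in> F"
      using u subgroup.m_inv_closed[OF subOm] by (simp add: F_def)
    fix w assume w: "w \<in> F"
    then have "w \<in> carrier G" by (simp add: F_def Om_def)
    then show "u \<otimes> w \<in> F"
      using u w uc subgroup.m_closed[OF subOm] by (simp add: F_def)
  qed
  have sigF: "\<sigma> ` F \<subseteq> F"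
    using sigOm by (auto simp: F_def iter_commute)
  have finOm: "finite Om"
    using fin by (auto simp: Om_def)
  have pn: "p dvd n"
    using n(1,2) by (simp add: dvd_power)
  obtain x0 where x0: "x0 \<in> carrier G" "x0 \<noteq> \<one>" "x0 [^] p = \<one>"
    "\<And>y. y \<in> carrier G \<Longrightarrow> x0 \<otimes> y = y \<otimes> x0"
    using nilpotent_central_prime_order[OF nil fin p pn] by blast
  have "p dvd card Om"
  proof (rule ccontr)
    assume "\<not> p dvd card Om"
    then have "gcd p (card Om) = 1"
      using prime_imp_coprime[OF p] by (simp add: coprime_iff_gcd_eq_1)
    moreover have "x0 [^] card Om = \<one>"
      using pow_card_subgroup[OF subOm, of x0] x0 by (simp add: Om_def)
    ultimately have "x0 \<in> {\<one>}"
      using subgroup_pow_gcd_mem[of "{\<one>}" x0 p "card Om"] x0 one_is_normal normal_imp_subgroup[of "{\<one>}" G]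
      by simp
    then show False using x0(2) by simp
  qed
  have pF: "p dvd card F"
    unfolding F_def
  proof (rule prime_dvd_card_fixed_points[OF finOm _ p _ \<open>p dvd card Om\<close>])
    show "(\<sigma> ^^ m) ` Om \<subseteq> Om" using itOm by blast
    fix x assume "x \<in> Om"
    then have "(\<sigma> ^^ n) x = x" by (intro iter_n) (simp add: Om_def)
    then show "((\<sigma> ^^ m) ^^ p ^ k) x = x"
      by (simp add: funpow_mult n(1) mult.commute)
  qed
  obtain d where d: "d dvd n" "F = H d" "card F * d = n"
    using invariant_subgroup_eq_H[OF subF sigF] by blast
  have finF: "finite F" using finOm by (auto simp: F_def)
  have "coprime m (card F)"
  proof (rule ccontr)
    assume "\<not> coprime m (card F)"
    then obtain q where q: "prime q" "q dvd m" "q dvd card F"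
      using prime_factor_nat[of "gcd m (card F)"] by (auto simp: coprime_iff_gcd_eq_1)
    obtain x where x: "x \<in> F" "x \<noteq> \<one>" "x [^] q = \<one>"
      using cauchy_subgroup[OF subF finF q(1,3)] by blast
    have "p \<noteq> q" using q(2) n(3) by auto
    then have "gcd p q = 1"
      using p q(1) by (simp add: primes_coprime coprime_iff_gcd_eq_1[symmetric])
    then have "x \<in> {\<one>}"
      using subgroup_pow_gcd_mem[of "{\<one>}" x p q] x one_is_normal normal_imp_subgroup[of "{\<one>}" G]
      by (simp add: F_def Om_def)
    then show False using x(2) by simp
  qed
  moreover have "m dvd card F * d"
    using d(3) n(1) by simp
  ultimately have "m dvd d"
    by (simp add: coprime_dvd_mult_right_iff)
  then obtain r where r: "d = m * r" by (rule dvdE)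
  have fixF: "(\<sigma> ^^ d) x = x" if "x \<in> F" for x
    unfolding r by (rule iter_fixed_mult) (use that in \<open>simp add: F_def\<close>)
  have gd: "g d \<in> F"
    unfolding d(2) mem_H_iff[OF d(1)] by simp
  have gpow: "g (j * d) = g d [^] j" for j
  proof (induction j)
    case (Suc j)
    have "g d [^] j \<in> F"
      using subF gd by (rule subgroup_pow_mem)
    then show ?case
      using Suc fixF by (simp add: g_add)
  qed simp
  have "F \<subseteq> (\<lambda>j. g d [^] j) ` {..<p}"
  proof
    fix x assume "x \<in> F"
    then obtain j where "x = g (j * d)"
      unfolding d(2) H_def by (metis (mono_tags) dvdE imageE mem_Collect_eq mult.commute)
    then have "x = g d [^] (p * (j div p) + j mod p)"
      using gpow by simp
    also have "\<dots> = (g d [^] p) [^] (j div p) \<otimes> g d [^] (j mod p)"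
      by (simp only: nat_pow_mult nat_pow_pow g_closed)
    also have "\<dots> = g d [^] (j mod p)"
      using gd by (simp add: F_def Om_def)
    finally show "x \<in> (\<lambda>j. g d [^] j) ` {..<p}"
      using p prime_gt_0_nat[of p] by auto
  qed
  then have "card F \<le> p"
    using card_mono[of "(\<lambda>j. g d [^] j) ` {..<p}" F] card_image_le[of "{..<p}" "\<lambda>j. g d [^] j"]
    by simp
  moreover have "card F \<noteq> 0"
    using d(3) n_pos by (metis mult_0 less_irrefl)
  ultimately have "card F = p"
    using pF by (meson dvd_imp_le gr0I le_antisym)
  then have "d = n div p"
    using d(3) p prime_gt_0_nat[of p] by (metis nonzero_mult_div_cancel_left less_numeral_extra(3))
  then have F: "H (n div p) = F" using d(2) by simp
  show "subgroup (H (n div p)) G" unfolding F by (rule subF)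
  show "\<And>x y. x \<in> H (n div p) \<Longrightarrow> y \<in> carrier G \<Longrightarrow> x \<otimes> y = y \<otimes> x"
    unfolding F by (simp add: F_def Om_def)
  show "\<And>x. x \<in> H (n div p) \<Longrightarrow> (\<sigma> ^^ m) x = x"
    unfolding F by (simp add: F_def)
  show "\<sigma> ` H (n div p) \<subseteq> H (n div p)"
    unfolding F by (rule sigF)
qed

section \<open>Cycles on quotients by invariant normal subgroups\<close>

lemma image_rcoset:
  assumes S: "S \<lhd> G" "\<sigma> ` S \<subseteq> S" and x: "x \<in> carrier G"
  shows "\<sigma> ` (S #> x) = S #> \<sigma> x"
proof -
  interpret S: normal S G by (rule S(1))
  have "finite S" using S.subset fin by (rule finite_subset)
  moreover have "inj_on \<sigma> S"
    using bij_betw_imp_inj_on[OF bij] S.subset by (rule inj_on_subset)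
  ultimately have "\<sigma> ` S = S"
    using S(2) endo_inj_surj[of S \<sigma>] by simp
  have "\<sigma> ` (S #> x) = (\<lambda>s. \<sigma> s \<otimes> \<sigma> x) ` S"
    using x S.subset by (auto simp: r_coset_def image_iff subset_iff)
  also have "\<dots> = (\<lambda>s. s \<otimes> \<sigma> x) ` (\<sigma> ` S)"
    by (simp add: image_image)
  finally show ?thesis
    unfolding \<open>\<sigma> ` S = S\<close> by (auto simp: r_coset_def)
qed

lemma orb_FactGroup:
  assumes S: "S \<lhd> G" "\<sigma> ` S \<subseteq> S"
  shows "orb (G Mod S) ((`) \<sigma>) (S #> a) k = S #> g k"
proof (induction k)
  case 0
  show ?case
    using normal_imp_subgroup[OF S(1)] coset_join2[of \<one> S] by (simp add: subgroup.one_closed)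
next
  case (Suc k)
  then show ?case
    using image_rcoset[OF S, of "g k"] normal.rcos_sum[OF S(1), of "\<sigma> (g k)" a] by simp
qed

text \<open>Injectivity on cosets is \<open>iter_mem_iff\<close>: if \<sigma> sends x y^-1 into S,
  then x y^-1 is in S.\<close>

lemma hol_cycle_FactGroup:
  assumes S: "S \<lhd> G" "\<sigma> ` S \<subseteq> S"
  shows "hol_cycle (G Mod S) ((`) \<sigma>) (S #> a)"
proof -
  interpret S: normal S G by (rule S(1))
  interpret Q: group "G Mod S" by (rule S.factorgroup_is_group)
  have finQ: "finite (carrier (G Mod S))"
    using fin by (simp add: carrier_FactGroup)
  have homQ: "(`) \<sigma> \<in> hom (G Mod S) (G Mod S)"
  proof (rule homI)
    fix C D assume CD: "C \<in> carrier (G Mod S)" "D \<in> carrier (G Mod S)"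
    then obtain x y where xy: "x \<in> carrier G" "y \<in> carrier G" "C = S #> x" "D = S #> y"
      by (auto simp: carrier_FactGroup)
    then show "\<sigma> ` C \<in> carrier (G Mod S)"
      using image_rcoset[OF S] by (auto simp: carrier_FactGroup)
    show "\<sigma> ` (C \<otimes>\<^bsub>G Mod S\<^esub> D) = \<sigma> ` C \<otimes>\<^bsub>G Mod S\<^esub> \<sigma> ` D"
      using xy image_rcoset[OF S] by (simp add: S.rcos_sum)
  qed
  have injQ: "inj_on ((`) \<sigma>) (carrier (G Mod S))"
  proof (rule inj_onI)
    fix C D assume CD: "C \<in> carrier (G Mod S)" "D \<in> carrier (G Mod S)" "\<sigma> ` C = \<sigma> ` D"
    then obtain x y where xy: "x \<in> carrier G" "y \<in> carrier G" "C = S #> x" "D = S #> y"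
      by (auto simp: carrier_FactGroup)
    then have "S #> \<sigma> x = S #> \<sigma> y"
      using CD(3) image_rcoset[OF S] by simp
    then have "\<sigma> (x \<otimes> inv y) \<in> S"
      using xy by (simp add: S.rcoset_eq_iff)
    then have "x \<otimes> inv y \<in> S"
      using iter_mem_iff[OF S.subgroup_axioms S(2), of "x \<otimes> inv y" 1] xy by simp
    then show "C = D"
      using xy by (simp add: S.rcoset_eq_iff)
  qed
  have "(`) \<sigma> ` carrier (G Mod S) \<subseteq> carrier (G Mod S)"
    using homQ by (auto simp: hom_def)
  then have "bij_betw ((`) \<sigma>) (carrier (G Mod S)) (carrier (G Mod S))"
    using injQ finQ by (simp add: bij_betw_def endo_inj_surj)
  moreover have "carrier (G Mod S) \<subseteq> range (orb (G Mod S) ((`) \<sigma>) (S #> a))"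
  proof
    fix C assume "C \<in> carrier (G Mod S)"
    then obtain x where "x \<in> carrier G" "C = S #> x"
      by (auto simp: carrier_FactGroup)
    then show "C \<in> range (orb (G Mod S) ((`) \<sigma>) (S #> a))"
      using orb_onto orb_FactGroup[OF S] by force
  qed
  ultimately show ?thesis
    using finQ homQ by unfold_locales (auto simp: carrier_FactGroup)
qed

lemma H_FactGroup:
  assumes "d dvd n" "H d \<lhd> G" "\<sigma> ` H d \<subseteq> H d"
  shows "order (G Mod H d) = d"
proof -
  have "order (G Mod H d) * card (H d) = n"
    using lagrange[OF normal_imp_subgroup[OF assms(2)]] by (simp add: order_def FactGroup_def)
  moreover have "card (H d) * d = n"
    using assms(1) by (rule card_H)
  ultimately show ?thesis
    using n_pos by (metis mult.commute mult_cancel1 not_less_zero mult_0)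
qed

text \<open>\<open>central_prime_subgroup\<close> for the quotient by \<open>H d\<close>, which has
  order d; hence m is the prime-to-p part of d here. Taking preimages turns centrality into
  normality, and the last claim says that \<sigma>^m acts trivially on the section.\<close>

lemma H_step:
  assumes nil: "nilpotent_group G" and Hd: "d dvd n" "H d \<lhd> G" "\<sigma> ` H d \<subseteq> H d"
    and p: "prime p" and d: "d = p ^ k * m" "k > 0" "\<not> p dvd m"
  shows "H (d div p) \<lhd> G" and "\<sigma> ` H (d div p) \<subseteq> H (d div p)"
    and "\<And>x. x \<in> H (d div p) \<Longrightarrow> (\<sigma> ^^ m) x \<otimes> inv x \<in> H d"
proof -
  interpret S: normal "H d" G by (rule Hd(2))
  interpret Q: hol_cycle "G Mod H d" "(`) \<sigma>" "H d #> a"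
    using Hd(2,3) by (rule hol_cycle_FactGroup)
  have orbQ: "Q.g k = H d #> g k" for k
    using Hd(2,3) by (rule orb_FactGroup)
  have ordQ: "order (G Mod H d) = d"
    using Hd by (rule H_FactGroup)
  have nilQ: "nilpotent_group (G Mod H d)"
    using nil Hd(2) by (rule nilpotent_group_FactGroup)
  note Q = Q.central_prime_subgroup[OF nilQ p, unfolded ordQ, OF d]
  have pd: "d div p dvd d"
    using d by (metis dvd_div_mult_self dvd_mult2 dvd_power dvd_triv_left)
  then have pn: "d div p dvd n"
    using Hd(1) by (rule dvd_trans)
  have mem: "x \<in> H (d div p) \<longleftrightarrow> H d #> x \<in> Q.H (d div p)" if x: "x \<in> carrier G" for x
  proof -
    obtain k where k: "x = g k" using x by (rule g_obtain)
    then show ?thesis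
      using mem_H_iff[OF pn, of k] Q.mem_H_iff[of "d div p" k] pd by (simp add: ordQ orbQ)
  qed
  have q: "group_hom G (G Mod H d) (\<lambda>x. H d #> x)"
    using S.r_coset_hom_Mod S.factorgroup_is_group is_group
    by (simp add: group_hom_def group_hom_axioms_def)
  then interpret q: group_hom G "G Mod H d" "\<lambda>x. H d #> x" .
  have sub: "subgroup (H (d div p)) G"
  proof (rule subgroupI)
    show "H (d div p) \<subseteq> carrier G" by (rule H_subset)
    have "g 0 \<in> H (d div p)" unfolding mem_H_iff[OF pn] by simp
    then show "H (d div p) \<noteq> {}" by blast
    fix u assume u: "u \<in> H (d div p)"
    then have uc: "u \<in> carrier G" using H_subset by blast
    then have "H d #> inv u = inv\<^bsub>G Mod H d\<^esub> (H d #> u)"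
      by (rule q.hom_inv)
    then show "inv u \<in> H (d div p)"
      using u uc mem subgroup.m_inv_closed[OF Q(1)] by simp
    fix w assume w: "w \<in> H (d div p)"
    then have wc: "w \<in> carrier G" using H_subset by blast
    have "H d #> (u \<otimes> w) = (H d #> u) \<otimes>\<^bsub>G Mod H d\<^esub> (H d #> w)"
      using uc wc by (rule q.hom_mult)
    then show "u \<otimes> w \<in> H (d div p)"
      using u w uc wc mem subgroup.m_closed[OF Q(1)] by simp
  qed
  show "H (d div p) \<lhd> G"
    unfolding normal_inv_iff
  proof (intro conjI ballI sub)
    fix y x assume y: "y \<in> carrier G" and x: "x \<in> H (d div p)"
    then have xc: "x \<in> carrier G" using H_subset by blast
    have "H d #> (y \<otimes> x \<otimes> inv y) = (H d #> y) \<otimes>\<^bsub>G Mod H d\<^esub> (H d #> x) \<otimes>\<^bsub>G Mod H d\<^esub> (H d #> inv y)"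
      using xc y by (simp only: q.hom_mult m_closed inv_closed)
    also have "\<dots> = (H d #> x) \<otimes>\<^bsub>G Mod H d\<^esub> (H d #> y) \<otimes>\<^bsub>G Mod H d\<^esub> (H d #> inv y)"
      using Q(2)[of "H d #> x" "H d #> y"] x mem[OF xc] q.hom_closed[OF y] by simp
    also have "\<dots> = H d #> (x \<otimes> y \<otimes> inv y)"
      using xc y by (simp only: q.hom_mult m_closed inv_closed)
    also have "\<dots> = H d #> x"
      using xc y by (simp add: m_assoc)
    finally show "y \<otimes> x \<otimes> inv y \<in> H (d div p)"
      using x xc y mem by simp
  qed
  have sig: "(\<sigma> ^^ j) ` (H d #> x) = H d #> (\<sigma> ^^ j) x" if "x \<in> carrier G" for x j
  proof (induction j)
    case (Suc j)
    have "(\<sigma> ^^ Suc j) ` (H d #> x) = \<sigma> ` ((\<sigma> ^^ j) ` (H d #> x))"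
      by (simp add: image_comp)
    then show ?case
      using Suc image_rcoset[OF Hd(2,3)] that by simp
  qed simp
  have itimg: "((`) \<sigma> ^^ j) C = (\<sigma> ^^ j) ` C" for j C
    by (induction j) (simp_all add: image_comp)
  show "(\<sigma> ^^ m) x \<otimes> inv x \<in> H d" if x: "x \<in> H (d div p)" for x
  proof -
    have xc: "x \<in> carrier G" using x H_subset by blast
    have "H d #> (\<sigma> ^^ m) x = H d #> x"
      using Q(3)[of "H d #> x"] x xc mem sig[OF xc] itimg by simp
    then show ?thesis using xc by (simp add: S.rcoset_eq_iff)
  qed
  have "\<sigma> x \<in> H (d div p)" if x: "x \<in> H (d div p)" for x
  proof -
    have xc: "x \<in> carrier G" using x H_subset by blast
    then have "\<sigma> ` (H d #> x) \<in> Q.H (d div p)"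
      using Q(4) x mem by blast
    then show ?thesis
      using image_rcoset[OF Hd(2,3) xc] mem xc by simp
  qed
  then show "\<sigma> ` H (d div p) \<subseteq> H (d div p)" by blast
qed

text \<open>Induction on the cofactor c of d, starting from the trivial group \<open>H n\<close>: if
  p divides c, then \<open>H (d * p)\<close> has the smaller cofactor c / p, and
  \<open>H_step\<close> removes the factor p.\<close>

lemma H_normal_invariant:
  assumes nil: "nilpotent_group G" and "d dvd n"
  shows "H d \<lhd> G \<and> \<sigma> ` H d \<subseteq> H d"
proof -
  obtain c where "n = d * c" using assms(2) by blast
  then show ?thesis
  proof (induction c arbitrary: d rule: less_induct)
    case (less c)
    show ?case
    proof (cases "c = 1")
      case True
      then show ?thesis
        using less.prems one_is_normal H_n by simp
    next
      case False
      then obtain p where p: "prime p" "p dvd c"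
        using prime_factor_nat by blast
      then obtain c' where c': "c = p * c'" by blast
      have c0: "c > 0" using less.prems n_pos by (cases c) auto
      then have "c' < c"
        using c' prime_gt_1_nat[OF p(1)] mult_less_mono1[of 1 p c'] by (cases "c' = 0") auto
      then have IH: "H (d * p) \<lhd> G \<and> \<sigma> ` H (d * p) \<subseteq> H (d * p)"
        using less.IH[of c' "d * p"] less.prems by (simp add: c' mult.assoc)
      have "d * p > 0" using less.prems n_pos c' by (cases "d * p") auto
      have npu: "\<not> is_unit p" using p(1) not_prime_unit by blast
      obtain m where m: "d * p = p ^ multiplicity p (d * p) * m" "\<not> p dvd m"
        using \<open>d * p > 0\<close> multiplicity_decompose'[of "d * p" p, OF _ npu] by (metis less_not_refl2)
      have "multiplicity p (d * p) > 0"
        using p(1) \<open>d * p > 0\<close> by (simp add: prime_multiplicity_gt_zero_iff)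
      then have "H (d * p div p) \<lhd> G \<and> \<sigma> ` H (d * p div p) \<subseteq> H (d * p div p)"
        using H_step(1,2)[OF nil _ _ _ p(1) m(1) _ m(2)] IH less.prems c' by (auto simp: mult.assoc)
      then show ?thesis
        using p(1) prime_gt_0_nat[of p] by simp
    qed
  qed
qed

text \<open>Write \<open>c = g (p ^ j)\<close> and \<open>\<sigma> c = w\<^sub>0 c\<close>. Then \<open>w\<^sub>0\<close> is central of order dividing \<open>p\<close>, and the
  cocycle identity gives \<open>g (p ^ j l) = c ^ l w ^ (l (l - 1) / 2)\<close> with \<open>w = w\<^sub>0 ^ (p ^ j)\<close>.\<close>

lemma g_pow_prime_absolute:
  assumes nil: "nilpotent_group G" and p: "prime p" and n: "n = p ^ (j + 2)"
    and oj: "odd p \<or> j \<ge> 1" and k: "p ^ j dvd k" "\<not> p ^ (j + 1) dvd k"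
  shows "\<exists>k'. g k [^] p = g k' \<and> p ^ (j + 1) dvd k' \<and> \<not> p ^ (j + 2) dvd k'"
proof -
  define d where "d = p ^ j"
  let ?H1 = "H (p ^ (j + 1))"
  have p0: "p > 0" using p prime_gt_0_nat by blast
  have np: "n div p = p ^ (j + 1)" using n p0 by simp
  \<comment> \<open>In a p-group the prime-to-p part m is 1, so \<sigma> itself acts trivially on
    the sections of order p.\<close>
  have n': "n = p ^ (j + 2) * 1" using n by simp
  have p1: "\<not> p dvd 1" using p not_prime_unit by blast
  have "j + 2 > 0" by simp
  note central = central_prime_subgroup[OF nil p n' this p1, unfolded np]
  have dvd1: "p ^ (j + 1) dvd n" unfolding n by (simp add: le_imp_power_dvd)
  have card1: "card ?H1 = p"
    using card_H[OF dvd1] n p0 by simp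
  have pow1: "x [^] p = \<one>" if "x \<in> ?H1" for x
    using pow_card_subgroup[OF central(1) that] by (simp only: card1)
  have H1: "?H1 \<lhd> G" "\<sigma> ` ?H1 \<subseteq> ?H1"
    using H_normal_invariant[OF nil dvd1] by auto
  have step: "\<sigma> x \<otimes> inv x \<in> ?H1" if "x \<in> H (p ^ j)" for x
    using H_step(3)[OF nil dvd1 H1 p, of "j + 1" 1 x] that p0 p1 by simp
  define c where "c = g d"
  have cc [simp]: "c \<in> carrier G" by (simp add: c_def)
  define w0 where "w0 = \<sigma> c \<otimes> inv c"
  have w0: "w0 \<in> ?H1"
    unfolding w0_def by (rule step) (auto simp: c_def d_def H_def)
  have w0c [simp]: "w0 \<in> carrier G" using w0 H_subset by blast
  have sw0: "\<sigma> w0 = w0" using central(3)[of w0] w0 by simp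
  have spow: "\<sigma> (w0 [^] r) = w0 [^] r" for r :: nat
    using iter_pow[OF w0c, of 1 r] sw0 by simp
  have sc: "\<sigma> c = w0 \<otimes> c"
    by (simp add: w0_def m_assoc)
  have it: "(\<sigma> ^^ r) c = w0 [^] r \<otimes> c" for r
    by (induction r) (simp_all add: sc spow m_assoc[symmetric])
  define w where "w = w0 [^] d"
  have w: "w \<in> ?H1"
    unfolding w_def using central(1) w0 by (rule subgroup_pow_mem)
  have wc [simp]: "w \<in> carrier G" using w H_subset by blast
  define T where "T = (\<lambda>l::nat. \<Sum>i<l. i)"
  have wpow: "w [^] r \<in> ?H1" for r :: nat
    using central(1) w by (rule subgroup_pow_mem)
  have form: "g (d * l) = c [^] l \<otimes> w [^] T l" for l
  proof (induction l)
    case (Suc l)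
    have "g (d * Suc l) = g (d * l + d)" by (simp add: add.commute)
    also have "\<dots> = w0 [^] (d * l) \<otimes> c \<otimes> (c [^] l \<otimes> w [^] T l)"
      by (simp add: g_add Suc it flip: c_def)
    also have "w0 [^] (d * l) = w [^] l"
      by (simp add: w_def nat_pow_pow)
    also have "w [^] l \<otimes> c \<otimes> (c [^] l \<otimes> w [^] T l) = (c \<otimes> c [^] l) \<otimes> (w [^] l \<otimes> w [^] T l)"
    proof -
      have "w [^] l \<otimes> (c \<otimes> c [^] l) = (c \<otimes> c [^] l) \<otimes> w [^] l"
        using central(2)[OF wpow] by simp
      then show ?thesis
        by (metis m_assoc m_closed nat_pow_closed cc wc)
    qed
    also have "\<dots> = c [^] Suc l \<otimes> w [^] T (Suc l)"
      by (simp only: nat_pow_Suc2[OF cc, symmetric]) (simp add: T_def nat_pow_mult add.commute)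
    finally show ?case .
  qed (simp add: T_def)
  \<comment> \<open>\<open>T p\<close> is p (p - 1) / 2, a multiple of p for odd p; and for j > 0
    the element w is a power of \<open>w0 [^] p\<close> and already trivial. Only p = 2 with j = 0
    escapes.\<close>
  have "w [^] T p = \<one>"
  proof (cases "j \<ge> 1")
    case True
    then obtain j' where "j = Suc j'" by (cases j) auto
    then have "w = (w0 [^] p) [^] (p ^ j')"
      by (simp add: w_def d_def nat_pow_pow)
    then show ?thesis using pow1[OF w0] by simp
  next
    case False
    then have "odd p" using oj by simp
    then have "coprime p 2" by simp
    moreover have "p dvd 2 * T p"
      using double_sum_lessThan[of p] by (simp add: T_def)
    ultimately have "p dvd T p"
      using coprime_dvd_mult_right_iff by blast
    then obtain q where "T p = p * q" by blast
    then show ?thesis using pow1[OF w] by (simp add: nat_pow_pow[symmetric])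
  qed
  then have cp: "c [^] p = g (d * p)"
    using form[of p] by simp
  obtain l where l: "k = d * l" using k(1) by (auto simp: d_def)
  have pl: "\<not> p dvd l"
    using k(2) by (auto simp: l d_def)
  have "g k [^] p = (c [^] l) [^] p \<otimes> (w [^] T l) [^] p"
    unfolding l form using central(2)[OF wpow, of "c [^] l"] by (intro pow_mult_distrib) auto
  also have "\<dots> = (c [^] p) [^] l"
    using pow1[OF wpow, of "T l"] by (simp only: nat_pow_pow cc mult.commute[of p l]) (simp add: nat_pow_pow)
  finally have gk: "g k [^] p = g (d * p) [^] l"
    using cp by simp
  have dp: "d * p = p ^ (j + 1)" by (simp add: d_def)
  have gdp: "g (d * p) \<in> ?H1" by (auto simp: H_def dp)
  have "g (d * p) [^] l \<in> ?H1"
    using central(1) gdp by (rule subgroup_pow_mem)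
  then obtain k' where k': "g (d * p) [^] l = g k'" "p ^ (j + 1) dvd k'"
    unfolding H_def by auto
  \<comment> \<open>Otherwise \<open>g (d * p)\<close> would be killed by the coprime exponents p
    and l, although its index is not a multiple of n.\<close>
  have "\<not> p ^ (j + 2) dvd k'"
  proof
    assume "p ^ (j + 2) dvd k'"
    then have "g (d * p) [^] l = \<one>"
      using k'(1) g_eq_one_iff[of k'] n by simp
    moreover have "g (d * p) [^] p = \<one>"
      using gdp by (rule pow1)
    moreover have "gcd p l = 1"
      using prime_imp_coprime[OF p pl] by (simp add: coprime_iff_gcd_eq_1)
    ultimately have "g (d * p) \<in> {\<one>}"
      using subgroup_pow_gcd_mem[of "{\<one>}" "g (d * p)" p l] normal_imp_subgroup[OF one_is_normal]
      by simp
    then have "p ^ (j + 2) dvd p ^ (j + 1)"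
      using g_eq_one_iff[of "d * p"] n dp by simp
    then show False
      using p prime_gt_1_nat[of p] power_dvd_imp_le[of p "j + 2" "j + 1"] by simp
  qed
  then show ?thesis using gk k' by auto
qed

text \<open>Valuations of an index up to j + 1 are visible in the quotient by
  \<open>H (p ^ (j + 2))\<close>, which has order \<open>p ^ (j + 2)\<close>; there
  \<open>g_pow_prime_absolute\<close> applies.\<close>

lemma g_pow_prime:
  assumes nil: "nilpotent_group G" and p: "prime p" and n: "p ^ (j + 2) dvd n"
    and oj: "odd p \<or> j \<ge> 1" and k: "p ^ j dvd k" "\<not> p ^ (j + 1) dvd k"
  shows "\<exists>k'. g k [^] p = g k' \<and> p ^ (j + 1) dvd k' \<and> \<not> p ^ (j + 2) dvd k'"
proof -
  let ?S = "H (p ^ (j + 2))"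
  have S: "?S \<lhd> G" "\<sigma> ` ?S \<subseteq> ?S"
    using H_normal_invariant[OF nil n] by auto
  interpret S: normal ?S G by (rule S(1))
  interpret Q: hol_cycle "G Mod ?S" "(`) \<sigma>" "?S #> a"
    using S by (rule hol_cycle_FactGroup)
  have orbQ: "Q.g k = ?S #> g k" for k
    using S by (rule orb_FactGroup)
  have ordQ: "order (G Mod ?S) = p ^ (j + 2)"
    using n S by (rule H_FactGroup)
  have nilQ: "nilpotent_group (G Mod ?S)"
    using nil S(1) by (rule nilpotent_group_FactGroup)
  obtain k' where k': "Q.g k [^]\<^bsub>G Mod ?S\<^esub> p = Q.g k'" "p ^ (j + 1) dvd k'" "\<not> p ^ (j + 2) dvd k'"
    using Q.g_pow_prime_absolute[OF nilQ p ordQ oj k] by blast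
  obtain l where l: "g k [^] p = g l"
    using g_obtain[of "g k [^] p"] by auto
  have "Q.g l = Q.g k'"
    using k'(1) S.FactGroup_pow[of "g k" p] by (simp only: orbQ l g_closed)
  then have "[l = k'] (mod p ^ (j + 2))"
    by (simp only: Q.g_eq_iff ordQ)
  then have "p ^ (j + 2) dvd l \<longleftrightarrow> p ^ (j + 2) dvd k'"
    and "p ^ (j + 1) dvd l \<longleftrightarrow> p ^ (j + 1) dvd k'"
    using cong_dvd_iff[of l k' "p ^ (j + 2)"] cong_dvd_iff[of l k' "p ^ (j + 1)"]
      cong_dvd_modulus_nat[of l k' "p ^ (j + 2)" "p ^ (j + 1)"] by (auto simp: le_imp_power_dvd)
  then show ?thesis using l k' by auto
qed

text \<open>Only the first step can fail for p = 2, since afterwards the valuation of the index is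
  positive; hence the disjunction in the hypothesis.\<close>

lemma g_pow_prime_power:
  assumes nil: "nilpotent_group G" and p: "prime p"
    and s: "p ^ j dvd s" "\<not> p ^ (j + 1) dvd s"
    and "r = 0 \<or> odd p \<or> j \<ge> 1" "p ^ (j + r + 1) dvd n"
  shows "\<exists>k'. g s [^] (p ^ r) = g k' \<and> p ^ (j + r) dvd k' \<and> \<not> p ^ (j + r + 1) dvd k'"
  using assms(5,6)
proof (induction r)
  case 0
  then show ?case using s by auto
next
  case (Suc r)
  have "p ^ (j + r + 1) dvd n"
    using Suc.prems(2) dvd_trans[OF le_imp_power_dvd[of "j + r + 1" "j + Suc r + 1" p]] by simp
  then obtain k' where k': "g s [^] (p ^ r) = g k'" "p ^ (j + r) dvd k'" "\<not> p ^ (j + r + 1) dvd k'"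
    using Suc by blast
  have "\<exists>k''. g k' [^] p = g k'' \<and> p ^ (j + r + 1) dvd k'' \<and> \<not> p ^ (j + r + 2) dvd k''"
    using g_pow_prime[OF nil p _ _ k'(2,3)] Suc.prems by auto
  moreover have "g s [^] (p ^ Suc r) = g k' [^] p"
    using k'(1) by (simp add: nat_pow_pow[symmetric] mult.commute[of p])
  ultimately show ?case by simp
qed

text \<open>Prime by prime, with j the valuation of s at p. In the quotient by
  \<open>H (p ^ (j + t))\<close>, a p-group, the \<open>p ^ (t - 1)\<close>-th power of
  \<open>g s\<close> has an index of valuation j + t - 1 and is not trivial. So \<open>p ^ t\<close>
  divides every exponent that kills \<open>g s\<close>.\<close>

lemma order_generator:
  assumes nil: "nilpotent_group G" and s: "s = 1 \<and> \<not> 4 dvd n \<or> s = 2" "s dvd n"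
  shows "g s [^] q = \<one> \<longleftrightarrow> n div s dvd q"
proof
  have s0: "s > 0" using s(1) by auto
  have cardH: "card (H s) = n div s"
    using card_H[OF s(2)] s0 by (metis div_mult_self_is_m)
  assume "n div s dvd q"
  then obtain r where r: "q = card (H s) * r"
    unfolding cardH by blast
  have "subgroup (H s) G"
    using H_normal_invariant[OF nil s(2)] normal_imp_subgroup by blast
  then have "g s [^] card (H s) = \<one>"
    by (rule pow_card_subgroup) (auto simp: H_def)
  then show "g s [^] q = \<one>"
    by (simp add: r nat_pow_pow[symmetric])
next
  have s0: "s > 0" using s(1) by auto
  assume q: "g s [^] q = \<one>"
  show "n div s dvd q"
  proof (rule dvd_prime_powersI)
    show "n div s > 0"
      using s(2) s0 n_pos by (simp add: div_greater_zero_iff dvd_imp_le)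
    fix p t assume p: "prime p" and pt: "p ^ t dvd n div s"
    show "p ^ t dvd q"
    proof (cases "t = 0")
      case False
      then obtain u where t: "t = Suc u" by (cases t) auto
      \<comment> \<open>The p-adic valuation of s, as s is 1 or 2.\<close>
      define j where "j = (if p = 2 \<and> s = 2 then 1 else 0 :: nat)"
      have "\<not> p dvd s" if "\<not> (p = 2 \<and> s = 2)"
        using that p s(1) by (auto dest: dvd_imp_le simp: prime_nat_iff)
      then have js: "p ^ j dvd s" "\<not> p ^ (j + 1) dvd s"
        by (auto simp: j_def)
      have "p ^ t * p ^ j dvd n div s * s"
        using pt js(1) by (rule mult_dvd_mono)
      then have pn: "p ^ (j + t) dvd n"
        using s(2) by (simp add: power_add mult.commute)
      \<comment> \<open>The chain of p-th powers could only break for p = 2, s = 1 and t > 1, but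
        then 4 divides n.\<close>
      have "odd p \<or> j \<ge> 1 \<or> u = 0"
      proof (rule ccontr)
        assume a: "\<not> ?thesis"
        then have "p = 2" using p primes_dvd_imp_eq[of 2 p] by auto
        moreover from this a have "s = 1" using s(1) by (auto simp: j_def)
        moreover have "2 ^ 2 dvd (2::nat) ^ t" using a t by (intro le_imp_power_dvd) auto
        ultimately have "4 dvd n"
          using pt dvd_trans[of 4 "2 ^ t" n] by simp
        then show False using s(1) \<open>s = 1\<close> by simp
      qed
      then obtain k' where k': "g s [^] (p ^ u) = g k'" "\<not> p ^ (j + t) dvd k'"
        using g_pow_prime_power[OF nil p js, of u] pn by (auto simp: t)
      let ?S = "H (p ^ (j + t))"
      have S: "?S \<lhd> G" "\<sigma> ` ?S \<subseteq> ?S"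
        using H_normal_invariant[OF nil pn] by auto
      interpret S: normal ?S G by (rule S(1))
      interpret Q: group "G Mod ?S" by (rule S.factorgroup_is_group)
      have "(?S #> g s) [^]\<^bsub>G Mod ?S\<^esub> (p ^ (j + t)) = ?S"
        using Q.pow_order_eq_1[of "?S #> g s"] H_FactGroup[OF pn S] by (simp add: carrier_FactGroup)
      then have big: "g s [^] (p ^ (j + t)) \<in> ?S"
        using S.FactGroup_pow[of "g s" "p ^ (j + t)"] S.rcoset_eq_self_iff[of "g s [^] (p ^ (j + t))"]
        by simp
      show ?thesis
      proof (rule ccontr)
        assume nq: "\<not> p ^ t dvd q"
        obtain i where i: "gcd q (p ^ (j + t)) = p ^ i"
          using divides_primepow_nat[OF p, of "gcd q (p ^ (j + t))" "j + t"] by auto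
        have "p ^ i dvd q" unfolding i[symmetric] by simp
        have "i \<le> u"
        proof (rule ccontr)
          assume "\<not> i \<le> u"
          then have "p ^ t dvd p ^ i" using t by (intro le_imp_power_dvd) auto
          then show False using \<open>p ^ i dvd q\<close> nq dvd_trans by blast
        qed
        have "g s [^] (p ^ i) \<in> ?S"
          using subgroup_pow_gcd_mem[OF S.subgroup_axioms, of "g s" q "p ^ (j + t)"] q big S.one_closed
          by (simp add: i)
        then have "(g s [^] (p ^ i)) [^] (p ^ (u - i)) \<in> ?S"
          by (rule subgroup_pow_mem[OF S.subgroup_axioms])
        moreover have "p ^ i * p ^ (u - i) = p ^ u"
          using \<open>i \<le> u\<close> by (simp flip: power_add)
        ultimately have "g k' \<in> ?S"
          using k'(1) by (simp add: nat_pow_pow)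
        then show False
          using k'(2) mem_H_iff[OF pn] by simp
      qed
    qed simp
  qed
qed

end

section \<open>Cyclic and metacyclic groups\<close>

lemma (in group) pow_eq_pow_iff:
  assumes x: "x \<in> carrier G" and ord: "\<And>q::nat. x [^] q = \<one> \<longleftrightarrow> N dvd q"
  shows "x [^] (j::nat) = x [^] (k::nat) \<longleftrightarrow> [j = k] (mod N)"
proof -
  have *: "x [^] (j + l) = x [^] j \<longleftrightarrow> [j + l = j] (mod N)" for j l :: nat
  proof -
    have "x [^] (j + l) = x [^] j \<longleftrightarrow> x [^] j \<otimes> x [^] l = x [^] j \<otimes> \<one>"
      using x by (simp add: nat_pow_mult)
    also have "\<dots> \<longleftrightarrow> N dvd l"
      using x ord by (simp add: l_cancel del: r_one)
    also have "\<dots> \<longleftrightarrow> [j + l = j] (mod N)"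
      unfolding cong_add_lcancel_0_nat cong_0_iff ..
    finally show ?thesis .
  qed
  show ?thesis
  proof (cases "j \<le> k")
    case True
    then show ?thesis
      using *[of j "k - j"] by (auto intro: cong_sym)
  next
    case False
    then show ?thesis
      using *[of k "j - k"] by simp
  qed
qed

section \<open>Finite cyclic groups with a chosen generator\<close>

locale cyclic_gen = group G for G (structure) +
  fixes w :: 'a and N :: nat
  assumes N_pos: "N > 0" and w_closed [simp]: "w \<in> carrier G"
    and pow_one_iff: "\<And>q::nat. w [^] q = \<one> \<longleftrightarrow> N dvd q"
    and carrier_subset: "carrier G \<subseteq> range (\<lambda>k::nat. w [^] k)"
begin

lemmas pow_cong_iff = pow_eq_pow_iff[OF w_closed pow_one_iff]

lemma elem_cases:
  assumes "x \<in> carrier G"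
  obtains k :: nat where "x = w [^] k"
  using assms carrier_subset by blast

lemma carrier_eq: "carrier G = (\<lambda>k. w [^] k) ` {..<N}"
proof
  show "carrier G \<subseteq> (\<lambda>k. w [^] k) ` {..<N}"
  proof
    fix x assume "x \<in> carrier G"
    then obtain k :: nat where "x = w [^] k" by (rule elem_cases)
    also have "\<dots> = w [^] (k mod N)" by (simp add: pow_cong_iff)
    finally show "x \<in> (\<lambda>k. w [^] k) ` {..<N}" using N_pos by auto
  qed
qed auto

lemma order_eq: "order G = N"
proof -
  have "inj_on (\<lambda>k. w [^] k) {..<N}"
    by (auto simp: inj_on_def pow_cong_iff cong_def)
  then show ?thesis unfolding order_def carrier_eq by (simp add: card_image)
qed

lemma commute:
  assumes "x \<in> carrier G" "y \<in> carrier G"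
  shows "x \<otimes> y = y \<otimes> x"
proof -
  obtain j k :: nat where "x = w [^] j" "y = w [^] k" using assms elem_cases by metis
  then show ?thesis by (simp add: nat_pow_mult add.commute)
qed

lemma hom_unique:
  assumes "f \<in> hom G K" "f' \<in> hom G K" "group K" "f w = f' w" "x \<in> carrier G"
  shows "f x = f' x"
proof -
  interpret f: group_hom G K f using assms is_group by (simp add: group_hom_def group_hom_axioms_def)
  interpret f': group_hom G K f' using assms is_group by (simp add: group_hom_def group_hom_axioms_def)
  obtain k :: nat where "x = w [^] k" using assms(5) by (rule elem_cases)
  then show ?thesis using assms(4) by (simp add: f.hom_nat_pow f'.hom_nat_pow)
qed

end

lemma cyclic_gen_iso:
  fixes G (structure)
  assumes "cyclic_gen G w N" "cyclic_gen G' w' N"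
  obtains f where "f \<in> iso G G'" "f w = w'"
proof -
  interpret A: cyclic_gen G w N by (rule assms)
  interpret B: cyclic_gen G' w' N by (rule assms)
  define f where "f = (\<lambda>x. w' [^]\<^bsub>G'\<^esub> (SOME k::nat. x = w [^] k))"
  have f: "f (w [^] k) = w' [^]\<^bsub>G'\<^esub> k" for k :: nat
  proof -
    have "w [^] k = w [^] (SOME l::nat. w [^] k = w [^] l)"
      by (rule someI[of _ k]) simp
    then show ?thesis unfolding f_def B.pow_cong_iff A.pow_cong_iff by (rule cong_sym)
  qed
  have "f \<in> hom G G'"
  proof (rule homI)
    fix x y assume xy: "x \<in> carrier G" "y \<in> carrier G"
    obtain j k :: nat where jk: "x = w [^] j" "y = w [^] k"
      using xy A.elem_cases by metis
    show "f x \<in> carrier G'" by (simp add: jk f)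
    show "f (x \<otimes> y) = f x \<otimes>\<^bsub>G'\<^esub> f y"
      by (simp add: jk f A.nat_pow_mult B.nat_pow_mult)
  qed
  moreover have "inj_on f (carrier G)"
  proof (rule inj_onI)
    fix x y assume xy: "x \<in> carrier G" "y \<in> carrier G" "f x = f y"
    obtain j k :: nat where jk: "x = w [^] j" "y = w [^] k"
      using xy A.elem_cases by metis
    then show "x = y" using xy(3) by (simp add: f A.pow_cong_iff B.pow_cong_iff)
  qed
  moreover have "f ` carrier G = carrier G'"
    using f unfolding A.carrier_eq B.carrier_eq by (auto simp: image_iff)
  moreover have "f w = w'" using f[of 1] by simp
  ultimately show thesis using that by (simp add: iso_def bij_betw_def)
qed

lemma cyclic_gen_iso_image:
  fixes G (structure)
  assumes "cyclic_gen G w N" "f \<in> iso G K" "group K"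
  shows "cyclic_gen K (f w) N"
proof -
  interpret A: cyclic_gen G w N by (rule assms)
  interpret f: group_hom G K f
    using assms A.is_group by (simp add: group_hom_def group_hom_axioms_def iso_def)
  have bij: "bij_betw f (carrier G) (carrier K)" using assms(2) by (simp add: iso_def)
  have one: "f x = \<one>\<^bsub>K\<^esub> \<longleftrightarrow> x = \<one>" if "x \<in> carrier G" for x
    using bij that by (metis A.one_closed bij_betw_def f.hom_one inj_on_eq_iff)
  show ?thesis
  proof unfold_locales
    show "f w [^]\<^bsub>K\<^esub> q = \<one>\<^bsub>K\<^esub> \<longleftrightarrow> N dvd q" for q :: nat
      using one[of "w [^] q"] A.pow_one_iff by (simp add: f.hom_nat_pow)
    show "carrier K \<subseteq> range (\<lambda>k::nat. f w [^]\<^bsub>K\<^esub> k)"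
    proof
      fix z assume "z \<in> carrier K"
      then obtain x where x: "x \<in> carrier G" "z = f x" using bij by (metis bij_betw_def imageE)
      obtain k :: nat where "x = w [^] k" using x(1) by (rule A.elem_cases)
      then show "z \<in> range (\<lambda>k::nat. f w [^]\<^bsub>K\<^esub> k)" using x(2) by (simp add: f.hom_nat_pow)
    qed
  qed (use A.N_pos in auto)
qed

lemma cyclic_group_gen:
  fixes G (structure)
  assumes "group G" "cyclic_group G" "finite (carrier G)"
  obtains w where "cyclic_gen G w (order G)"
proof -
  interpret group G by (rule assms)
  obtain w where w: "w \<in> carrier G" "carrier G = range (\<lambda>n::int. w [^] n)"
    using assms(2) cyclic_group by blast
  have "carrier G = generate G {w}"
    using w generate_pow[of w] by auto
  then have ord: "ord w = order G"
    using generate_pow_card[OF w(1)] by (simp add: order_def)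
  have pos: "order G > 0" using assms(3) order_gt_0_iff_finite by blast
  have "cyclic_gen G w (order G)"
  proof unfold_locales
    show "w [^] q = \<one> \<longleftrightarrow> order G dvd q" for q :: nat
      using pow_eq_id[OF w(1)] ord by simp
    show "carrier G \<subseteq> range (\<lambda>k::nat. w [^] k)"
    proof
      fix x assume "x \<in> carrier G"
      then obtain z :: int where "x = w [^] z" using w(2) by blast
      also have "\<dots> = w [^] (z mod int (ord w))"
        using w(1) dvd_minus_mod[of "int (ord w)" z]
        by (metis int_pow_eq dvd_diff_commute)
      also have "\<dots> = w [^] nat (z mod int (ord w))"
        using pos ord by (simp flip: int_pow_int)
      finally show "x \<in> range (\<lambda>k::nat. w [^] k)" by blast
    qed
  qed (use w pos in auto)
  then show thesis by (rule that)
qed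

text \<open>A group with a cyclic subgroup <w> of index 2, in the normal form w^k or w^k y. N, t and
  e determine it up to isomorphism (\<open>metacyclic_iso\<close>); \<open>change_y\<close> and
  \<open>change_w\<close> show how e depends on the generators. Exponents are natural numbers and
  matter modulo N.\<close>

locale metacyclic = group G for G (structure) +
  fixes w y :: 'a and N t e :: nat
  assumes N_pos: "N > 0" and w_closed [simp]: "w \<in> carrier G" and y_closed [simp]: "y \<in> carrier G"
    and pow_one_iff: "\<And>q::nat. w [^] q = \<one> \<longleftrightarrow> N dvd q"
    and carrier_subset: "carrier G \<subseteq> range (\<lambda>k::nat. w [^] k) \<union> range (\<lambda>k::nat. w [^] k \<otimes> y)"
    and y_notin: "y \<notin> range (\<lambda>k::nat. w [^] k)"
    and conj: "y \<otimes> w = w [^] t \<otimes> y"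
    and sq: "y \<otimes> y = w [^] e"
begin

lemmas pow_cong_iff = pow_eq_pow_iff[OF w_closed pow_one_iff]

lemma elem_cases:
  assumes "x \<in> carrier G"
  obtains k :: nat where "x = w [^] k" | k :: nat where "x = w [^] k \<otimes> y"
  using assms carrier_subset by blast

lemma pow_y_cong_iff: "w [^] (j::nat) \<otimes> y = w [^] (k::nat) \<otimes> y \<longleftrightarrow> [j = k] (mod N)"
  by (simp add: r_cancel pow_cong_iff)

text \<open>In natural exponents modulo N, \<open>N - 1\<close> stands for -1; the same device
  returns below.\<close>

lemma inv_pow: "inv (w [^] (k::nat)) = w [^] (k * (N - 1))"
proof -
  have "w [^] (k * (N - 1)) \<otimes> w [^] k = w [^] (k * N)"
    using N_pos by (simp add: nat_pow_mult flip: mult_Suc_right) (simp add: algebra_simps)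
  also have "\<dots> = \<one>" by (simp add: pow_one_iff)
  finally show ?thesis by (simp add: inv_equality)
qed

lemma pow_neq_pow_y: "w [^] (j::nat) \<noteq> w [^] (k::nat) \<otimes> y"
proof
  assume "w [^] j = w [^] k \<otimes> y"
  then have "y = inv (w [^] k) \<otimes> w [^] j"
    by (simp add: inv_solve_left)
  then have "y = w [^] (k * (N - 1) + j)"
    by (simp add: inv_pow nat_pow_mult)
  then show False using y_notin by blast
qed

lemma y_pow: "y \<otimes> w [^] (k::nat) = w [^] (t * k) \<otimes> y"
proof (induction k)
  case (Suc k)
  have "y \<otimes> w [^] Suc k = y \<otimes> w [^] k \<otimes> w"
    by (simp add: m_assoc)
  also have "\<dots> = w [^] (t * k) \<otimes> (y \<otimes> w)"
    unfolding Suc by (simp add: m_assoc)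
  also have "\<dots> = w [^] (t * k) \<otimes> w [^] t \<otimes> y"
    unfolding conj by (simp add: m_assoc)
  finally show ?case by (simp add: nat_pow_mult add.commute)
qed simp

lemma mult_pow_pow: "w [^] (j::nat) \<otimes> w [^] (k::nat) = w [^] (j + k)"
  by (simp add: nat_pow_mult)

lemma mult_pow_y: "w [^] (j::nat) \<otimes> (w [^] (k::nat) \<otimes> y) = w [^] (j + k) \<otimes> y"
  by (simp add: m_assoc[symmetric] nat_pow_mult)

lemma mult_y_pow: "w [^] (j::nat) \<otimes> y \<otimes> w [^] (k::nat) = w [^] (j + t * k) \<otimes> y"
proof -
  have "w [^] j \<otimes> y \<otimes> w [^] k = w [^] j \<otimes> (y \<otimes> w [^] k)" by (simp add: m_assoc)
  then show ?thesis by (simp add: y_pow mult_pow_y)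
qed

lemma mult_y_y: "w [^] (j::nat) \<otimes> y \<otimes> (w [^] (k::nat) \<otimes> y) = w [^] (j + t * k + e)"
proof -
  have "w [^] j \<otimes> y \<otimes> (w [^] k \<otimes> y) = w [^] j \<otimes> y \<otimes> w [^] k \<otimes> y" by (simp add: m_assoc)
  also have "\<dots> = w [^] (j + t * k) \<otimes> (y \<otimes> y)" by (simp add: mult_y_pow m_assoc)
  finally show ?thesis by (simp add: sq nat_pow_mult)
qed

text \<open>Conjugating w twice by y is conjugating by \<open>y \<otimes> y\<close>, a power of
  w.\<close>

lemma t_sq: "[t * t = 1] (mod N)"
proof -
  have "y \<otimes> (y \<otimes> w) = w [^] (t * t) \<otimes> w [^] e"
    by (simp add: conj m_assoc[symmetric] y_pow) (simp add: m_assoc sq)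
  moreover have "y \<otimes> (y \<otimes> w) = w [^] e \<otimes> w [^] (1::nat)"
    by (simp add: m_assoc[symmetric] sq)
  ultimately have "w [^] (t * t + e) = w [^] (1 + e)"
    by (simp add: nat_pow_mult add.commute)
  then have "[t * t + e = 1 + e] (mod N)" by (simp only: pow_cong_iff)
  then show ?thesis by (simp only: cong_add_rcancel_nat)
qed

text \<open>y commutes with its own square.\<close>

lemma t_e: "[t * e = e] (mod N)"
proof -
  have "w [^] (t * e) \<otimes> y = y \<otimes> (y \<otimes> y)" by (simp add: sq y_pow)
  also have "\<dots> = y \<otimes> y \<otimes> y" by (simp only: m_assoc y_closed)
  also have "\<dots> = w [^] e \<otimes> y" by (simp only: sq)
  finally show ?thesis by (simp add: pow_y_cong_iff)
qed

lemma carrier_eq: "carrier G = (\<lambda>k. w [^] k) ` {..<N} \<union> (\<lambda>k. w [^] k \<otimes> y) ` {..<N}"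
proof
  show "carrier G \<subseteq> (\<lambda>k. w [^] k) ` {..<N} \<union> (\<lambda>k. w [^] k \<otimes> y) ` {..<N}"
  proof
    fix x assume "x \<in> carrier G"
    then show "x \<in> (\<lambda>k. w [^] k) ` {..<N} \<union> (\<lambda>k. w [^] k \<otimes> y) ` {..<N}"
    proof (cases rule: elem_cases)
      case (1 k)
      then have "x = w [^] (k mod N)" by (simp add: pow_cong_iff)
      then show ?thesis using N_pos by auto
    next
      case (2 k)
      then have "x = w [^] (k mod N) \<otimes> y" by (simp add: pow_y_cong_iff)
      then show ?thesis using N_pos by auto
    qed
  qed
qed auto

lemma order_eq: "order G = 2 * N"
proof -
  have "inj_on (\<lambda>k. w [^] k) {..<N}" "inj_on (\<lambda>k. w [^] k \<otimes> y) {..<N}"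
    by (auto simp: inj_on_def pow_cong_iff pow_y_cong_iff cong_def)
  moreover have "(\<lambda>k. w [^] k) ` {..<N} \<inter> (\<lambda>k. w [^] k \<otimes> y) ` {..<N} = {}"
    using pow_neq_pow_y by blast
  ultimately show ?thesis
    unfolding order_def carrier_eq by (simp add: card_Un_disjoint card_image)
qed

lemma hom_unique:
  assumes "f \<in> hom G K" "f' \<in> hom G K" "group K" "f w = f' w" "f y = f' y" "x \<in> carrier G"
  shows "f x = f' x"
proof -
  interpret f: group_hom G K f using assms is_group by (simp add: group_hom_def group_hom_axioms_def)
  interpret f': group_hom G K f' using assms is_group by (simp add: group_hom_def group_hom_axioms_def)
  show ?thesis
    using assms(6) by (cases rule: elem_cases) (use assms(4,5) in \<open>simp_all add: f.hom_nat_pow f'.hom_nat_pow\<close>)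
qed

text \<open>The freedom that normalises e: another element of the coset of y adds (1 + t) c to
  it.\<close>

lemma change_y: "metacyclic G w (w [^] (c::nat) \<otimes> y) N t (c + t * c + e)"
proof unfold_locales
  show "w [^] c \<otimes> y \<notin> range (\<lambda>k::nat. w [^] k)"
    using pow_neq_pow_y[of _ c] by (metis rangeE)
  show "w [^] c \<otimes> y \<otimes> w = w [^] t \<otimes> (w [^] c \<otimes> y)"
    using mult_y_pow[of c 1] by (simp add: mult_pow_y add.commute)
  show "w [^] c \<otimes> y \<otimes> (w [^] c \<otimes> y) = w [^] (c + t * c + e)"
    by (rule mult_y_y)
  have "w [^] k \<otimes> y = w [^] (k + c * (N - 1)) \<otimes> (w [^] c \<otimes> y)" for k :: nat
  proof -
    have "[k = k + c * (N - 1) + c] (mod N)"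
    proof -
      have "k + c * (N - 1) + c = k + N * c" using N_pos by (cases N) auto
      then show ?thesis unfolding cong_def by (metis mod_mult_self2)
    qed
    then show ?thesis by (simp add: mult_pow_y pow_y_cong_iff)
  qed
  then have "range (\<lambda>k::nat. w [^] k \<otimes> y) \<subseteq> range (\<lambda>k::nat. w [^] k \<otimes> (w [^] c \<otimes> y))"
    by blast
  then show "carrier G \<subseteq> range (\<lambda>k::nat. w [^] k) \<union> range (\<lambda>k::nat. w [^] k \<otimes> (w [^] c \<otimes> y))"
    using carrier_subset by blast
qed (simp_all add: N_pos pow_one_iff)

text \<open>The square of y is now read as a power of w^i. Combined with \<open>change_y\<close>
  this verifies that prescribed images of w and y satisfy the relations of the original
  pair.\<close>

lemma change_w:
  assumes i: "coprime i N" and e': "[e = i * e'] (mod N)"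
  shows "metacyclic G (w [^] i) y N t e'"
proof -
  obtain j where j: "[i * j = 1] (mod N)"
    using cong_solve_coprime_nat[OF i] by auto
  have XX: "w [^] k = (w [^] i) [^] (j * k)" for k :: nat
  proof -
    have "[i * (j * k) = k] (mod N)"
      using cong_scalar_right[OF j, of k] by (simp add: mult.assoc)
    then show ?thesis by (simp add: nat_pow_pow pow_cong_iff cong_sym)
  qed
  have sub1: "range (\<lambda>k::nat. w [^] k) \<subseteq> range (\<lambda>k::nat. (w [^] i) [^] k)"
    using XX by blast
  have "w [^] k \<otimes> y = (w [^] i) [^] (j * k) \<otimes> y" for k :: nat
    by (simp only: XX[of k])
  then have sub2: "range (\<lambda>k::nat. w [^] k \<otimes> y) \<subseteq> range (\<lambda>k::nat. (w [^] i) [^] k \<otimes> y)"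
    by blast
  show ?thesis
  proof unfold_locales
    show "(w [^] i) [^] q = \<one> \<longleftrightarrow> N dvd q" for q :: nat
      using i by (simp add: nat_pow_pow pow_one_iff coprime_dvd_mult_right_iff coprime_commute)
    show "carrier G \<subseteq> range (\<lambda>k::nat. (w [^] i) [^] k) \<union> range (\<lambda>k::nat. (w [^] i) [^] k \<otimes> y)"
      using carrier_subset sub1 sub2 by blast
    show "y \<notin> range (\<lambda>k::nat. (w [^] i) [^] k)"
      using y_notin by (auto simp: nat_pow_pow)
    show "y \<otimes> w [^] i = (w [^] i) [^] t \<otimes> y"
      by (simp add: y_pow nat_pow_pow mult.commute)
    show "y \<otimes> y = (w [^] i) [^] e'"
      using e' by (simp add: sq nat_pow_pow pow_cong_iff)
  qed (simp_all add: N_pos)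
qed

lemma change_params:
  assumes "[t = t'] (mod N)" "[e = e'] (mod N)"
  shows "metacyclic G w y N t' e'"
proof -
  have "w [^] t = w [^] t'" "w [^] e = w [^] e'"
    using assms by (simp_all add: pow_cong_iff)
  then show ?thesis
    using N_pos pow_one_iff carrier_subset y_notin conj sq by unfold_locales auto
qed

end

text \<open>Products of normal forms obey the same formulas in N, t and e on both sides, so matching
  normal forms is an isomorphism.\<close>

lemma metacyclic_iso:
  fixes G (structure)
  assumes "metacyclic G w y N t e" "metacyclic G' w' y' N t e"
  obtains f where "f \<in> iso G G'" "f w = w'" "f y = y'"
proof -
  interpret A: metacyclic G w y N t e by (rule assms)
  interpret B: metacyclic G' w' y' N t e by (rule assms)
  define f where "f = (\<lambda>x. if x \<in> range (\<lambda>k::nat. w [^] k) then w' [^]\<^bsub>G'\<^esub> (SOME k::nat. x = w [^] k)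
    else w' [^]\<^bsub>G'\<^esub> (SOME k::nat. x = w [^] k \<otimes> y) \<otimes>\<^bsub>G'\<^esub> y')"
  have f1: "f (w [^] k) = w' [^]\<^bsub>G'\<^esub> k" for k :: nat
  proof -
    have "w [^] k = w [^] (SOME l::nat. w [^] k = w [^] l)"
      by (rule someI[of _ k]) simp
    then have "[(SOME l::nat. w [^] k = w [^] l) = k] (mod N)"
      unfolding A.pow_cong_iff by (rule cong_sym)
    then show ?thesis unfolding f_def by (simp add: B.pow_cong_iff)
  qed
  have f2: "f (w [^] k \<otimes> y) = w' [^]\<^bsub>G'\<^esub> k \<otimes>\<^bsub>G'\<^esub> y'" for k :: nat
  proof -
    have "w [^] k \<otimes> y = w [^] (SOME l::nat. w [^] k \<otimes> y = w [^] l \<otimes> y) \<otimes> y"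
      by (rule someI[of _ k]) simp
    then have "[(SOME l::nat. w [^] k \<otimes> y = w [^] l \<otimes> y) = k] (mod N)"
      unfolding A.pow_y_cong_iff by (rule cong_sym)
    moreover have "w [^] k \<otimes> y \<notin> range (\<lambda>k::nat. w [^] k)"
      using A.pow_neq_pow_y by (metis rangeE)
    ultimately show ?thesis unfolding f_def by (simp add: B.pow_y_cong_iff)
  qed
  have "f \<in> hom G G'"
  proof (rule homI)
    fix x z assume x: "x \<in> carrier G"
    then show "f x \<in> carrier G'"
      by (cases rule: A.elem_cases) (simp_all add: f1 f2)
    assume z: "z \<in> carrier G"
    show "f (x \<otimes> z) = f x \<otimes>\<^bsub>G'\<^esub> f z"
      using x
    proof (cases rule: A.elem_cases)
      case x: (1 j)
      show ?thesis using z
        by (cases rule: A.elem_cases)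
          (simp_all only: x f1 f2 A.mult_pow_pow B.mult_pow_pow A.mult_pow_y B.mult_pow_y)
    next
      case x: (2 j)
      show ?thesis using z
        by (cases rule: A.elem_cases)
          (simp_all only: x f1 f2 A.mult_y_pow B.mult_y_pow A.mult_y_y B.mult_y_y)
    qed
  qed
  moreover have "inj_on f (carrier G)"
  proof (rule inj_onI)
    fix x z assume x: "x \<in> carrier G" and z: "z \<in> carrier G" and eq: "f x = f z"
    show "x = z"
      using x
    proof (cases rule: A.elem_cases)
      case x: (1 j)
      show ?thesis using z
        by (cases rule: A.elem_cases)
          (use eq x B.pow_neq_pow_y in \<open>auto simp: f1 f2 A.pow_cong_iff B.pow_cong_iff\<close>)
    next
      case x: (2 j)
      show ?thesis using z
        by (cases rule: A.elem_cases)
          (use eq x B.pow_neq_pow_y in \<open>auto simp: f1 f2 A.pow_y_cong_iff B.pow_y_cong_iff dest: sym\<close>)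
    qed
  qed
  moreover have "f ` carrier G = carrier G'"
    unfolding A.carrier_eq B.carrier_eq image_Un image_image f1 f2 ..
  moreover have "f w = w'" using f1[of 1] by simp
  moreover have "f y = y'" using f2[of 0] by simp
  ultimately show thesis using that by (simp add: iso_def bij_betw_def)
qed

lemma metacyclic_iso_image:
  fixes G (structure)
  assumes "metacyclic G w y N t e" "f \<in> iso G K" "group K"
  shows "metacyclic K (f w) (f y) N t e"
proof -
  interpret A: metacyclic G w y N t e by (rule assms)
  interpret f: group_hom G K f
    using assms A.is_group by (simp add: group_hom_def group_hom_axioms_def iso_def)
  have bij: "bij_betw f (carrier G) (carrier K)" using assms(2) by (simp add: iso_def)
  have inj: "f x = f z \<longleftrightarrow> x = z" if "x \<in> carrier G" "z \<in> carrier G" for x z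
    using bij that by (meson bij_betw_def inj_on_eq_iff)
  show ?thesis
  proof unfold_locales
    show "f w [^]\<^bsub>K\<^esub> q = \<one>\<^bsub>K\<^esub> \<longleftrightarrow> N dvd q" for q :: nat
      using inj[of "w [^] q" "\<one>"] A.pow_one_iff by (simp add: f.hom_nat_pow)
    show "carrier K \<subseteq> range (\<lambda>k::nat. f w [^]\<^bsub>K\<^esub> k) \<union> range (\<lambda>k::nat. f w [^]\<^bsub>K\<^esub> k \<otimes>\<^bsub>K\<^esub> f y)"
    proof
      fix z assume "z \<in> carrier K"
      then obtain x where x: "x \<in> carrier G" "z = f x" using bij by (metis bij_betw_def imageE)
      show "z \<in> range (\<lambda>k::nat. f w [^]\<^bsub>K\<^esub> k) \<union> range (\<lambda>k::nat. f w [^]\<^bsub>K\<^esub> k \<otimes>\<^bsub>K\<^esub> f y)"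
        using x(1) by (cases rule: A.elem_cases) (simp_all add: x(2) f.hom_nat_pow)
    qed
    show "f y \<notin> range (\<lambda>k::nat. f w [^]\<^bsub>K\<^esub> k)"
    proof
      assume "f y \<in> range (\<lambda>k::nat. f w [^]\<^bsub>K\<^esub> k)"
      then obtain k :: nat where "f y = f (w [^] k)" by (auto simp: f.hom_nat_pow)
      then show False using inj[of y "w [^] k"] A.y_notin by auto
    qed
    show "f y \<otimes>\<^bsub>K\<^esub> f w = f w [^]\<^bsub>K\<^esub> t \<otimes>\<^bsub>K\<^esub> f y"
      using arg_cong[OF A.conj, of f] by (simp add: f.hom_nat_pow)
    show "f y \<otimes>\<^bsub>K\<^esub> f y = f w [^]\<^bsub>K\<^esub> e"
      using arg_cong[OF A.sq, of f] by (simp add: f.hom_nat_pow)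
  qed (use A.N_pos in auto)
qed

text \<open>The commutator of w^m with a power of w is 1, and with
  \<open>w [^] j \<otimes> y\<close> it is w^(u m), where u stands for t - 1. So each further
  commutator multiplies exponents by u, once a first one has led into <w>.\<close>

lemma (in metacyclic) nilpotent:
  assumes u: "[t = 1 + u] (mod N)" "N dvd u ^ r"
  shows "nilpotent_group G"
proof -
  define L where "L = (\<lambda>i. range (\<lambda>k. w [^] (u ^ i * k)))"
  have subL: "subgroup (L i) G" for i
  proof (rule subgroupI)
    show "L i \<subseteq> carrier G" by (auto simp: L_def)
    show "L i \<noteq> {}" by (auto simp: L_def)
    fix x assume "x \<in> L i"
    then obtain j where j: "x = w [^] (u ^ i * j)" by (auto simp: L_def)
    then show "inv x \<in> L i" by (auto simp: L_def inv_pow mult.assoc)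
    fix z assume "z \<in> L i"
    then obtain k where "z = w [^] (u ^ i * k)" by (auto simp: L_def)
    then have "x \<otimes> z = w [^] (u ^ i * (j + k))"
      by (simp add: j nat_pow_mult distrib_left)
    then show "x \<otimes> z \<in> L i" unfolding L_def by blast
  qed
  have L0: "x \<in> L 0 \<longleftrightarrow> (\<exists>k::nat. x = w [^] k)" for x
    by (auto simp: L_def)
  define B where "B = range (\<lambda>k::nat. w [^] k \<otimes> y)"
  have AB: "x \<in> L 0 \<or> x \<in> B" if "x \<in> carrier G" for x
    using that by (cases rule: elem_cases) (auto simp: L0 B_def)
  have disj: "\<not> (x \<in> L 0 \<and> x \<in> B)" for x
    using pow_neq_pow_y by (auto simp: L0 B_def dest: sym)
  have AA: "x \<in> L 0 \<Longrightarrow> z \<in> L 0 \<Longrightarrow> x \<otimes> z \<in> L 0" for x z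
    using subgroup.m_closed[OF subL] by blast
  have AmB: "x \<in> L 0 \<Longrightarrow> z \<in> B \<Longrightarrow> x \<otimes> z \<in> B" for x z
    by (auto simp: L0 B_def mult_pow_y)
  have BmA: "x \<in> B \<Longrightarrow> z \<in> L 0 \<Longrightarrow> x \<otimes> z \<in> B" for x z
    by (auto simp: L0 B_def mult_y_pow)
  have BB: "x \<in> B \<Longrightarrow> z \<in> B \<Longrightarrow> x \<otimes> z \<in> L 0" for x z
    by (auto simp: L0 B_def mult_y_y)
  have invA: "x \<in> L 0 \<Longrightarrow> inv x \<in> L 0" for x
    using subgroup.m_inv_closed[OF subL] by blast
  have invB: "inv x \<in> B" if "x \<in> B" for x
  proof -
    have xc: "x \<in> carrier G" using that by (auto simp: B_def)
    have "inv x \<notin> L 0"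
      using invA[of "inv x"] xc that disj by auto
    then show ?thesis using AB[of "inv x"] xc by blast
  qed
  \<comment> \<open>A commutator has an even number of factors outside <w>.\<close>
  have comm0: "inv h \<otimes> inv k \<otimes> h \<otimes> k \<in> L 0" if "h \<in> carrier G" "k \<in> carrier G" for h k
    using AB[OF that(1)] AB[OF that(2)] by (elim disjE) (blast intro: AA AmB BmA BB invA invB)+
  have comm: "inv h \<otimes> inv z \<otimes> h \<otimes> z \<in> L (Suc i)" if h: "h \<in> L i" and z: "z \<in> carrier G" for h z i
  proof -
    obtain k where k: "h = w [^] (u ^ i * k)" using h by (auto simp: L_def)
    let ?m = "u ^ i * k"
    show ?thesis
      using z
    proof (cases rule: elem_cases)
      case (1 j)
      have "inv h \<otimes> inv z \<otimes> h \<otimes> z = inv (z \<otimes> h) \<otimes> (h \<otimes> z)"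
        using z by (simp add: k inv_mult_group m_assoc)
      also have "z \<otimes> h = h \<otimes> z"
        by (simp add: 1 k nat_pow_mult add.commute)
      finally have "inv h \<otimes> inv z \<otimes> h \<otimes> z = \<one>" using z by (simp add: k)
      then show ?thesis using subgroup.one_closed[OF subL] by simp
    next
      case (2 j)
      have "w [^] (t * ?m) = w [^] (?m + u * ?m)"
        using cong_scalar_right[OF u(1), of ?m] by (simp add: pow_cong_iff)
      have "[j + t * (t * ?m) = ?m + j] (mod N)"
        using cong_add[OF cong_refl[of j] cong_scalar_right[OF t_sq, of ?m]] by (simp add: mult.assoc add.commute)
      then have "z \<otimes> w [^] (t * ?m) = h \<otimes> z"
        by (simp add: 2 k mult_y_pow mult_pow_y pow_y_cong_iff)
      then have "inv z \<otimes> (h \<otimes> z) = w [^] (t * ?m)"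
        using z by (metis w_closed inv_closed inv_solve_left' k m_closed nat_pow_closed inv_solve_left)
      then have "inv h \<otimes> inv z \<otimes> h \<otimes> z = inv h \<otimes> (h \<otimes> w [^] (u * ?m))"
        using z \<open>w [^] (t * ?m) = w [^] (?m + u * ?m)\<close> by (simp add: k m_assoc nat_pow_mult)
      also have "\<dots> = w [^] (u ^ Suc i * k)"
        by (simp add: k m_assoc[symmetric] mult.assoc)
      finally show ?thesis unfolding L_def by blast
    qed
  qed
  have lc: "lower_central G (Suc i) \<subseteq> L i" for i
  proof (induction i)
    case 0
    show ?case
      using comm0 by (auto simp: commutator_subgroup_def intro!: generate_subgroup_incl[OF _ subL])
  next
    case (Suc i)
    have "{inv h \<otimes> inv k \<otimes> h \<otimes> k |h k. h \<in> lower_central G (Suc i) \<and> k \<in> carrier G} \<subseteq> L (Suc i)"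
      using comm Suc by blast
    then show ?case
      unfolding lower_central.simps(2)[of G "Suc i"] commutator_subgroup_def[of G "lower_central G (Suc i)"]
      by (rule generate_subgroup_incl[OF _ subL])
  qed
  have "L r = {\<one>}"
  proof -
    have "w [^] (u ^ r * k) = \<one>" for k
      unfolding pow_one_iff using u(2) by (rule dvd_mult2)
    then show ?thesis by (auto simp: L_def)
  qed
  then have "lower_central G (Suc r) = {\<one>}"
    using lc[of r] subgroup.one_closed[OF normal_imp_subgroup[OF lower_central_normal[of "Suc r"]]]
    by (simp only: subset_singleton_iff) blast
  then show ?thesis using is_group unfolding nilpotent_group_def by blast
qed

section \<open>The shape of a nilpotent group with a cycle\<close>

lemma coprime_of_cong_one:
  fixes u m :: nat
  assumes "\<And>p. prime p \<Longrightarrow> p dvd m \<Longrightarrow> [u = 1] (mod p)"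
  shows "coprime u m"
proof (rule ccontr)
  assume "\<not> coprime u m"
  then obtain q where q: "prime q" "q dvd u" "q dvd m"
    using prime_factor_nat[of "gcd u m"] by (auto simp: coprime_iff_gcd_eq_1)
  then have "q dvd 1"
    using cong_dvd_iff[OF assms[OF q(1,3)]] by blast
  then show False using q(1) not_prime_unit by blast
qed

text \<open>A common prime of u + 1 and m would divide 1 + 1.\<close>

lemma coprime_Suc_of_cong_one:
  fixes u m :: nat
  assumes "\<And>p. prime p \<Longrightarrow> p dvd m \<Longrightarrow> [u = 1] (mod p)" "odd m"
  shows "coprime (u + 1) m"
proof (rule ccontr)
  assume "\<not> coprime (u + 1) m"
  then obtain q where q: "prime q" "q dvd u + 1" "q dvd m"
    using prime_factor_nat[of "gcd (u + 1) m"] by (auto simp: coprime_iff_gcd_eq_1)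
  have "[u + 1 = 1 + 1] (mod q)"
    using assms(1)[OF q(1,3)] by (intro cong_add) auto
  then have "q dvd 2" using q(2) cong_dvd_iff[of "u + 1" 2 q] unfolding one_add_one by blast
  then have "q = 2" using q(1) primes_dvd_imp_eq[of q 2] two_is_prime_nat by blast
  then show False using q(3) assms(2) by simp
qed

text \<open>The group order is 2 N = 2^v n'. The exponent t0 inverts the 2-part of <w> and fixes its
  odd part, as conjugation does in D x C and Q x C. For v = 2 the 2-part of <w> has order 2, so t0 =
  1 modulo N.\<close>

locale split_order =
  fixes v n' N t0 :: nat
  assumes v: "v \<ge> 2" and n'_odd: "odd n'" and N_def: "N = 2 ^ (v - 1) * n'"
    and t0: "2 ^ (v - 1) dvd t0 + 1" "[t0 = 1] (mod n')"
begin

lemma two_power: "2 ^ (v - 1) = 2 * (2::nat) ^ (v - 2)"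
  using v by (metis Suc_1 Suc_diff_le diff_Suc_Suc power_Suc One_nat_def)

lemma N_pos: "N > 0"
  using n'_odd by (cases n') (auto simp: N_def)

lemma N_even: "even N"
  unfolding N_def two_power by simp

lemma coprime_2: "coprime ((2::nat) ^ k) n'"
  using n'_odd by simp

lemma cong_N_iff: "[x = y] (mod N) \<longleftrightarrow> [x = y] (mod 2 ^ (v - 1)) \<and> [x = y] (mod n')"
  for x y :: nat
proof
  assume "[x = y] (mod N)"
  then show "[x = y] (mod 2 ^ (v - 1)) \<and> [x = y] (mod n')"
    using cong_dvd_modulus_nat[of x y N] by (simp add: N_def)
next
  assume "[x = y] (mod 2 ^ (v - 1)) \<and> [x = y] (mod n')"
  then show "[x = y] (mod N)"
    unfolding N_def using coprime_cong_mult_nat[OF _ _ coprime_2] by blast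
qed

lemma half_N: "N div 2 = 2 ^ (v - 2) * n'"
  unfolding N_def two_power by simp

lemma t_cong_iff: "[t = t0] (mod N) \<longleftrightarrow> 2 ^ (v - 1) dvd t + 1 \<and> [t = 1] (mod n')"
proof -
  have "[t = t0] (mod 2 ^ (v - 1)) \<longleftrightarrow> [t + 1 = t0 + 1] (mod 2 ^ (v - 1))"
    by (simp only: cong_add_rcancel_nat)
  also have "\<dots> \<longleftrightarrow> 2 ^ (v - 1) dvd t + 1"
    using t0(1) cong_0_iff[of "t0 + 1" "2 ^ (v - 1)"] cong_0_iff[of "t + 1" "2 ^ (v - 1)"]
    by (meson cong_sym cong_trans)
  moreover have "[t = t0] (mod n') \<longleftrightarrow> [t = 1] (mod n')"
    using t0(2) by (meson cong_sym cong_trans)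
  ultimately show ?thesis unfolding cong_N_iff by blast
qed

text \<open>Modulo n', t + 1 is invertible, so t^2 = 1 gives t = 1. An odd e can be cancelled from t
  e = e on the 2-part, so t = 1 there as well, and e is a unit because e (i + 1) = 2 modulo n'. If e
  is even and v > 2, then 4 divides e (i + 1), hence 1 + t. Thus (t - 1) / 2 is odd, t e = e makes e
  a multiple of 2^(v - 2), and then 1 + t = e (i + 1) vanishes modulo 2^(v - 1).\<close>

lemma parameters_cong:
  assumes tt: "[t * t = 1] (mod N)" and te: "[t * e = e] (mod N)"
    and ei: "[e * (i + 1) = 1 + t] (mod N)"
    and p: "\<And>p. prime p \<Longrightarrow> p dvd N \<Longrightarrow> [t = 1] (mod p) \<and> [i = 1] (mod p)"
  shows "[e * (i + 1) = 2] (mod n')"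
    and "odd e \<Longrightarrow> [t = 1] (mod N) \<and> coprime e N"
    and "even e \<Longrightarrow> [t = t0] (mod N) \<and>
      (2 ^ (v - 1) dvd e \<or> 3 \<le> v \<and> [e = 2 ^ (v - 2)] (mod 2 ^ (v - 1)))"
proof -
  have n'N: "n' dvd N" by (simp add: N_def)
  have pn': "[t = 1] (mod p) \<and> [i = 1] (mod p)" if "prime p" "p dvd n'" for p
    using p that n'N dvd_trans by blast
  have t_n': "[t = 1] (mod n')"
  proof -
    have "int n' dvd int (t * t) - int 1"
      using tt cong_dvd_modulus_nat[OF _ n'N] cong_int_iff[of "t * t" 1 n'] cong_iff_dvd_diff by blast
    also have "int (t * t) - int 1 = (int t - 1) * int (t + 1)"
      by (simp add: algebra_simps)
    finally have "int n' dvd (int t - 1) * int (t + 1)" .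
    moreover have "coprime (int n') (int (t + 1))"
      using coprime_Suc_of_cong_one[of n' t] pn' n'_odd coprime_int_iff coprime_commute by blast
    ultimately have "int n' dvd int t - int 1"
      by (simp add: coprime_dvd_mult_left_iff)
    then show ?thesis using cong_int_iff[of t 1 n'] cong_iff_dvd_diff by blast
  qed
  have "[e * (i + 1) = 1 + t] (mod n')"
    using ei n'N by (rule cong_dvd_modulus_nat)
  moreover have "[1 + t = 1 + 1] (mod n')"
    using t_n' by (intro cong_add) auto
  ultimately show en': "[e * (i + 1) = 2] (mod n')"
    using cong_trans[of "e * (i + 1)" "1 + t" n' 2] unfolding one_add_one by blast
  have "[t = 1] (mod 2)" "[i = 1] (mod 2)"
    using p[of 2] N_even by auto
  then have odd: "odd t" "odd i"
    by (auto simp: cong_def odd_iff_mod_2_eq_one)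
  have te': "(2::int) ^ (v - 1) dvd (int t - 1) * int e"
  proof -
    have "[t * e = e] (mod 2 ^ (v - 1))" using te cong_N_iff by blast
    then have "int (2 ^ (v - 1)) dvd int (t * e) - int e"
      using cong_int_iff cong_iff_dvd_diff by blast
    then show ?thesis by (simp add: algebra_simps)
  qed
  {
    assume "odd e"
    then have "coprime ((2::int) ^ (v - 1)) (int e)"
      by simp
    then have "int (2 ^ (v - 1)) dvd int t - int 1"
      using te' by (simp add: coprime_dvd_mult_left_iff)
    then have "[t = 1] (mod 2 ^ (v - 1))"
      using cong_int_iff cong_iff_dvd_diff by blast
    moreover have "coprime e N"
    proof (rule ccontr)
      assume "\<not> coprime e N"
      then obtain q where q: "prime q" "q dvd e" "q dvd N"
        using prime_factor_nat[of "gcd e N"] by (auto simp: coprime_iff_gcd_eq_1)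
      have "q \<noteq> 2" using q(2) \<open>odd e\<close> by blast
      then have "coprime q (2 ^ (v - 1))"
        using primes_coprime[OF q(1) two_is_prime_nat] by simp
      then have "q dvd n'"
        using q(3) by (simp add: N_def coprime_dvd_mult_right_iff)
      then have "[e * (i + 1) = 2] (mod q)"
        using en' cong_dvd_modulus_nat by blast
      then have "q dvd 2" using q(2) cong_dvd_iff dvd_mult2 by blast
      then show False
        using \<open>q \<noteq> 2\<close> q(1) primes_dvd_imp_eq[of q 2] two_is_prime_nat by blast
    qed
    ultimately show "[t = 1] (mod N) \<and> coprime e N"
      using t_n' cong_N_iff by blast
  }
  {
    assume "even e"
    have i2: "2 dvd i + 1" using odd by simp
    have ei2: "[e * (i + 1) = 1 + t] (mod 2 ^ (v - 1))"
      using ei cong_N_iff by blast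
    show "[t = t0] (mod N) \<and> (2 ^ (v - 1) dvd e \<or> 3 \<le> v \<and> [e = 2 ^ (v - 2)] (mod 2 ^ (v - 1)))"
    proof (cases "v = 2")
      \<comment> \<open>Here the 2-part of the modulus is 2, so t odd and e even settle it.\<close>
      case True
      then show ?thesis
        using \<open>even e\<close> odd t_n' by (simp add: t_cong_iff)
    next
      case False
      then have v3: "v \<ge> 3" using v by simp
      have "(4::nat) = 2 ^ 2" by simp
      also have "\<dots> dvd 2 ^ (v - 1)" using v3 by (intro le_imp_power_dvd) auto
      finally have four: "(4::nat) dvd 2 ^ (v - 1)" .
      have "2 * 2 dvd e * (i + 1)"
        using \<open>even e\<close> i2 by (rule mult_dvd_mono)
      then have "4 dvd 1 + t"
        using cong_dvd_iff[OF cong_dvd_modulus_nat[OF ei2 four]] by simp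
      then obtain s where s: "1 + t = 4 * s" by blast
      \<comment> \<open>t - 1 = 2 (2 s - 1) with 2 s - 1 odd: one factor 2 cancels against the
        modulus, the rest is a unit.\<close>
      have "(2::int) * 2 ^ (v - 2) dvd 2 * ((2 * int s - 1) * int e)"
      proof -
        have "int t - 1 = 2 * (2 * int s - 1)" using arg_cong[OF s, of int] by simp
        moreover have "(2::int) ^ (v - 1) = 2 * 2 ^ (v - 2)"
          using arg_cong[OF two_power, of int] by simp
        ultimately show ?thesis using te' by (simp only: mult.assoc)
      qed
      then have "(2::int) ^ (v - 2) dvd (2 * int s - 1) * int e"
        by simp
      moreover have "coprime ((2::int) ^ (v - 2)) (2 * int s - 1)"
        by simp
      ultimately have "(2::int) ^ (v - 2) dvd int e"
        by (simp only: coprime_dvd_mult_right_iff)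
      then have "int (2 ^ (v - 2)) dvd int e" by simp
      then have e2: "2 ^ (v - 2) dvd e" by (simp only: int_dvd_int_iff)
      have "2 ^ (v - 2) * 2 dvd e * (i + 1)"
        using e2 i2 by (rule mult_dvd_mono)
      then have "2 ^ (v - 1) dvd t + 1"
        using cong_dvd_iff[OF ei2] unfolding two_power by (simp add: mult.commute)
      moreover have "2 ^ (v - 1) dvd e \<or> [e = 2 ^ (v - 2)] (mod 2 ^ (v - 1))"
      proof -
        obtain q where q: "e = 2 ^ (v - 2) * q" using e2 by blast
        show ?thesis
        proof (cases "even q")
          case True
          then obtain q' where "q = 2 * q'" by blast
          then show ?thesis unfolding q two_power by simp
        next
          case False
          then obtain q' where "q = 2 * q' + 1" by (rule oddE)
          then have "e = 2 ^ (v - 2) + 2 ^ (v - 1) * q'"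
            unfolding q two_power by (simp add: algebra_simps)
          then show ?thesis by (simp add: cong_def)
        qed
      qed
      ultimately show ?thesis
        using v3 t_n' t_cong_iff by blast
    qed
  }
qed

text \<open>These are the squares reachable by \<open>change_y\<close>. The choice c = -e / 2 modulo
  n' removes the odd part of e, and the 2-part does not move because 1 + t0 vanishes there.\<close>

lemma normalize_square:
  "\<exists>c. n' dvd c + t0 * c + e \<and> [c + t0 * c + e = e] (mod 2 ^ (v - 1))"
proof -
  have "coprime 2 n'" using n'_odd by simp
  then obtain d where d: "[2 * d = 1] (mod n')"
    using cong_solve_coprime_nat[of 2 n'] by auto
  define c where "c = d * (e * (n' - 1))"
  have "[c + t0 * c + e = 2 * c + e] (mod n')"
  proof -
    have "[c + t0 * c + e = c + 1 * c + e] (mod n')"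
      using t0(2) by (intro cong_add cong_mult cong_refl)
    then show ?thesis by (simp add: mult_2)
  qed
  also have "[2 * c + e = 1 * (e * (n' - 1)) + e] (mod n')"
    unfolding c_def mult.assoc[symmetric] using d by (intro cong_add cong_mult cong_refl) auto
  also have "1 * (e * (n' - 1)) + e = e * n'"
    using n'_odd by (cases n') auto
  finally have "n' dvd c + t0 * c + e"
    using cong_dvd_iff[of "c + t0 * c + e" "e * n'" n'] by simp
  moreover have "[c + t0 * c + e = e] (mod 2 ^ (v - 1))"
  proof -
    obtain q where "t0 + 1 = 2 ^ (v - 1) * q" using t0(1) by blast
    then have "c + t0 * c + e = e + 2 ^ (v - 1) * (q * c)"
      by (metis add.commute add_mult_distrib mult.assoc mult_1)
    then show ?thesis by (simp add: cong_def)
  qed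
  ultimately show ?thesis by blast
qed

lemma half_N_cong: "[N div 2 = 2 ^ (v - 2)] (mod 2 ^ (v - 1))"
proof -
  obtain q where "n' = 2 * q + 1" using n'_odd by (rule oddE)
  then have "N div 2 = 2 ^ (v - 2) + 2 ^ (v - 1) * q"
    unfolding half_N two_power by (simp add: algebra_simps)
  then show ?thesis by (simp add: cong_def)
qed

end

text \<open>With \<open>t = t0\<close> as in \<open>split_order\<close>, the value \<open>e = 0\<close> describes \<open>D \<times> C\<close> (or \<open>C\<^sub>2 \<times> C\<^sub>N\<close> if \<open>v = 2\<close>)
  and \<open>e = N div 2\<close> describes \<open>Q \<times> C\<close>, where \<open>D\<close>, \<open>Q\<close> have order \<open>2\<^sup>v\<close> and \<open>C\<close> is cyclic of order \<open>n'\<close>.\<close>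

definition has_type :: "('g, 'x) monoid_scheme \<Rightarrow> nat \<Rightarrow> nat \<Rightarrow> nat \<Rightarrow> bool" where
  "has_type G N t e \<longleftrightarrow> (\<exists>w y. metacyclic G w y N t e)"

section \<open>Dihedral and quaternion types and what tells them apart\<close>

lemma has_type_iso:
  assumes "has_type G N t e" "G \<cong> K" "group K"
  shows "has_type K N t e"
proof -
  obtain f where "f \<in> iso G K" using assms(2) by (auto simp: is_iso_def)
  then show ?thesis using assms(1,3) metacyclic_iso_image[of G _ _ N t e f K] unfolding has_type_def by blast
qed

lemma has_type_imp_iso:
  assumes "has_type G N t e" "has_type K N t e"
  shows "G \<cong> K"
proof -
  obtain w y w' y' where "metacyclic G w y N t e" "metacyclic K w' y' N t e"
    using assms by (auto simp: has_type_def)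
  then obtain f where "f \<in> iso G K" by (rule metacyclic_iso)
  then show ?thesis by (auto simp: is_iso_def)
qed

context split_order
begin

lemma dihedral_type_if:
  assumes "metacyclic G w y N t0 e" "2 ^ (v - 1) dvd e"
  shows "has_type G N t0 0"
proof -
  interpret metacyclic G w y N t0 e by (rule assms)
  obtain c where c: "n' dvd c + t0 * c + e" "[c + t0 * c + e = e] (mod 2 ^ (v - 1))"
    using normalize_square by blast
  have "[c + t0 * c + e = 0] (mod 2 ^ (v - 1))"
    using c(2) assms(2) by (meson cong_0_iff cong_trans)
  then have "[c + t0 * c + e = 0] (mod N)"
    using c(1) by (simp only: cong_N_iff cong_0_iff)
  then show ?thesis
    using metacyclic.change_params[OF change_y[of c] cong_refl] unfolding has_type_def by blast
qed

lemma quaternion_type_if: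
  assumes "metacyclic G w y N t0 e" "[e = 2 ^ (v - 2)] (mod 2 ^ (v - 1))"
  shows "has_type G N t0 (N div 2)"
proof -
  interpret metacyclic G w y N t0 e by (rule assms)
  obtain c where c: "n' dvd c + t0 * c + e" "[c + t0 * c + e = e] (mod 2 ^ (v - 1))"
    using normalize_square by blast
  have "[c + t0 * c + e = N div 2] (mod 2 ^ (v - 1))"
    using c(2) assms(2) half_N_cong by (meson cong_sym cong_trans)
  moreover have "[c + t0 * c + e = N div 2] (mod n')"
    using c(1) by (simp add: cong_def half_N)
  ultimately have "[c + t0 * c + e = N div 2] (mod N)"
    using cong_N_iff by blast
  then show ?thesis
    using metacyclic.change_params[OF change_y[of c] cong_refl] unfolding has_type_def by blast
qed

text \<open>With u standing for t0 - 1, both 2 and n' divide u, so N divides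
  \<open>u ^ v\<close>.\<close>

lemma nilpotent_type:
  assumes "has_type G N t0 e"
  shows "nilpotent_group G"
proof -
  obtain w y where "metacyclic G w y N t0 e" using assms by (auto simp: has_type_def)
  then interpret metacyclic G w y N t0 e .
  have "n' > 0" using n'_odd by (cases n') auto
  define u where "u = t0 + (N - 1)"
  have u: "[t0 = 1 + u] (mod N)"
    using N_pos by (simp add: u_def cong_def)
  have "odd t0"
  proof -
    have "even (t0 + 1)" using t0(1) two_power by (metis dvd_trans dvd_triv_left)
    then show ?thesis by simp
  qed
  then have "2 dvd u" using N_even N_pos by (simp add: u_def)
  have "n' dvd u"
  proof -
    have "[1 + u = 1 + 0] (mod n')"
      using u t0(2) cong_N_iff by (metis add_0_right cong_sym cong_trans)
    then show ?thesis by (simp only: cong_add_lcancel_nat cong_0_iff)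
  qed
  then have "2 * n' dvd u"
    using \<open>2 dvd u\<close> n'_odd by (simp add: divides_mult)
  then have "(2 * n') ^ v dvd u ^ v" by (rule dvd_power_same)
  moreover have "N dvd (2 * n') ^ v"
    unfolding N_def power_mult_distrib using v
    by (intro mult_dvd_mono le_imp_power_dvd dvd_power) auto
  ultimately have "N dvd u ^ v" by (rule dvd_trans[rotated])
  with u show ?thesis by (rule nilpotent)
qed

text \<open>The witnesses are w^(N / 2) and y. Having two involutions separates this type from the
  cyclic group and from the quaternion type.\<close>

lemma dihedral_involutions:
  fixes G (structure)
  assumes "has_type G N t0 0"
  shows "\<exists>u z. u \<in> carrier G \<and> z \<in> carrier G \<and> u \<noteq> z \<and> u \<noteq> \<one> \<and> z \<noteq> \<one> \<and>
    u \<otimes> u = \<one> \<and> z \<otimes> z = \<one>"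
proof -
  obtain w y where "metacyclic G w y N t0 0" using assms by (auto simp: has_type_def)
  then interpret metacyclic G w y N t0 0 .
  have "\<not> N dvd N div 2" using N_pos N_even by (auto dest: dvd_imp_le)
  then have "w [^] (N div 2) \<noteq> \<one>" by (simp add: pow_one_iff)
  moreover have "w [^] (N div 2) \<otimes> w [^] (N div 2) = \<one>"
    using N_even by (simp add: nat_pow_mult pow_one_iff flip: mult_2)
  moreover have "w [^] (N div 2) \<noteq> y" "y \<noteq> \<one>"
    using y_notin by (auto, metis nat_pow_0 rangeI)
  moreover have "y \<otimes> y = \<one>" using sq by simp
  ultimately show ?thesis by (intro exI[of _ "w [^] (N div 2)"] exI[of _ y]) auto
qed

text \<open>The square of \<open>w [^] k \<otimes> y\<close> has exponent (1 + t0) k + N / 2, which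
  is 2^(v - 2) modulo 2^(v - 1) and so never 0. Hence involutions lie in <w>, which has only
  one.\<close>

lemma quaternion_involution:
  fixes G (structure)
  assumes "has_type G N t0 (N div 2)" "3 \<le> v"
    and "u \<in> carrier G" "u \<noteq> \<one>" "u \<otimes> u = \<one>"
    and "z \<in> carrier G" "z \<noteq> \<one>" "z \<otimes> z = \<one>"
  shows "u = z"
proof -
  obtain w y where "metacyclic G w y N t0 (N div 2)" using assms by (auto simp: has_type_def)
  then interpret metacyclic G w y N t0 "N div 2" .
  have *: "x = w [^] (N div 2)" if x: "x \<in> carrier G" "x \<noteq> \<one>" "x \<otimes> x = \<one>" for x
    using x(1)
  proof (cases rule: elem_cases)
    case (1 k)
    then have "N dvd 2 * k" using x(3) by (simp add: nat_pow_mult pow_one_iff mult_2)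
    then obtain q where q: "2 * k = N * q" by blast
    then have k: "k = N div 2 * q" using N_even by (metis dvd_div_mult nonzero_mult_div_cancel_left zero_neq_numeral)
    have "odd q"
    proof
      assume "even q"
      then obtain q' where "q = 2 * q'" by blast
      then have "k = N * q'" using q by simp
      then show False using x(2) 1 by (simp add: pow_one_iff)
    qed
    then obtain q' where "q = 2 * q' + 1" by (rule oddE)
    then have "k = N div 2 + N * q'" using q N_even by auto
    then show ?thesis using 1 by (simp add: pow_cong_iff cong_def)
  next
    case (2 k)
    then have "N dvd k + t0 * k + N div 2"
      using x(3) by (simp add: mult_y_y pow_one_iff)
    then have "2 ^ (v - 1) dvd k + t0 * k + N div 2"
      using N_def dvd_mult_left by blast
    moreover have "2 ^ (v - 1) dvd k + t0 * k"
      using t0(1) dvd_mult2[of "2 ^ (v - 1)" "t0 + 1" k] by (simp add: algebra_simps)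
    ultimately have "2 ^ (v - 1) dvd N div 2"
      by (simp add: dvd_add_right_iff)
    then have "2 ^ (v - 1) dvd (2::nat) ^ (v - 2)"
      using cong_dvd_iff[OF half_N_cong] by blast
    then show ?thesis
      using assms(2) power_dvd_imp_le[of 2 "v - 1" "v - 2"] by simp
  qed
  show ?thesis using *[of u] *[of z] assms by simp
qed

end

lemma (in cyclic_gen) involution_unique:
  assumes "u \<in> carrier G" "u \<noteq> \<one>" "u \<otimes> u = \<one>" and "z \<in> carrier G" "z \<noteq> \<one>" "z \<otimes> z = \<one>"
  shows "u = z"
proof -
  have *: "even N \<and> x = w [^] (N div 2)" if x: "x \<in> carrier G" "x \<noteq> \<one>" "x \<otimes> x = \<one>" for x
  proof -
    obtain k :: nat where k: "x = w [^] k" using x(1) by (rule elem_cases)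
    then have "N dvd 2 * k" using x(3) by (simp add: nat_pow_mult pow_one_iff mult_2)
    then obtain q where q: "2 * k = N * q" by blast
    have "odd q"
    proof
      assume "even q"
      then obtain q' where "q = 2 * q'" by blast
      then have "k = N * q'" using q by simp
      then show False using x(2) k by (simp add: pow_one_iff)
    qed
    have "even (N * q)" using q by (metis dvd_triv_left)
    then have "even N" using \<open>odd q\<close> by simp
    obtain q' where "q = 2 * q' + 1" using \<open>odd q\<close> by (rule oddE)
    then have "k = N div 2 + N * q'" using q \<open>even N\<close> by auto
    then show ?thesis using k \<open>even N\<close> by (simp add: pow_cong_iff cong_def)
  qed
  show ?thesis using *[of u] *[of z] assms by simp
qed

text \<open>\<open>y \<otimes> y\<close> is w^e and generates <w>, so the powers of y cover both
  cosets.\<close>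

lemma (in metacyclic) cyclic_if_coprime:
  assumes "coprime e N" "[t = 1] (mod N)" "even N"
  shows "cyclic_gen G y (2 * N)"
proof -
  obtain d where d: "[e * d = 1] (mod N)"
    using cong_solve_coprime_nat[OF assms(1)] by auto
  have y2: "y [^] (2 * k) = w [^] (e * k)" for k :: nat
  proof -
    have "y [^] (2::nat) = w [^] e" by (simp add: numeral_2_eq_2 sq)
    then show ?thesis by (metis nat_pow_pow w_closed y_closed)
  qed
  have y21: "y [^] (2 * k + 1) = w [^] (e * k) \<otimes> y" for k :: nat
    using y2[of k] by simp
  have ed: "[e * (d * k) = k] (mod N)" for k
    using cong_scalar_right[OF d, of k] by (simp add: mult.assoc)
  show ?thesis
  proof unfold_locales
    show "y [^] q = \<one> \<longleftrightarrow> 2 * N dvd q" for q :: nat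
    proof (cases "even q")
      case True
      then obtain k where k: "q = 2 * k" by blast
      show ?thesis
        using assms(1) by (simp add: k y2 pow_one_iff coprime_dvd_mult_right_iff coprime_commute)
    next
      case False
      then obtain k where k: "q = 2 * k + 1" by (rule oddE)
      have "y [^] q \<noteq> \<one>"
        using pow_neq_pow_y[of 0 "e * k"] unfolding k y21 by simp
      moreover have "\<not> 2 * N dvd q" using False by (meson dvd_trans dvd_triv_left)
      ultimately show ?thesis by simp
    qed
    show "carrier G \<subseteq> range (\<lambda>k::nat. y [^] k)"
    proof
      fix x assume "x \<in> carrier G"
      then show "x \<in> range (\<lambda>k::nat. y [^] k)"
      proof (cases rule: elem_cases)
        case (1 k)
        then have "x = y [^] (2 * (d * k))"
          using ed[of k] by (simp only: y2 pow_cong_iff cong_sym)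
        then show ?thesis by blast
      next
        case (2 k)
        then have "x = y [^] (2 * (d * k) + 1)"
          using ed[of k] by (simp only: y21 pow_y_cong_iff cong_sym)
        then show ?thesis by blast
      qed
    qed
  qed (use N_pos in auto)
qed

section \<open>From a cycle to metacyclic parameters\<close>

context hol_cycle
begin

text \<open>The square of the cycle sends w^x to w^(i^2 x + 1), where w =
  \<open>g 2\<close>.\<close>

lemma g_even_power:
  assumes "\<sigma> (g 2) = g 2 [^] i"
  shows "g (2 * k) = g 2 [^] geom (i * i) k"
proof (induction k)
  case (Suc k)
  have "g (2 * Suc k) = (\<sigma> ^^ 2) (g (2 * k)) \<otimes> g 2"
    by (subst g_add[symmetric]) simp
  also have "(\<sigma> ^^ 2) (g (2 * k)) = (\<sigma> ^^ 2) (g 2) [^] geom (i * i) k"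
    unfolding Suc by (simp only: iter_pow g_closed)
  also have "(\<sigma> ^^ 2) (g 2) = g 2 [^] (i * i)"
    using assms iter_pow[of "g 2" 1 i] by (simp add: numeral_2_eq_2 nat_pow_pow)
  finally show ?case
    by (simp add: nat_pow_pow geom_Suc_shift)
qed simp

text \<open>\<sigma> is injective, but with d = gcd i N it sends x^(N / d) to a power of x^N =
  1.\<close>

lemma coprime_sigma_exponent:
  assumes x: "x \<in> carrier G" and ord: "\<And>q::nat. x [^] q = \<one> \<longleftrightarrow> N dvd q" and "N > 0"
    and i: "\<sigma> x = x [^] i"
  shows "coprime i N"
proof -
  define d where "d = gcd i N"
  obtain i' N' where d: "i = d * i'" "N = d * N'" unfolding d_def by (meson dvdE gcd_dvd1 gcd_dvd2)
  have "\<sigma> (x [^] N') = x [^] (i * N')"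
    using iter_pow[OF x, of 1 N'] i x by (simp add: nat_pow_pow)
  also have "i * N' = N * i'" by (simp add: d)
  also have "x [^] (N * i') = \<sigma> \<one>" by (simp add: ord)
  finally have "x [^] N' = \<one>" using x by (subst (asm) sigma_inj) auto
  then have "N dvd N'" by (simp add: ord)
  then have "d = 1" using d(2) \<open>N > 0\<close> by auto
  then show ?thesis by (simp add: d_def coprime_iff_gcd_eq_1)
qed

text \<open>By \<open>order_generator\<close> the powers of w = \<open>g 2\<close> fill
  \<open>H 2\<close>; t, e and i exist because \<open>H 2\<close> is normal and invariant with a
  quotient of order 2.\<close>

lemma metacyclic_structure:
  assumes nil: "nilpotent_group G" and four: "4 dvd n"
  shows "\<exists>t e i. metacyclic G (g 2) a (n div 2) t e \<and> \<sigma> (g 2) = g 2 [^] i \<and>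
    [e * (i + 1) = 1 + t] (mod n div 2) \<and>
    (\<forall>p. prime p \<longrightarrow> p dvd n div 2 \<longrightarrow> [t = 1] (mod p) \<and> [i = 1] (mod p))"
proof -
  define N where "N = n div 2"
  have two: "2 dvd n" using four by presburger
  have nN: "n = 2 * N" using two by (simp add: N_def)
  have Npos: "N > 0" using n_pos nN by simp
  have Neven: "even N" using four nN by auto
  define w where "w = g 2"
  have wc [simp]: "w \<in> carrier G" by (simp add: w_def)
  have ord: "w [^] q = \<one> \<longleftrightarrow> N dvd q" for q :: nat
    unfolding w_def N_def using order_generator[OF nil, of 2 q] two by simp
  have H2: "H 2 \<lhd> G" "\<sigma> ` H 2 \<subseteq> H 2"
    using H_normal_invariant[OF nil two] by auto
  interpret H2: normal "H 2" G by (rule H2(1))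
  have wH: "w \<in> H 2" by (auto simp: w_def H_def)
  have cardH: "card (H 2) = N" using card_H[OF two] nN by simp
  have H2_eq: "H 2 = range (\<lambda>k::nat. w [^] k)"
  proof -
    have sub: "(\<lambda>k. w [^] k) ` {..<N} \<subseteq> H 2"
      using subgroup_pow_mem[OF H2.subgroup_axioms wH] by blast
    have "inj_on (\<lambda>k. w [^] k) {..<N}"
      by (auto simp: inj_on_def pow_eq_pow_iff[OF wc ord] cong_def)
    then have "card ((\<lambda>k. w [^] k) ` {..<N}) = card (H 2)"
      by (simp add: card_image cardH)
    then have "(\<lambda>k. w [^] k) ` {..<N} = H 2"
      using sub finite_subset[OF H_subset fin] by (intro card_subset_eq) auto
    moreover have "range (\<lambda>k::nat. w [^] k) \<subseteq> H 2"
      using subgroup_pow_mem[OF H2.subgroup_axioms wH] by blast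
    ultimately show ?thesis by blast
  qed
  have "a \<otimes> w \<otimes> inv a \<in> H 2"
    using wH by (intro H2.inv_op_closed2) auto
  then obtain t :: nat where t: "a \<otimes> w \<otimes> inv a = w [^] t"
    unfolding H2_eq by blast
  have conj: "a \<otimes> w = w [^] t \<otimes> a"
    unfolding t[symmetric] by (simp add: m_assoc)
  have "a \<otimes> a \<in> H 2"
  proof -
    interpret Q: group "G Mod H 2" by (rule H2.factorgroup_is_group)
    have "(H 2 #> a) [^]\<^bsub>G Mod H 2\<^esub> (2::nat) = H 2"
      using Q.pow_order_eq_1[of "H 2 #> a"] H_FactGroup[OF two H2] by (simp add: carrier_FactGroup)
    then have "a [^] (2::nat) \<in> H 2"
      using H2.FactGroup_pow[of a 2] H2.rcoset_eq_self_iff[of "a [^] (2::nat)"] by simp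
    then show ?thesis by (simp add: numeral_2_eq_2)
  qed
  then obtain e :: nat where e: "a \<otimes> a = w [^] e" unfolding H2_eq by blast
  have "\<sigma> w \<in> H 2" using H2(2) wH by blast
  then obtain i :: nat where i: "\<sigma> w = w [^] i" unfolding H2_eq by blast
  have a_notin: "a \<notin> H 2" using mem_H_iff[OF two, of 1] by simp
  have carr: "carrier G \<subseteq> range (\<lambda>k::nat. w [^] k) \<union> range (\<lambda>k::nat. w [^] k \<otimes> a)"
  proof
    fix x assume "x \<in> carrier G"
    then obtain k where k: "x = g k" by (rule g_obtain)
    show "x \<in> range (\<lambda>k::nat. w [^] k) \<union> range (\<lambda>k::nat. w [^] k \<otimes> a)"
    proof (cases "even k")
      case True
      then have "x \<in> H 2" by (auto simp: k H_def)
      then show ?thesis unfolding H2_eq by blast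
    next
      case False
      then obtain l where l: "k = 2 * l + 1" by (rule oddE)
      have "\<sigma> (g (2 * l)) \<in> H 2" using H2(2) by (auto simp: H_def)
      then show ?thesis unfolding H2_eq by (auto simp: k l)
    qed
  qed
  interpret M: metacyclic G w a N t e
    using Npos ord carr a_notin conj e H2_eq by unfold_locales auto
  have sa: "\<sigma> a \<otimes> a = w" by (simp add: w_def numeral_2_eq_2)
  \<comment> \<open>Here the relation for e (i + 1) arises: b a = w and b b = w^(i e) give b w =
    w^(i e) a, while a w^t = w a because t t = 1. Computing b a w^t in two ways yields w^(1 + t) =
    w^(i e + e).\<close>
  define b where "b = \<sigma> a"
  have bc [simp]: "b \<in> carrier G" by (simp add: b_def)
  have "b \<otimes> b = w [^] (i * e)"
    using iter_pow[OF wc, of 1 e] i arg_cong[OF e, of \<sigma>] by (simp add: b_def nat_pow_pow)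
  then have "w [^] (i * e) \<otimes> a = b \<otimes> (b \<otimes> a)" by (simp add: m_assoc[symmetric])
  also have "b \<otimes> a = w" using sa by (simp add: b_def)
  finally have bw: "b \<otimes> w = w [^] (i * e) \<otimes> a" ..
  have "[t * t = 1] (mod N)" by (rule M.t_sq)
  then have "a \<otimes> w [^] t = w \<otimes> a"
    using M.y_pow[of t] M.pow_y_cong_iff[of "t * t" 1] by simp
  then have "b \<otimes> a \<otimes> w [^] t = b \<otimes> w \<otimes> a" by (simp add: m_assoc)
  then have "w \<otimes> w [^] t = w [^] (i * e) \<otimes> a \<otimes> a"
    using bw \<open>b \<otimes> a = w\<close> by simp
  then have "w [^] (1 + t) = w [^] (e * (i + 1))"
    using nat_pow_Suc2[OF wc, of t] by (simp add: m_assoc e nat_pow_mult algebra_simps)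
  then have ei: "[e * (i + 1) = 1 + t] (mod N)"
    by (simp only: M.pow_cong_iff cong_sym)
  \<comment> \<open>The central subgroup of order p lies in <w>; it contains w^c with c = (N / p) c'
    and c' prime to p. That a commutes with w^c says c = t c modulo N, and dividing by N / p and c'
    leaves t = 1 modulo p.\<close>
  have t1: "[t = 1] (mod p)" if p: "prime p" "p dvd N" for p
  proof -
    have pn: "p dvd n" using p(2) nN by simp
    obtain m where m: "n = p ^ multiplicity p n * m" "\<not> p dvd m"
      using multiplicity_decompose'[of n p] n_pos p(1) not_prime_unit[of p] by (metis less_not_refl2)
    have mpos: "multiplicity p n > 0"
      using p(1) pn n_pos by (simp add: prime_multiplicity_gt_zero_iff)
    note central = central_prime_subgroup[OF nil p(1) m(1) mpos m(2)]
    have p0: "p > 0" using p(1) prime_gt_0_nat by blast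
    obtain N' where N': "N = p * N'" using p(2) by blast
    have npd: "n div p = 2 * N'" using nN N' p0 by simp
    then have "g (n div p) \<in> H 2" by (auto simp: H_def)
    then obtain c :: nat where c: "g (n div p) = w [^] c" unfolding H2_eq by blast
    have zH: "g (n div p) \<in> H (n div p)" by (auto simp: H_def)
    have cardp: "card (H (n div p)) = p"
    proof -
      have "card (H (n div p)) * (n div p) = p * (n div p)"
        using card_H[of "n div p"] pn div_dvd_iff_mult[of p n n] p0 by simp
      then show ?thesis using n_pos pn by auto
    qed
    have "w [^] (c * p) = \<one>"
      using pow_card_subgroup[OF central(1) zH] cardp c by (simp add: nat_pow_pow)
    then have "p * N' dvd p * c" using ord N' by (simp add: mult.commute)
    then have "N' dvd c" using p0 by simp
    then obtain c' where c': "c = N' * c'" by blast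
    have "\<not> p dvd c'"
    proof
      assume "p dvd c'"
      then have "N dvd c" unfolding N' c' by (metis mult.commute mult_dvd_mono dvd_refl)
      then have "g (n div p) = \<one>" using c ord by simp
      then have "n dvd n div p" by (simp add: g_eq_one_iff)
      then show False
        using npd nN N' Npos p(1) prime_gt_1_nat[of p] by (auto dest!: dvd_imp_le)
    qed
    have "w [^] c \<otimes> a = a \<otimes> w [^] c" using central(2)[OF zH] c by simp
    then have "[c = t * c] (mod N)" using M.y_pow[of c] M.pow_y_cong_iff by simp
    then have "[N' * c' = N' * (t * c')] (mod N' * p)" by (simp add: c' N' algebra_simps)
    then have "[c' = t * c'] (mod p)"
      using Npos N' by (simp add: cong_def mult_mod_right[symmetric])
    then have "[1 * c' = t * c'] (mod p)" by simp
    moreover have "coprime c' p"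
      using p(1) \<open>\<not> p dvd c'\<close> prime_imp_coprime coprime_commute by blast
    ultimately have "[1 = t] (mod p)" using cong_mult_rcancel_nat by blast
    then show ?thesis by (rule cong_sym)
  qed
  have cop: "coprime i N" using coprime_sigma_exponent[OF wc ord Npos i] .
  \<comment> \<open>The even-indexed terms fill <w>, so the sequence with multiplier
    \<open>i * i\<close> has full period.\<close>
  have lcg: "lcg_unit N (i * i)"
  proof (rule lcg_unit_if_geom_onto)
    show "coprime (i * i) N" using cop by simp
    fix c :: nat
    have "w [^] c \<in> H 2" unfolding H2_eq by (rule rangeI)
    then obtain k where "w [^] c = g (2 * k)" unfolding H_def by auto
    then have "w [^] c = w [^] geom (i * i) k"
      using g_even_power[of i k] i by (simp add: w_def)
    then show "\<exists>k. [geom (i * i) k = c] (mod N)"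
      using M.pow_cong_iff cong_sym by blast
  qed
  have i1: "[i = 1] (mod p)" if p: "prime p" "p dvd N" for p
  proof -
    have ii: "[i * i = 1] (mod p)" using lcg p by (auto simp: lcg_unit_def)
    then have "int p dvd int (i * i) - int 1"
      using cong_int_iff cong_iff_dvd_diff by blast
    also have "int (i * i) - int 1 = (int i - int 1) * int (i + 1)"
      by (simp add: algebra_simps)
    finally have "int p dvd int i - int 1 \<or> int p dvd int (i + 1)"
      using p(1) prime_dvd_multD[of "int p"] by simp
    then show ?thesis
    proof
      assume "int p dvd int i - int 1"
      then show ?thesis using cong_int_iff cong_iff_dvd_diff by blast
    next
      \<comment> \<open>The case i = -1 modulo p: the relation for e (i + 1) makes p divide 1 + t,
        that is, 2.\<close>
      assume "int p dvd int (i + 1)"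
      then have pi: "p dvd i + 1" by (simp only: int_dvd_int_iff)
      have "[e * (i + 1) = 1 + t] (mod p)"
        using ei p(2) by (rule cong_dvd_modulus_nat)
      then have "p dvd 1 + t" using pi cong_dvd_iff dvd_mult by blast
      moreover have "[1 + t = 1 + 1] (mod p)" using t1[OF p] by (intro cong_add) auto
      ultimately have "p dvd 2" using cong_dvd_iff[of "1 + t" 2 p] unfolding one_add_one by blast
      then have "p = 2" using p(1) primes_dvd_imp_eq[of p 2] two_is_prime_nat by blast
      then show ?thesis using pi by (simp add: cong_def) presburger
    qed
  qed
  show ?thesis
    unfolding N_def[symmetric] w_def[symmetric]
    by (intro exI[of _ t] exI[of _ e] exI[of _ i] conjI M.metacyclic_axioms i ei) (use t1 i1 in blast)
qed

end

section \<open>Regular embeddings and cycles\<close>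

lemma BijGroup_mult:
  assumes "f \<in> Bij S" "h \<in> Bij S"
  shows "f \<otimes>\<^bsub>BijGroup S\<^esub> h = compose S f h"
  using assms by (simp add: BijGroup_def)

lemma BijGroup_carrier: "carrier (BijGroup S) = Bij S"
  by (simp add: BijGroup_def)

lemma BijGroup_one: "\<one>\<^bsub>BijGroup S\<^esub> = (\<lambda>x\<in>S. x)"
  by (simp add: BijGroup_def)

lemma autoD:
  assumes "\<alpha> \<in> auto G"
  shows "\<alpha> \<in> hom G G" "\<alpha> \<in> Bij (carrier G)" "bij_betw \<alpha> (carrier G) (carrier G)"
    "\<alpha> \<in> extensional (carrier G)"
  using assms by (auto simp: auto_def Bij_def)

lemma restrict_iso_auto:
  assumes "group G" "f \<in> iso G G"
  shows "restrict f (carrier G) \<in> auto G"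
proof -
  interpret group G by (rule assms)
  have "restrict f (carrier G) \<in> hom G G"
    using assms(2) by (auto simp: iso_def hom_def Pi_def)
  moreover have "bij_betw (restrict f (carrier G)) (carrier G) (carrier G)"
    using assms(2) by (simp add: iso_def bij_betw_def inj_on_def)
  ultimately show ?thesis by (simp add: auto_def Bij_def)
qed

lemma reg_embeddingsD:
  assumes "\<beta> \<in> reg_embeddings Gam G"
  shows "\<beta> \<in> hom Gam (BijGroup (carrier G))" "\<beta> \<in> extensional (carrier Gam)"
    "\<beta> ` carrier Gam \<subseteq> Hol G" "inj_on \<beta> (carrier Gam)"
    "\<And>x y. x \<in> carrier G \<Longrightarrow> y \<in> carrier G \<Longrightarrow> \<exists>!h. h \<in> \<beta> ` carrier Gam \<and> h x = y"
  using assms by (auto simp: reg_embeddings_def)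

text \<open>An element of the holomorph has the form x -> \<sigma>(x) u^-1, and the powers of
  \<open>\<beta> c\<close> send 1 to the terms of \<open>orb\<close>; regularity makes these exhaust
  G.\<close>

lemma embedding_cycle:
  fixes G (structure)
  assumes Gam: "cyclic_gen Gam c n" and G: "group G" and \<beta>: "\<beta> \<in> reg_embeddings Gam G"
  obtains \<sigma> a where "\<sigma> \<in> auto G" "hol_cycle G \<sigma> a"
    "\<And>x. x \<in> carrier G \<Longrightarrow> \<beta> c x = \<sigma> x \<otimes> a"
proof -
  interpret C: cyclic_gen Gam c n by (rule Gam)
  interpret G: group G by (rule G)
  note b = reg_embeddingsD[OF \<beta>]
  have "\<beta> c \<in> Hol G" using b(3) by auto
  then obtain u \<sigma> where us: "u \<in> carrier G" "\<sigma> \<in> auto G" "\<beta> c = compose (carrier G) (rho G u) \<sigma>"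
    by (auto simp: Hol_def)
  note sig = autoD[OF us(2)]
  define a where "a = inv u"
  have sc: "\<sigma> x \<in> carrier G" if "x \<in> carrier G" for x
    using sig(1) that by (auto simp: hom_def)
  have bc: "\<beta> c x = \<sigma> x \<otimes> a" if "x \<in> carrier G" for x
    using that us sc by (simp add: compose_def rho_def a_def)
  have bB: "\<beta> x \<in> Bij (carrier G)" if "x \<in> carrier Gam" for x
    using b(1) that by (auto simp: hom_def BijGroup_carrier)
  have orb: "\<beta> (c [^]\<^bsub>Gam\<^esub> k) \<one> = orb G \<sigma> a k" for k :: nat
  proof (induction k)
    case 0
    interpret h: group_hom Gam "BijGroup (carrier G)" \<beta>
      using b(1) C.is_group group_BijGroup by (simp add: group_hom_def group_hom_axioms_def)
    show ?case using h.hom_one by (simp add: BijGroup_one)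
  next
    case (Suc k)
    have "\<beta> (c [^]\<^bsub>Gam\<^esub> Suc k) = \<beta> (c \<otimes>\<^bsub>Gam\<^esub> c [^]\<^bsub>Gam\<^esub> k)"
      using C.nat_pow_Suc2[OF C.w_closed, of k] by simp
    also have "\<dots> = \<beta> c \<otimes>\<^bsub>BijGroup (carrier G)\<^esub> \<beta> (c [^]\<^bsub>Gam\<^esub> k)"
      using b(1) by (simp add: hom_def)
    also have "\<dots> = compose (carrier G) (\<beta> c) (\<beta> (c [^]\<^bsub>Gam\<^esub> k))"
      by (intro BijGroup_mult bB) auto
    finally have "\<beta> (c [^]\<^bsub>Gam\<^esub> Suc k) \<one> = \<beta> c (orb G \<sigma> a k)"
      using Suc by (simp add: compose_def)
    moreover have "orb G \<sigma> a k \<in> carrier G"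
      unfolding Suc[symmetric] using Bij_imp_funcset[OF bB[of "c [^]\<^bsub>Gam\<^esub> k"]] by auto
    ultimately show ?case using bc by simp
  qed
  have onto: "carrier G \<subseteq> range (orb G \<sigma> a)"
  proof
    fix y assume "y \<in> carrier G"
    then obtain x where x: "x \<in> carrier Gam" "\<beta> x \<one> = y"
      using b(5)[of "\<one>" y] by auto
    obtain k :: nat where "x = c [^]\<^bsub>Gam\<^esub> k" using x(1) by (rule C.elem_cases)
    then show "y \<in> range (orb G \<sigma> a)" using x(2) orb by blast
  qed
  have "finite (carrier Gam)" unfolding C.carrier_eq by simp
  then have "finite ((\<lambda>x. \<beta> x \<one>) ` carrier Gam)" by (rule finite_imageI)
  moreover have "carrier G \<subseteq> (\<lambda>x. \<beta> x \<one>) ` carrier Gam"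
  proof
    fix y assume "y \<in> carrier G"
    then show "y \<in> (\<lambda>x. \<beta> x \<one>) ` carrier Gam"
      using b(5)[of "\<one>" y] by auto
  qed
  ultimately have "finite (carrier G)" by (rule finite_subset[rotated])
  then have "hol_cycle G \<sigma> a"
    using sig onto us(1) by unfold_locales (auto simp: a_def)
  then show thesis using that us(2) bc by blast
qed

text \<open>The k-th power of the cycle takes \<open>g l\<close> to \<open>g (k + l)\<close>: on
  indices modulo n the image consists of all translations and is therefore regular.\<close>

lemma cycle_embedding:
  fixes G (structure)
  assumes Gam: "cyclic_gen Gam c n" and \<sigma>: "\<sigma> \<in> auto G" and cyc: "hol_cycle G \<sigma> a"
    and n: "order G = n"
  obtains \<beta> where "\<beta> \<in> reg_embeddings Gam G" "\<And>x. x \<in> carrier G \<Longrightarrow> \<beta> c x = \<sigma> x \<otimes> a"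
proof -
  interpret C: cyclic_gen Gam c n by (rule Gam)
  interpret hol_cycle G \<sigma> a by (rule cyc)
  define T where "T = (\<lambda>k. \<lambda>z\<in>carrier G. (\<sigma> ^^ k) z \<otimes> g k)"
  have Tg: "T k (g l) = g (k + l)" for k l
    by (simp add: T_def g_add)
  have Teq: "T k = T l \<longleftrightarrow> [k = l] (mod n)" for k l
  proof
    assume "T k = T l"
    then have "T k (g 0) = T l (g 0)" by (rule arg_cong)
    then show "[k = l] (mod n)" unfolding Tg by (simp add: g_eq_iff n)
  next
    assume kl: "[k = l] (mod n)"
    show "T k = T l"
    proof (rule extensionalityI[of _ "carrier G"])
      fix x assume "x \<in> carrier G"
      then obtain j where j: "x = g j" by (rule g_obtain)
      show "T k x = T l x"
        unfolding j Tg using kl by (simp add: g_eq_iff n cong_add_rcancel_nat)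
    qed (simp_all add: T_def)
  qed
  define \<beta> where "\<beta> = (\<lambda>x\<in>carrier Gam. T (SOME k. x = c [^]\<^bsub>Gam\<^esub> k))"
  have b: "\<beta> (c [^]\<^bsub>Gam\<^esub> k) = T k" for k :: nat
  proof -
    have "c [^]\<^bsub>Gam\<^esub> k = c [^]\<^bsub>Gam\<^esub> (SOME l::nat. c [^]\<^bsub>Gam\<^esub> k = c [^]\<^bsub>Gam\<^esub> l)"
      by (rule someI[of _ k]) simp
    then have "T k = T (SOME l::nat. c [^]\<^bsub>Gam\<^esub> k = c [^]\<^bsub>Gam\<^esub> l)"
      unfolding Teq C.pow_cong_iff .
    then show ?thesis by (simp add: \<beta>_def)
  qed
  have TB: "T k \<in> Bij (carrier G)" for k
  proof -
    have "inj_on (T k) (carrier G)"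
    proof (rule inj_onI)
      fix x y assume xy: "x \<in> carrier G" "y \<in> carrier G" "T k x = T k y"
      obtain i j where "x = g i" "y = g j" using xy g_obtain by metis
      then show "x = y" using xy(3) by (simp add: Tg g_eq_iff cong_add_lcancel_nat)
    qed
    moreover have "T k ` carrier G \<subseteq> carrier G" by (auto simp: T_def)
    ultimately have "bij_betw (T k) (carrier G) (carrier G)"
      using fin by (simp add: bij_betw_def endo_inj_surj)
    then show ?thesis by (simp add: Bij_def T_def)
  qed
  have comp: "compose (carrier G) (T k) (T l) = T (k + l)" for k l
  proof (rule extensionalityI[of _ "carrier G"])
    fix x assume x: "x \<in> carrier G"
    then obtain j where j: "x = g j" by (rule g_obtain)
    show "compose (carrier G) (T k) (T l) x = T (k + l) x"
      using x by (simp add: compose_def j Tg add.assoc)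
  qed (simp_all add: T_def compose_def)
  have "\<beta> \<in> hom Gam (BijGroup (carrier G))"
  proof (rule homI)
    fix x y assume xy: "x \<in> carrier Gam" "y \<in> carrier Gam"
    obtain j k :: nat where jk: "x = c [^]\<^bsub>Gam\<^esub> j" "y = c [^]\<^bsub>Gam\<^esub> k"
      using xy C.elem_cases by metis
    show "\<beta> x \<in> carrier (BijGroup (carrier G))"
      by (simp add: jk b BijGroup_carrier TB)
    show "\<beta> (x \<otimes>\<^bsub>Gam\<^esub> y) = \<beta> x \<otimes>\<^bsub>BijGroup (carrier G)\<^esub> \<beta> y"
      by (simp add: jk b C.nat_pow_mult BijGroup_mult TB comp)
  qed
  moreover have "\<beta> \<in> extensional (carrier Gam)" by (simp add: \<beta>_def)
  moreover have THol: "T k \<in> Hol G" for k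
  proof -
    define s where "s = restrict (\<sigma> ^^ k) (carrier G)"
    have "s \<in> auto G"
    proof -
      have "inj_on (\<sigma> ^^ k) (carrier G)" by (auto simp: inj_on_def iter_inj)
      moreover have "(\<sigma> ^^ k) ` carrier G \<subseteq> carrier G" by auto
      ultimately have "bij_betw (\<sigma> ^^ k) (carrier G) (carrier G)"
        using fin by (simp add: bij_betw_def endo_inj_surj)
      then show ?thesis
        unfolding s_def by (intro restrict_iso_auto is_group) (auto simp: iso_def hom_def)
    qed
    moreover have "T k = compose (carrier G) (rho G (inv g k)) s"
      by (auto simp: T_def compose_def rho_def s_def restrict_def fun_eq_iff)
    moreover have "inv g k \<in> carrier G" by simp
    ultimately show ?thesis unfolding Hol_def mem_Collect_eq by (intro exI conjI)
  qed
  have "\<beta> ` carrier Gam \<subseteq> Hol G"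
  proof clarify
    fix x assume "x \<in> carrier Gam"
    then obtain k :: nat where "x = c [^]\<^bsub>Gam\<^esub> k" by (rule C.elem_cases)
    then show "\<beta> x \<in> Hol G" by (simp add: b THol)
  qed
  moreover have "inj_on \<beta> (carrier Gam)"
  proof (rule inj_onI)
    fix x y assume xy: "x \<in> carrier Gam" "y \<in> carrier Gam" "\<beta> x = \<beta> y"
    obtain j k :: nat where jk: "x = c [^]\<^bsub>Gam\<^esub> j" "y = c [^]\<^bsub>Gam\<^esub> k"
      using xy C.elem_cases by metis
    then show "x = y" using xy(3) by (simp add: b Teq C.pow_cong_iff)
  qed
  moreover have "\<exists>!h. h \<in> \<beta> ` carrier Gam \<and> h x = y" if xy: "x \<in> carrier G" "y \<in> carrier G" for x y
  proof -
    obtain j l where jl: "x = g j" "y = g l" using xy g_obtain by metis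
    have img: "h \<in> \<beta> ` carrier Gam \<longleftrightarrow> (\<exists>k. h = T k)" for h
    proof
      assume "h \<in> \<beta> ` carrier Gam"
      then obtain x where x: "x \<in> carrier Gam" "h = \<beta> x" by blast
      obtain k :: nat where "x = c [^]\<^bsub>Gam\<^esub> k" using x(1) by (rule C.elem_cases)
      then show "\<exists>k. h = T k" using x(2) b by blast
    next
      assume "\<exists>k. h = T k"
      then obtain k :: nat where "h = \<beta> (c [^]\<^bsub>Gam\<^esub> k)" using b by metis
      then show "h \<in> \<beta> ` carrier Gam" by simp
    qed
    show ?thesis
    \<comment> \<open>The translation by l - j, with j (n - 1) in place of -j.\<close>
    proof (rule ex1I[of _ "T (l + j * (n - 1))"])
      have "l + j * (n - 1) + j = l + n * j" using C.N_pos by (cases n) auto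
      then have "[l + j * (n - 1) + j = l] (mod n)" unfolding cong_def by (metis mod_mult_self2)
      then show "T (l + j * (n - 1)) \<in> \<beta> ` carrier Gam \<and> T (l + j * (n - 1)) x = y"
        unfolding img jl Tg by (auto simp: g_eq_iff n)
      fix h assume h: "h \<in> \<beta> ` carrier Gam \<and> h x = y"
      then obtain k where k: "h = T k" using img by blast
      then have "[k + j = l] (mod n)" using h by (simp add: jl Tg g_eq_iff n)
      then have "[k + j = l + j * (n - 1) + j] (mod n)"
        using \<open>[l + j * (n - 1) + j = l] (mod n)\<close> cong_sym cong_trans by blast
      then show "h = T (l + j * (n - 1))" by (simp only: k Teq cong_add_rcancel_nat)
    qed
  qed
  ultimately have "\<beta> \<in> reg_embeddings Gam G" by (simp add: reg_embeddings_def)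
  moreover have "\<beta> c x = \<sigma> x \<otimes> a" if "x \<in> carrier G" for x
    using b[of 1] that by (simp add: T_def)
  ultimately show thesis using that by blast
qed

text \<open>Conjugation by \<alpha> is a homomorphism, so the condition can be tested on the
  generator c, where it becomes an intertwining relation.\<close>

lemma aut_conj_iff:
  assumes Gam: "cyclic_gen Gam c n" and \<beta>: "\<beta> \<in> reg_embeddings Gam G" "\<beta>' \<in> reg_embeddings Gam G"
  shows "(\<beta>, \<beta>') \<in> aut_conj Gam G \<longleftrightarrow>
    (\<exists>\<alpha>\<in>auto G. \<forall>x\<in>carrier G. \<alpha> (\<beta> c x) = \<beta>' c (\<alpha> x))"
proof -
  interpret C: cyclic_gen Gam c n by (rule Gam)
  let ?B = "BijGroup (carrier G)"
  interpret B: group ?B by (rule group_BijGroup)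
  interpret b: group_hom Gam ?B \<beta>
    using reg_embeddingsD(1)[OF \<beta>(1)] C.is_group B.is_group by (simp add: group_hom_def group_hom_axioms_def)
  interpret b': group_hom Gam ?B \<beta>'
    using reg_embeddingsD(1)[OF \<beta>(2)] C.is_group B.is_group by (simp add: group_hom_def group_hom_axioms_def)
  have key: "\<beta>' c = \<alpha> \<otimes>\<^bsub>?B\<^esub> \<beta> c \<otimes>\<^bsub>?B\<^esub> inv\<^bsub>?B\<^esub> \<alpha> \<longleftrightarrow> (\<forall>x\<in>carrier G. \<alpha> (\<beta> c x) = \<beta>' c (\<alpha> x))"
    if \<alpha>: "\<alpha> \<in> auto G" for \<alpha>
  proof -
    have aB: "\<alpha> \<in> carrier ?B" using autoD(2)[OF \<alpha>] by (simp add: BijGroup_carrier)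
    have bB: "\<beta> c \<in> carrier ?B" "\<beta>' c \<in> carrier ?B" by simp_all
    have "\<beta>' c = \<alpha> \<otimes>\<^bsub>?B\<^esub> \<beta> c \<otimes>\<^bsub>?B\<^esub> inv\<^bsub>?B\<^esub> \<alpha> \<longleftrightarrow> \<beta>' c \<otimes>\<^bsub>?B\<^esub> \<alpha> = \<alpha> \<otimes>\<^bsub>?B\<^esub> \<beta> c"
      using aB bB by (metis B.inv_solve_right B.m_closed)
    also have "\<dots> \<longleftrightarrow> compose (carrier G) (\<beta>' c) \<alpha> = compose (carrier G) \<alpha> (\<beta> c)"
      using aB bB by (simp add: BijGroup_mult BijGroup_carrier)
    also have "\<dots> \<longleftrightarrow> (\<forall>x\<in>carrier G. \<alpha> (\<beta> c x) = \<beta>' c (\<alpha> x))"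
      by (auto simp: compose_def fun_eq_iff restrict_def)
    finally show ?thesis .
  qed
  have pow: "\<beta>' x = \<alpha> \<otimes>\<^bsub>?B\<^esub> \<beta> x \<otimes>\<^bsub>?B\<^esub> inv\<^bsub>?B\<^esub> \<alpha>"
    if \<alpha>: "\<alpha> \<in> auto G" and eq: "\<beta>' c = \<alpha> \<otimes>\<^bsub>?B\<^esub> \<beta> c \<otimes>\<^bsub>?B\<^esub> inv\<^bsub>?B\<^esub> \<alpha>" and x: "x \<in> carrier Gam" for \<alpha> x
  proof -
    have aB: "\<alpha> \<in> carrier ?B" using autoD(2)[OF \<alpha>] by (simp add: BijGroup_carrier)
    obtain k :: nat where k: "x = c [^]\<^bsub>Gam\<^esub> k" using x by (rule C.elem_cases)
    have "(\<alpha> \<otimes>\<^bsub>?B\<^esub> \<beta> c \<otimes>\<^bsub>?B\<^esub> inv\<^bsub>?B\<^esub> \<alpha>) [^]\<^bsub>?B\<^esub> k = \<alpha> \<otimes>\<^bsub>?B\<^esub> \<beta> c [^]\<^bsub>?B\<^esub> k \<otimes>\<^bsub>?B\<^esub> inv\<^bsub>?B\<^esub> \<alpha>"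
      using B.conj_pow[of "\<beta> c" "inv\<^bsub>?B\<^esub> \<alpha>" k] aB by simp
    then show ?thesis by (simp add: k b.hom_nat_pow b'.hom_nat_pow eq)
  qed
  show ?thesis
  proof
    assume "(\<beta>, \<beta>') \<in> aut_conj Gam G"
    then obtain \<alpha> where "\<alpha> \<in> auto G" "\<beta>' c = \<alpha> \<otimes>\<^bsub>?B\<^esub> \<beta> c \<otimes>\<^bsub>?B\<^esub> inv\<^bsub>?B\<^esub> \<alpha>"
      by (auto simp: aut_conj_def)
    then show "\<exists>\<alpha>\<in>auto G. \<forall>x\<in>carrier G. \<alpha> (\<beta> c x) = \<beta>' c (\<alpha> x)"
      using key by blast
  next
    assume "\<exists>\<alpha>\<in>auto G. \<forall>x\<in>carrier G. \<alpha> (\<beta> c x) = \<beta>' c (\<alpha> x)"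
    then obtain \<alpha> where \<alpha>: "\<alpha> \<in> auto G" "\<beta>' c = \<alpha> \<otimes>\<^bsub>?B\<^esub> \<beta> c \<otimes>\<^bsub>?B\<^esub> inv\<^bsub>?B\<^esub> \<alpha>"
      using key by blast
    then show "(\<beta>, \<beta>') \<in> aut_conj Gam G"
      using pow[OF \<alpha>] \<beta> unfolding aut_conj_def by blast
  qed
qed

section \<open>Counting conjugacy classes by a complete invariant\<close>

lemma card_quotient_eq_card_image:
  assumes "\<And>x y. (x, y) \<in> E \<longleftrightarrow> x \<in> A \<and> y \<in> A \<and> f x = f y"
  shows "card (A // E) = card (f ` A)"
proof -
  have cls: "E `` {x} = {y \<in> A. f y = f x}" if "x \<in> A" for x
    using assms that by auto
  define F where "F = (\<lambda>i. {y \<in> A. f y = i})"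
  have "A // E = F ` f ` A"
    using cls by (auto simp: quotient_def F_def)
  moreover have "inj_on F (f ` A)"
  proof (rule inj_onI)
    fix i j assume "i \<in> f ` A" "j \<in> f ` A" "F i = F j"
    then obtain x where "x \<in> A" "f x = i" "x \<in> F j" by (auto simp: F_def)
    then show "i = j" by (simp add: F_def)
  qed
  ultimately show ?thesis by (simp add: card_image)
qed

text \<open>The reduction behind every count below: embeddings correspond to cycles, conjugate
  embeddings to cycles related by an automorphism of G, and \<open>idx\<close> is a complete
  invariant of that relation with range I.\<close>

lemma e_HG_eq_card:
  fixes G (structure)
  assumes Gam: "cyclic_gen Gam c n" and G: "group G" and n: "order G = n"
    and idx: "\<And>\<sigma> a. \<sigma> \<in> auto G \<Longrightarrow> hol_cycle G \<sigma> a \<Longrightarrow> idx \<sigma> a \<in> I"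
    and surj: "\<And>i. i \<in> I \<Longrightarrow> \<exists>\<sigma> a. \<sigma> \<in> auto G \<and> hol_cycle G \<sigma> a \<and> idx \<sigma> a = i"
    and inj: "\<And>\<sigma> a \<sigma>' a'. \<sigma> \<in> auto G \<Longrightarrow> hol_cycle G \<sigma> a \<Longrightarrow> \<sigma>' \<in> auto G \<Longrightarrow> hol_cycle G \<sigma>' a' \<Longrightarrow>
      idx \<sigma> a = idx \<sigma>' a' \<longleftrightarrow>
      (\<exists>\<alpha>\<in>auto G. \<alpha> a = a' \<and> (\<forall>x\<in>carrier G. \<alpha> (\<sigma> x) = \<sigma>' (\<alpha> x)))"
  shows "e_HG Gam G = card I"
proof -
  interpret group G by (rule G)
  \<comment> \<open>The pair is recovered from \<beta>: a is the image of 1 under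
    \<open>\<beta> c\<close>, and \<sigma> is \<open>\<beta> c\<close> followed by right
    multiplication with the inverse of a.\<close>
  define f where "f = (\<lambda>\<beta>. idx (\<lambda>x\<in>carrier G. \<beta> c x \<otimes> inv (\<beta> c \<one>)) (\<beta> c \<one>))"
  have f: "f \<beta> = idx \<sigma> a"
    if s: "\<sigma> \<in> auto G" "hol_cycle G \<sigma> a" "\<And>x. x \<in> carrier G \<Longrightarrow> \<beta> c x = \<sigma> x \<otimes> a" for \<beta> \<sigma> a
  proof -
    interpret hol_cycle G \<sigma> a by (rule s(2))
    have "\<beta> c \<one> = a" using s(3)[of "\<one>"] by simp
    moreover have "(\<lambda>x\<in>carrier G. \<beta> c x \<otimes> inv a) = \<sigma>"
    proof (rule extensionalityI[of _ "carrier G"])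
      fix x assume "x \<in> carrier G"
      then show "(\<lambda>x\<in>carrier G. \<beta> c x \<otimes> inv a) x = \<sigma> x"
        using s(3) by (simp add: m_assoc)
    qed (use autoD(4)[OF s(1)] in auto)
    ultimately show ?thesis by (simp add: f_def)
  qed
  have "(\<beta>, \<beta>') \<in> aut_conj Gam G \<longleftrightarrow>
      \<beta> \<in> reg_embeddings Gam G \<and> \<beta>' \<in> reg_embeddings Gam G \<and> f \<beta> = f \<beta>'" for \<beta> \<beta>'
  proof (cases "\<beta> \<in> reg_embeddings Gam G \<and> \<beta>' \<in> reg_embeddings Gam G")
    case False
    then show ?thesis by (auto simp: aut_conj_def)
  next
    case True
    obtain \<sigma> a where s: "\<sigma> \<in> auto G" "hol_cycle G \<sigma> a"
      "\<And>x. x \<in> carrier G \<Longrightarrow> \<beta> c x = \<sigma> x \<otimes> a"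
      using embedding_cycle[OF Gam G] True by blast
    obtain \<sigma>' a' where s': "\<sigma>' \<in> auto G" "hol_cycle G \<sigma>' a'"
      "\<And>x. x \<in> carrier G \<Longrightarrow> \<beta>' c x = \<sigma>' x \<otimes> a'"
      using embedding_cycle[OF Gam G] True by blast
    interpret S: hol_cycle G \<sigma> a by (rule s(2))
    interpret S': hol_cycle G \<sigma>' a' by (rule s'(2))
    have "(\<beta>, \<beta>') \<in> aut_conj Gam G \<longleftrightarrow> (\<exists>\<alpha>\<in>auto G. \<forall>x\<in>carrier G. \<alpha> (\<beta> c x) = \<beta>' c (\<alpha> x))"
      using aut_conj_iff[OF Gam] True by blast
    also have "\<dots> \<longleftrightarrow> (\<exists>\<alpha>\<in>auto G. \<alpha> a = a' \<and> (\<forall>x\<in>carrier G. \<alpha> (\<sigma> x) = \<sigma>' (\<alpha> x)))"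
    proof (rule bex_cong[OF refl])
      fix \<alpha> assume "\<alpha> \<in> auto G"
      then interpret \<alpha>: group_hom G G \<alpha>
        using autoD(1) is_group by (simp add: group_hom_def group_hom_axioms_def)
      have "(\<forall>x\<in>carrier G. \<alpha> (\<beta> c x) = \<beta>' c (\<alpha> x)) \<longleftrightarrow>
          (\<forall>x\<in>carrier G. \<alpha> (\<sigma> x) \<otimes> \<alpha> a = \<sigma>' (\<alpha> x) \<otimes> a')"
        using s(3) s'(3) by simp
      also have "\<dots> \<longleftrightarrow> \<alpha> a = a' \<and> (\<forall>x\<in>carrier G. \<alpha> (\<sigma> x) = \<sigma>' (\<alpha> x))"
      proof
        assume h: "\<forall>x\<in>carrier G. \<alpha> (\<sigma> x) \<otimes> \<alpha> a = \<sigma>' (\<alpha> x) \<otimes> a'"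
        then have a': "\<alpha> a = a'" using bspec[OF h, of "\<one>"] by simp
        then show "\<alpha> a = a' \<and> (\<forall>x\<in>carrier G. \<alpha> (\<sigma> x) = \<sigma>' (\<alpha> x))"
          using h by (simp add: r_cancel)
      qed auto
      finally show "(\<forall>x\<in>carrier G. \<alpha> (\<beta> c x) = \<beta>' c (\<alpha> x)) \<longleftrightarrow>
        \<alpha> a = a' \<and> (\<forall>x\<in>carrier G. \<alpha> (\<sigma> x) = \<sigma>' (\<alpha> x))" .
    qed
    also have "\<dots> \<longleftrightarrow> f \<beta> = f \<beta>'"
      using inj[OF s(1,2) s'(1,2)] f[of \<sigma> a \<beta>, OF s] f[of \<sigma>' a' \<beta>', OF s'] by simp
    finally show ?thesis using True by blast
  qed
  then have "e_HG Gam G = card (f ` reg_embeddings Gam G)"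
    unfolding e_HG_def by (rule card_quotient_eq_card_image)
  also have "f ` reg_embeddings Gam G = I"
  proof
    show "f ` reg_embeddings Gam G \<subseteq> I"
    proof clarify
      fix \<beta> assume "\<beta> \<in> reg_embeddings Gam G"
      then obtain \<sigma> a where s: "\<sigma> \<in> auto G" "hol_cycle G \<sigma> a"
        "\<And>x. x \<in> carrier G \<Longrightarrow> \<beta> c x = \<sigma> x \<otimes> a"
        using embedding_cycle[OF Gam G] by blast
      show "f \<beta> \<in> I" using f[of \<sigma> a \<beta>, OF s] idx[OF s(1,2)] by simp
    qed
    show "I \<subseteq> f ` reg_embeddings Gam G"
    proof
      fix i assume "i \<in> I"
      then obtain \<sigma> a where s: "\<sigma> \<in> auto G" "hol_cycle G \<sigma> a" "idx \<sigma> a = i"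
        using surj by blast
      obtain \<beta> where b: "\<beta> \<in> reg_embeddings Gam G" "\<And>x. x \<in> carrier G \<Longrightarrow> \<beta> c x = \<sigma> x \<otimes> a"
        using cycle_embedding[OF Gam s(1,2) n] by blast
      then have "f \<beta> = i" using f[of \<sigma> a \<beta>, OF s(1,2)] s(3) by simp
      then show "i \<in> f ` reg_embeddings Gam G" using b(1) by blast
    qed
  qed
  finally show ?thesis .
qed

section \<open>Counting cycles\<close>

lemma lcg_unit_coprime: "lcg_unit n u \<Longrightarrow> coprime u n"
  by (rule coprime_of_cong_one) (auto simp: lcg_unit_def)

lemma geom_onto':
  assumes "lcg_unit n u" "n > 0"
  shows "\<exists>k. [geom u k = c] (mod n)"
proof (cases "n = 1")
  case False
  have "coprime u n" using assms(1) by (rule lcg_unit_coprime)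
  moreover from this have "u > 0" using False assms(2) by (cases u) auto
  ultimately show ?thesis using geom_onto assms by blast
qed (simp add: cong_def)

lemma (in cyclic_gen) cyclic_gen_pow:
  assumes "coprime i N"
  shows "cyclic_gen G (w [^] i) N"
proof -
  obtain j where j: "[i * j = 1] (mod N)"
    using cong_solve_coprime_nat[OF assms] by auto
  have "w [^] k = (w [^] i) [^] (j * k)" for k :: nat
  proof -
    have "[i * (j * k) = k] (mod N)"
      using cong_scalar_right[OF j, of k] by (simp add: mult.assoc)
    then show ?thesis by (simp add: nat_pow_pow pow_cong_iff cong_sym)
  qed
  then have "range (\<lambda>k::nat. w [^] k) \<subseteq> range (\<lambda>k::nat. (w [^] i) [^] k)" by blast
  then have "carrier G \<subseteq> range (\<lambda>k::nat. (w [^] i) [^] k)" using carrier_subset by blast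
  moreover have "(w [^] i) [^] q = \<one> \<longleftrightarrow> N dvd q" for q :: nat
    using assms by (simp add: nat_pow_pow pow_one_iff coprime_dvd_mult_right_iff coprime_commute)
  ultimately show ?thesis using N_pos by unfold_locales auto
qed

text \<open>With a = w^b and \<sigma>(w) = w^u every term of the orbit is a power of w^b; since w
  itself occurs, b is a unit modulo n.\<close>

lemma (in hol_cycle) cyclic_gen_orbit:
  assumes "cyclic_gen G w n"
  shows "cyclic_gen G a n"
proof -
  interpret C: cyclic_gen G w n by (rule assms)
  obtain b :: nat where b: "a = w [^] b" using C.elem_cases[of a] by auto
  obtain u :: nat where u: "\<sigma> w = w [^] u" using C.elem_cases[of "\<sigma> w"] by auto
  have gk: "g k = w [^] (b * geom u k)" for k
  proof (induction k)
    case (Suc k)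
    have "\<sigma> (w [^] (b * geom u k)) = w [^] (u * (b * geom u k))"
      using iter_pow[of w 1 "b * geom u k"] u by (simp add: nat_pow_pow)
    then show ?case
      by (simp only: orb.simps Suc) (simp add: b nat_pow_mult geom_Suc_shift algebra_simps)
  qed simp
  obtain k where "w = g k" using g_obtain[of w] by auto
  then have "w [^] (1::nat) = w [^] (b * geom u k)" using gk by simp
  then have "[b * geom u k = 1] (mod n)" unfolding C.pow_cong_iff by (rule cong_sym)
  then have "coprime b n"
    using coprime_iff_invertible_nat[of b n] unfolding One_nat_def by blast
  then show ?thesis unfolding b by (rule C.cyclic_gen_pow)
qed

lemma Least_pow_exponent:
  fixes G (structure)
  assumes "group G" "x \<in> carrier G" "\<And>q::nat. x [^] q = \<one> \<longleftrightarrow> N dvd q" "N > 0"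
    and z: "z = x [^] (k::nat)"
  shows "z = x [^] (LEAST i::nat. z = x [^] i)" "(LEAST i::nat. z = x [^] i) < N"
    and "[(LEAST i::nat. z = x [^] i) = k] (mod N)"
    and "k < N \<Longrightarrow> (LEAST i::nat. z = x [^] i) = k"
proof -
  interpret group G by (rule assms)
  note iff = pow_eq_pow_iff[OF assms(2,3)]
  show *: "z = x [^] (LEAST i::nat. z = x [^] i)" using z by (rule LeastI)
  have "z = x [^] (k mod N)" by (simp add: z iff)
  then have "(LEAST i::nat. z = x [^] i) \<le> k mod N" by (rule Least_le)
  then show lt: "(LEAST i::nat. z = x [^] i) < N" using assms(4) by (meson le_less_trans mod_less_divisor)
  have "x [^] (LEAST i::nat. z = x [^] i) = x [^] k" using * z by simp
  then show c: "[(LEAST i::nat. z = x [^] i) = k] (mod N)" unfolding iff .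
  show "(LEAST i::nat. z = x [^] i) = k" if "k < N"
    using c lt that by (simp add: cong_def)
qed

text \<open>a is a generator, and automorphisms act simply transitively on generators. So the pair
  is determined up to automorphism by the exponent i with \<sigma>(a) = a^i, and Hull--Dobell
  decides which i occur.\<close>

lemma e_HG_cyclic:
  fixes G (structure)
  assumes Gam: "cyclic_gen Gam c n" and G: "cyclic_gen G w n"
  shows "e_HG Gam G = card {i. i < n \<and> lcg_unit n i}"
proof -
  interpret C: cyclic_gen G w n by (rule G)
  \<comment> \<open>\<open>LEAST\<close> selects the representative of the exponent below n.\<close>
  define idx where "idx = (\<lambda>\<sigma> a. LEAST i::nat. \<sigma> a = a [^] i)"
  have gen: "cyclic_gen G a n" if "hol_cycle G \<sigma> a" for \<sigma> a
    using hol_cycle.cyclic_gen_orbit[OF that] G C.order_eq by simp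
  have key: "\<sigma> a = a [^] idx \<sigma> a \<and> idx \<sigma> a < n" if h: "hol_cycle G \<sigma> a" for \<sigma> a
  proof -
    interpret hol_cycle G \<sigma> a by (rule h)
    interpret A: cyclic_gen G a n by (rule gen[OF h])
    obtain k :: nat where k: "\<sigma> a = a [^] k" using A.elem_cases[of "\<sigma> a"] by auto
    show ?thesis
      unfolding idx_def using Least_pow_exponent(1,2)[OF C.is_group a_closed A.pow_one_iff A.N_pos k] by blast
  qed
  have gpow: "orb G \<sigma> a k = a [^] geom i k"
    if "\<sigma> \<in> hom G G" "a \<in> carrier G" "\<sigma> a = a [^] i" for \<sigma> a i k
  proof -
    interpret s: group_hom G G \<sigma>
      using that(1) C.is_group by (simp add: group_hom_def group_hom_axioms_def)
    show ?thesis
    proof (induction k)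
      case (Suc k)
      show ?case using that(2,3) by (simp add: Suc s.hom_nat_pow C.nat_pow_pow geom_Suc_shift)
    qed simp
  qed
  show ?thesis
  proof (rule e_HG_eq_card[OF Gam C.is_group C.order_eq, of idx])
    fix \<sigma> a assume s: "\<sigma> \<in> auto G" "hol_cycle G \<sigma> a"
    interpret hol_cycle G \<sigma> a by (rule s(2))
    interpret A: cyclic_gen G a n by (rule gen[OF s(2)])
    note p = key[OF s(2)]
    have "lcg_unit n (idx \<sigma> a)"
    proof (rule lcg_unit_if_geom_onto)
      show "coprime (idx \<sigma> a) n"
        using coprime_sigma_exponent[OF a_closed A.pow_one_iff A.N_pos] p by blast
      fix b :: nat
      have "a [^] b \<in> carrier G" by simp
      then obtain k where "a [^] b = g k" by (rule g_obtain)
      then have "a [^] b = a [^] geom (idx \<sigma> a) k"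
        using gpow[OF hom a_closed] p by simp
      then show "\<exists>k. [geom (idx \<sigma> a) k = b] (mod n)"
        using A.pow_cong_iff cong_sym by blast
    qed
    then show "idx \<sigma> a \<in> {i. i < n \<and> lcg_unit n i}" using p by simp
  next
    fix i assume i: "i \<in> {i. i < n \<and> lcg_unit n i}"
    then have "coprime i n" using lcg_unit_coprime by blast
    then obtain f where f: "f \<in> iso G G" "f w = w [^] i"
      using cyclic_gen_iso[OF G C.cyclic_gen_pow] by blast
    define \<sigma> where "\<sigma> = restrict f (carrier G)"
    have s: "\<sigma> \<in> auto G" unfolding \<sigma>_def using C.is_group f(1) by (rule restrict_iso_auto)
    have sw: "\<sigma> w = w [^] i" by (simp add: \<sigma>_def f(2))
    have "hol_cycle G \<sigma> w"
    proof unfold_locales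
      show "carrier G \<subseteq> range (orb G \<sigma> w)"
      proof
        fix x assume "x \<in> carrier G"
        then obtain b :: nat where b: "x = w [^] b" by (rule C.elem_cases)
        obtain k where "[geom i k = b] (mod n)"
          using geom_onto'[of n i b] i C.N_pos by blast
        then have "x = orb G \<sigma> w k"
          using gpow[OF autoD(1)[OF s] C.w_closed sw] by (simp add: b C.pow_cong_iff cong_sym)
        then show "x \<in> range (orb G \<sigma> w)" by blast
      qed
      show "finite (carrier G)" unfolding C.carrier_eq by simp
    qed (use autoD[OF s] in auto)
    moreover have "idx \<sigma> w = i"
      unfolding idx_def using Least_pow_exponent(4)[OF C.is_group C.w_closed C.pow_one_iff C.N_pos sw] i by simp
    ultimately show "\<exists>\<sigma> a. \<sigma> \<in> auto G \<and> hol_cycle G \<sigma> a \<and> idx \<sigma> a = i" using s by blast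
  next
    fix \<sigma> a \<sigma>' a'
    assume s: "\<sigma> \<in> auto G" "hol_cycle G \<sigma> a" and s': "\<sigma>' \<in> auto G" "hol_cycle G \<sigma>' a'"
    interpret S: hol_cycle G \<sigma> a by (rule s(2))
    interpret S': hol_cycle G \<sigma>' a' by (rule s'(2))
    interpret A: cyclic_gen G a n by (rule gen[OF s(2)])
    show "idx \<sigma> a = idx \<sigma>' a' \<longleftrightarrow>
      (\<exists>\<alpha>\<in>auto G. \<alpha> a = a' \<and> (\<forall>x\<in>carrier G. \<alpha> (\<sigma> x) = \<sigma>' (\<alpha> x)))"
    proof
      assume eq: "idx \<sigma> a = idx \<sigma>' a'"
      obtain f where f: "f \<in> iso G G" "f a = a'"
        using cyclic_gen_iso[OF gen[OF s(2)] gen[OF s'(2)]] by blast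
      define \<alpha> where "\<alpha> = restrict f (carrier G)"
      have \<alpha>: "\<alpha> \<in> auto G" unfolding \<alpha>_def using C.is_group f(1) by (rule restrict_iso_auto)
      interpret \<alpha>: group_hom G G \<alpha>
        using autoD(1)[OF \<alpha>] C.is_group by (simp add: group_hom_def group_hom_axioms_def)
      have \<alpha>a: "\<alpha> a = a'" by (simp add: \<alpha>_def f(2))
      have "\<alpha> (\<sigma> x) = \<sigma>' (\<alpha> x)" if "x \<in> carrier G" for x
      proof -
        have "(\<alpha> \<circ> \<sigma>) x = (\<sigma>' \<circ> \<alpha>) x"
        proof (rule A.hom_unique[of "\<alpha> \<circ> \<sigma>" G "\<sigma>' \<circ> \<alpha>"])
          show "\<alpha> \<circ> \<sigma> \<in> hom G G" using S.hom \<alpha>.homh by (rule Group.hom_compose)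
          show "\<sigma>' \<circ> \<alpha> \<in> hom G G" using \<alpha>.homh S'.hom by (rule Group.hom_compose)
          show "(\<alpha> \<circ> \<sigma>) a = (\<sigma>' \<circ> \<alpha>) a"
            using key[OF s(2)] key[OF s'(2)] eq \<alpha>.hom_nat_pow[of a "idx \<sigma> a"] \<alpha>a by simp
        qed (use that C.is_group in auto)
        then show ?thesis by simp
      qed
      then show "\<exists>\<alpha>\<in>auto G. \<alpha> a = a' \<and> (\<forall>x\<in>carrier G. \<alpha> (\<sigma> x) = \<sigma>' (\<alpha> x))"
        using \<alpha> \<alpha>a by blast
    next
      assume "\<exists>\<alpha>\<in>auto G. \<alpha> a = a' \<and> (\<forall>x\<in>carrier G. \<alpha> (\<sigma> x) = \<sigma>' (\<alpha> x))"
      then obtain \<alpha> where \<alpha>: "\<alpha> \<in> auto G" "\<alpha> a = a'" "\<And>x. x \<in> carrier G \<Longrightarrow> \<alpha> (\<sigma> x) = \<sigma>' (\<alpha> x)"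
        by blast
      interpret \<alpha>: group_hom G G \<alpha>
        using autoD(1)[OF \<alpha>(1)] C.is_group by (simp add: group_hom_def group_hom_axioms_def)
      have "\<sigma>' a' = a' [^] i \<longleftrightarrow> \<sigma> a = a [^] i" for i :: nat
      proof -
        have "\<sigma>' a' = a' [^] i \<longleftrightarrow> \<alpha> (\<sigma> a) = \<alpha> (a [^] i)"
          using \<alpha> by (simp add: \<alpha>.hom_nat_pow)
        also have "\<dots> \<longleftrightarrow> \<sigma> a = a [^] i"
          using autoD(3)[OF \<alpha>(1)] inj_on_eq_iff[of \<alpha> "carrier G" "\<sigma> a" "a [^] i"]
          by (simp add: bij_betw_def)
        finally show ?thesis .
      qed
      then show "idx \<sigma> a = idx \<sigma>' a'" unfolding idx_def by simp
    qed
  qed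
qed

section \<open>Cycles on groups of dihedral and quaternion type\<close>

lemma has_type_order: "has_type G N t e \<Longrightarrow> order G = 2 * N"
  by (auto simp: has_type_def dest: metacyclic.order_eq)

lemma has_type_group: "has_type G N t e \<Longrightarrow> group G"
  by (auto simp: has_type_def dest: metacyclic.axioms(1))

lemma comm_group_if_cyclic_gen:
  assumes "cyclic_gen G w n"
  shows "comm_group G"
proof -
  interpret cyclic_gen G w n by (rule assms)
  show ?thesis using commute by unfold_locales auto
qed

text \<open>Commutativity means t0 = 1 modulo N, that is, -1 = 1 modulo 2^(v - 1).\<close>

lemma (in split_order) comm_group_type_iff:
  fixes G (structure)
  assumes "has_type G N t0 \<epsilon>"
  shows "comm_group G \<longleftrightarrow> v = 2"
proof -
  obtain w y where "metacyclic G w y N t0 \<epsilon>" using assms by (auto simp: has_type_def)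
  then interpret metacyclic G w y N t0 \<epsilon> .
  show ?thesis
  proof
    assume "comm_group G"
    then interpret C: comm_group G .
    have "w [^] t0 \<otimes> y = w [^] (1::nat) \<otimes> y"
      using conj C.m_comm[of y w] by simp
    then have "[t0 = 1] (mod N)" unfolding pow_y_cong_iff .
    then have "[t0 + 1 = 1 + 1] (mod 2 ^ (v - 1))"
      using cong_N_iff by (intro cong_add) auto
    then have "2 ^ (v - 1) dvd (2::nat) ^ 1"
      using t0(1) cong_dvd_iff[of "t0 + 1" 2 "2 ^ (v - 1)"] unfolding one_add_one power_one_right by blast
    then have "v - 1 \<le> 1" using power_dvd_imp_le[of 2 "v - 1" 1] by simp
    then show "v = 2" using v by simp
  next
    assume v2: "v = 2"
    have t1: "[t0 = 1] (mod N)"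
    proof -
      have "[1 = t0] (mod N)" unfolding t_cong_iff using v2 by simp
      then show ?thesis by (rule cong_sym)
    qed
    interpret M1: metacyclic G w y N 1 \<epsilon> using t1 by (rule change_params) simp
    have "x \<otimes> z = z \<otimes> x" if x: "x \<in> carrier G" and z: "z \<in> carrier G" for x z
      using x
    proof (cases rule: elem_cases)
      case x: (1 j)
      show ?thesis using z
        by (cases rule: elem_cases)
          (simp_all only: x M1.mult_pow_pow M1.mult_pow_y M1.mult_y_pow add.commute mult_1)
    next
      case x: (2 j)
      show ?thesis using z
        by (cases rule: elem_cases)
          (simp_all only: x M1.mult_y_y M1.mult_pow_y M1.mult_y_pow add.commute mult_1)
    qed
    then show "comm_group G" by unfold_locales auto
  qed
qed

context split_order
begin

text \<open>For v = 2 the value \<open>N div 2\<close> is left out: there y would have order 4 in an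
  abelian group of order 4 n' with n' odd, and the group would be cyclic.\<close>

definition good_eps :: "nat \<Rightarrow> bool" where
  "good_eps \<epsilon> \<longleftrightarrow> \<epsilon> = 0 \<or> 3 \<le> v \<and> \<epsilon> = N div 2"

text \<open>A cyclic group has at most one involution, and the quaternion type with v > 2 is not
  abelian.\<close>

lemma type_not_cyclic:
  fixes G (structure)
  assumes "has_type G N t0 \<epsilon>" "good_eps \<epsilon>"
  shows "\<not> cyclic_gen G x m"
proof
  assume "cyclic_gen G x m"
  then interpret C: cyclic_gen G x m .
  show False
  proof (cases "\<epsilon> = 0")
    case True
    then show False
      using dihedral_involutions[of G] assms(1) C.involution_unique by blast
  next
    case False
    then have "3 \<le> v" using assms(2) by (simp add: good_eps_def)
    moreover have "comm_group G" using C.cyclic_gen_axioms by (rule comm_group_if_cyclic_gen)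
    then have "v = 2" using comm_group_type_iff[OF assms(1)] by blast
    ultimately show False by simp
  qed
qed

lemma type_exclusive:
  assumes "has_type G N t0 0" "has_type G N t0 (N div 2)" "3 \<le> v"
  shows False
  using dihedral_involutions[OF assms(1)] quaternion_involution[OF assms(2,3)] by blast

text \<open>The exponent e of the pair (w, a) is pinned down: modulo 2^(v - 1) by the type, since
  the two types exclude each other, and modulo n' by e (i + 1) = 2 with i + 1 invertible. So i
  determines e modulo N.\<close>

lemma hol_cycle_type:
  fixes G (structure)
  assumes ty: "has_type G N t0 \<epsilon>" "good_eps \<epsilon>" and cyc: "hol_cycle G \<sigma> a"
  defines "w \<equiv> \<sigma> a \<otimes> a"
  defines "i \<equiv> LEAST i::nat. \<sigma> w = w [^] i"
  shows "\<exists>e. metacyclic G w a N t0 e \<and> [e = \<epsilon>] (mod 2 ^ (v - 1)) \<and> [e * (i + 1) = 2] (mod n')"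
    and "\<sigma> w = w [^] i" and "i < N"
    and "\<And>p. prime p \<Longrightarrow> p dvd N \<Longrightarrow> [i = 1] (mod p)"
proof -
  interpret hol_cycle G \<sigma> a by (rule cyc)
  have nN: "n = 2 * N"
    using ty(1) by (rule has_type_order)
  have four: "4 dvd n" using nN N_even by auto
  have nil: "nilpotent_group G" using ty(1) by (rule nilpotent_type)
  have wg: "w = g 2" by (simp add: w_def numeral_2_eq_2)
  have N2: "n div 2 = N" using nN by simp
  obtain t e j where S: "metacyclic G w a N t e" "\<sigma> w = w [^] j"
    "[e * (j + 1) = 1 + t] (mod N)"
    "\<forall>p. prime p \<longrightarrow> p dvd N \<longrightarrow> [t = 1] (mod p) \<and> [j = 1] (mod p)"
    using metacyclic_structure[OF nil four] unfolding N2 wg by blast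
  interpret M: metacyclic G w a N t e by (rule S(1))
  have S4: "\<And>p. prime p \<Longrightarrow> p dvd N \<Longrightarrow> [t = 1] (mod p) \<and> [j = 1] (mod p)"
    using S(4) by blast
  note ar = parameters_cong[OF M.t_sq M.t_e S(3) S4]
  have "even e"
  proof (rule ccontr)
    assume "odd e"
    then have "cyclic_gen G a (2 * N)"
      using ar(2) M.cyclic_if_coprime N_even by blast
    then show False using type_not_cyclic[OF ty] by blast
  qed
  then have t: "[t = t0] (mod N)"
    and e: "2 ^ (v - 1) dvd e \<or> 3 \<le> v \<and> [e = 2 ^ (v - 2)] (mod 2 ^ (v - 1))"
    using ar(3) by blast+
  have M0: "metacyclic G w a N t0 e" using t by (rule M.change_params) simp
  have eps: "[e = \<epsilon>] (mod 2 ^ (v - 1))"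
  proof (cases "\<epsilon> = 0")
    case True
    have "\<not> (3 \<le> v \<and> [e = 2 ^ (v - 2)] (mod 2 ^ (v - 1)))"
      using quaternion_type_if[OF M0] type_exclusive[of G] ty(1) True by blast
    then show ?thesis using e True by (simp only: cong_0_iff) blast
  next
    case False
    then have v3: "3 \<le> v" "\<epsilon> = N div 2" using ty(2) by (auto simp: good_eps_def)
    have "\<not> 2 ^ (v - 1) dvd e"
      using dihedral_type_if[OF M0] type_exclusive[of G] ty(1) v3 by blast
    then have "[e = 2 ^ (v - 2)] (mod 2 ^ (v - 1))" using e by blast
    then show ?thesis using half_N_cong v3(2) cong_sym cong_trans by blast
  qed
  note L = Least_pow_exponent[OF is_group M.w_closed M.pow_one_iff M.N_pos S(2)]
  show "\<sigma> w = w [^] i" "i < N" unfolding i_def by (fact L(1), fact L(2))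
  have ij: "[i = j] (mod N)" unfolding i_def by (rule L(3))
  have "[e * (i + 1) = e * (j + 1)] (mod n')"
    using ij cong_N_iff by (intro cong_mult cong_add cong_refl) auto
  then have "[e * (i + 1) = 2] (mod n')" using ar(1) cong_trans by blast
  then show "\<exists>e. metacyclic G w a N t0 e \<and> [e = \<epsilon>] (mod 2 ^ (v - 1)) \<and> [e * (i + 1) = 2] (mod n')"
    using M0 eps by blast
  show "[i = 1] (mod p)" if "prime p" "p dvd N" for p
  proof -
    have "[i = j] (mod p)" using ij that(2) by (rule cong_dvd_modulus_nat)
    then show ?thesis using S4[OF that] cong_trans by blast
  qed
qed

text \<open>\<sigma> is prescribed by w -> w^i and a -> w^f a. Because of e (i + 1) = 1 + t0 the new
  pair satisfies the relations of (w, a), and \<open>metacyclic_iso\<close> supplies the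
  automorphism. Its orbit fills <w> at even and <w> a at odd indices.\<close>

lemma type_realize:
  fixes G (structure)
  assumes ty: "has_type G N t0 \<epsilon>" "good_eps \<epsilon>"
    and i: "i < N" "\<And>p. prime p \<Longrightarrow> p dvd N \<Longrightarrow> [i = 1] (mod p)"
  shows "\<exists>\<sigma> a. \<sigma> \<in> auto G \<and> hol_cycle G \<sigma> a \<and>
    (LEAST i::nat. \<sigma> (\<sigma> a \<otimes> a) = (\<sigma> a \<otimes> a) [^] i) = i"
proof -
  obtain w y where M0: "metacyclic G w y N t0 \<epsilon>" using ty by (auto simp: has_type_def)
  interpret M0: metacyclic G w y N t0 \<epsilon> by (rule M0)
  have copi: "coprime i N" using i(2) by (rule coprime_of_cong_one)
  have pn': "[i = 1] (mod p)" if "prime p" "p dvd n'" for p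
    using i(2) that by (simp add: N_def)
  have "coprime (i + 1) n'"
    using coprime_Suc_of_cong_one[of n' i] pn' n'_odd by blast
  \<comment> \<open>Modulo n' the square of w^c y has exponent 2 c, so c = 1 / (i + 1) gives e (i +
    1) = 2 there.\<close>
  then obtain c where c: "[(i + 1) * c = 1] (mod n')"
    using cong_solve_coprime_nat[of "i + 1" n'] unfolding One_nat_def[symmetric] by blast
  define a where "a = w [^] c \<otimes> y"
  define e where "e = c + t0 * c + \<epsilon>"
  have M: "metacyclic G w a N t0 e" unfolding a_def e_def by (rule M0.change_y)
  interpret M: metacyclic G w a N t0 e by (rule M)
  have "[i = 1] (mod 2)" using i(2)[of 2] N_even by simp
  then have "2 dvd i + 1" by (simp add: cong_def) presburger
  have ei: "[e * (i + 1) = 1 + t0] (mod N)"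
  proof -
    have "2 ^ (v - 1) dvd e * (i + 1)"
    proof -
      have "2 ^ (v - 1) dvd \<epsilon> * (i + 1)"
      proof (cases "\<epsilon> = 0")
        case False
        then have "\<epsilon> = 2 ^ (v - 2) * n'" using ty(2) half_N by (simp add: good_eps_def)
        then have "2 ^ (v - 2) dvd \<epsilon>" by simp
        then have "2 ^ (v - 2) * 2 dvd \<epsilon> * (i + 1)" using \<open>2 dvd i + 1\<close> by (rule mult_dvd_mono)
        then show ?thesis unfolding two_power by (simp add: mult.commute)
      qed simp
      moreover have "2 ^ (v - 1) dvd (t0 + 1) * (c * (i + 1))" using t0(1) by (rule dvd_mult2)
      moreover have "e * (i + 1) = (t0 + 1) * (c * (i + 1)) + \<epsilon> * (i + 1)"
        by (simp add: e_def algebra_simps)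
      ultimately show ?thesis by (simp only: dvd_add)
    qed
    moreover have "2 ^ (v - 1) dvd 1 + t0" using t0(1) by (simp add: add.commute)
    ultimately have "[e * (i + 1) = 1 + t0] (mod 2 ^ (v - 1))"
      by (meson cong_0_iff cong_sym cong_trans)
    moreover have "[e * (i + 1) = 1 + t0] (mod n')"
    proof -
      have "n' dvd \<epsilon>" using ty(2) half_N by (auto simp: good_eps_def)
      then have "[\<epsilon> * (i + 1) = 0] (mod n')" by (simp add: cong_0_iff)
      then have "[(t0 + 1) * ((i + 1) * c) + \<epsilon> * (i + 1) = (t0 + 1) * 1 + 0] (mod n')"
        using c by (intro cong_add cong_mult cong_refl)
      moreover have "e * (i + 1) = (t0 + 1) * ((i + 1) * c) + \<epsilon> * (i + 1)"
        by (simp add: e_def algebra_simps)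
      ultimately show ?thesis by (simp add: add.commute)
    qed
    ultimately show ?thesis using cong_N_iff by blast
  qed
  \<comment> \<open>f stands for 1 - e, which makes \<sigma>(a) a = w^(f + e) equal to w.\<close>
  define f where "f = 1 + e * (N - 1)"
  have fe: "[f + e = 1] (mod N)"
  proof -
    have "f + e = 1 + N * e" using N_pos by (cases N) (auto simp: f_def)
    then show ?thesis unfolding cong_def by (metis mod_mult_self2)
  qed
  \<comment> \<open>The square of w^f a has to be (w^i)^e. After adding e to both sides, t0 e = e
    reduces this to (1 + t0) (f + e) = e (i + 1).\<close>
  have "[f + t0 * f + e = i * e] (mod N)"
  proof -
    have "[(f + t0 * f + e) + e = (f + e) + t0 * f + t0 * e] (mod N)"
      using cong_sym[OF M.t_e] by (intro cong_add[of "f + t0 * f + e" "f + e + t0 * f", OF _ ]) (auto simp: add_ac)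
    also have "(f + e) + t0 * f + t0 * e = (f + e) + t0 * (f + e)"
      by (simp add: algebra_simps)
    also have "[\<dots> = 1 + t0 * 1] (mod N)"
      using fe by (intro cong_add cong_mult cong_refl)
    also have "[1 + t0 * 1 = e * (i + 1)] (mod N)" using cong_sym[OF ei] by simp
    also have "e * (i + 1) = i * e + e" by (simp add: algebra_simps)
    finally show ?thesis by (simp only: cong_add_rcancel_nat)
  qed
  then have M': "metacyclic G (w [^] i) (w [^] f \<otimes> a) N t0 e"
    using metacyclic.change_w[OF M.change_y copi] by blast
  obtain s where s: "s \<in> iso G G" "s w = w [^] i" "s a = w [^] f \<otimes> a"
    using M M' by (rule metacyclic_iso)
  define \<sigma> where "\<sigma> = restrict s (carrier G)"
  have sa: "\<sigma> \<in> auto G" unfolding \<sigma>_def using M0.is_group s(1) by (rule restrict_iso_auto)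
  interpret sg: group_hom G G \<sigma>
    using autoD(1)[OF sa] M0.is_group by (simp add: group_hom_def group_hom_axioms_def)
  have sw: "\<sigma> w = w [^] i" by (simp add: \<sigma>_def s(2))
  have saa: "\<sigma> a \<otimes> a = w"
  proof -
    have "\<sigma> a \<otimes> a = w [^] f \<otimes> (a \<otimes> a)" by (simp add: \<sigma>_def s(3) M0.m_assoc)
    also have "\<dots> = w [^] (f + e)" by (simp add: M.sq M0.nat_pow_mult)
    also have "\<dots> = w [^] (1::nat)" using fe by (simp only: M.pow_cong_iff)
    finally show ?thesis by simp
  qed
  have even: "orb G \<sigma> a (2 * k) = w [^] geom (i * i) k" for k
  proof (induction k)
    case (Suc k)
    have "orb G \<sigma> a (2 * Suc k) = \<sigma> (\<sigma> (w [^] geom (i * i) k)) \<otimes> (\<sigma> a \<otimes> a)"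
      by (simp add: Suc M0.m_assoc)
    also have "\<dots> = w [^] (i * i * geom (i * i) k) \<otimes> w"
      by (simp only: saa) (simp add: sg.hom_nat_pow sw M0.nat_pow_pow mult.assoc)
    finally show ?case by (simp add: geom_Suc_shift)
  qed simp
  have lcg: "lcg_unit N (i * i)"
    unfolding lcg_unit_def
  proof (intro conjI allI impI)
    fix p assume "prime p \<and> p dvd N"
    then show "[i * i = 1] (mod p)"
      using cong_mult[of i 1 p i 1] i(2) by simp
  next
    \<comment> \<open>i is odd, and odd squares are 1 modulo 4.\<close>
    obtain j where "i + 1 = 2 * j" using \<open>2 dvd i + 1\<close> by blast
    then obtain l where "i = 2 * l + 1" by (cases j) auto
    then have "i * i = 1 + 4 * (l * l + l)" by (simp add: algebra_simps)
    then show "[i * i = 1] (mod 4)" unfolding cong_def by (metis mod_mult_self2)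
  qed
  have "hol_cycle G \<sigma> a"
  proof unfold_locales
    show "finite (carrier G)" unfolding M.carrier_eq by simp
    show "carrier G \<subseteq> range (orb G \<sigma> a)"
    proof
      fix x assume "x \<in> carrier G"
      then show "x \<in> range (orb G \<sigma> a)"
      proof (cases rule: M.elem_cases)
        case (1 b)
        obtain k where "[geom (i * i) k = b] (mod N)"
          using geom_onto'[OF lcg N_pos] by blast
        then have "x = orb G \<sigma> a (2 * k)"
          by (simp only: 1 even M.pow_cong_iff cong_sym)
        then show ?thesis by blast
      next
        case (2 b)
        \<comment> \<open>An odd-indexed term is \<sigma> of an even-indexed one times a, so its
          exponent carries an extra factor i, compensated by the inverse j.\<close>
        obtain j where j: "[i * j = 1] (mod N)"
          using cong_solve_coprime_nat[OF copi] by auto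
        obtain k where k: "[geom (i * i) k = j * b] (mod N)"
          using geom_onto'[OF lcg N_pos] by blast
        have "[i * geom (i * i) k = i * (j * b)] (mod N)" using k by (rule cong_scalar_left)
        also have "[i * (j * b) = b] (mod N)" using cong_scalar_right[OF j, of b] by (simp add: mult.assoc)
        finally have ik: "[i * geom (i * i) k = b] (mod N)" .
        have "orb G \<sigma> a (Suc (2 * k)) = w [^] (i * geom (i * i) k) \<otimes> a"
          by (simp only: orb.simps(2) even) (simp add: sg.hom_nat_pow sw M0.nat_pow_pow)
        also have "\<dots> = x" using ik by (simp only: 2 M.pow_y_cong_iff)
        finally show ?thesis by blast
      qed
    qed
  qed (use autoD[OF sa] in auto)
  moreover have "(LEAST i::nat. \<sigma> (\<sigma> a \<otimes> a) = (\<sigma> a \<otimes> a) [^] i) = i"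
    unfolding saa
    using Least_pow_exponent(4)[OF M0.is_group M.w_closed M.pow_one_iff M.N_pos sw i(1)] .
  ultimately show ?thesis using sa by blast
qed

text \<open>By \<open>hol_cycle_type\<close> equal i give equal e modulo N, so
  \<open>metacyclic_iso\<close> carries one pair (w, a) to the other. The resulting automorphism
  intertwines the two maps because it does so on w and on a.\<close>

lemma e_HG_type:
  fixes G (structure)
  assumes Gam: "cyclic_gen Gam c (2 * N)" and ty: "has_type G N t0 \<epsilon>" "good_eps \<epsilon>"
  shows "e_HG Gam G = card {i. i < N \<and> (\<forall>p. prime p \<and> p dvd N \<longrightarrow> [i = 1] (mod p))}"
proof -
  define idx where "idx = (\<lambda>\<sigma> a. LEAST i::nat. \<sigma> (\<sigma> a \<otimes> a) = (\<sigma> a \<otimes> a) [^] i)"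
  have G: "group G" and ord: "order G = 2 * N"
    using has_type_group[OF ty(1)] has_type_order[OF ty(1)] .
  interpret G: group G by (rule G)
  note T = hol_cycle_type[OF ty]
  show ?thesis
  proof (rule e_HG_eq_card[OF Gam G ord, of idx])
    fix \<sigma> a assume "\<sigma> \<in> auto G" "hol_cycle G \<sigma> a"
    then show "idx \<sigma> a \<in> {i. i < N \<and> (\<forall>p. prime p \<and> p dvd N \<longrightarrow> [i = 1] (mod p))}"
      using T(3,4) unfolding idx_def by blast
  next
    fix i assume "i \<in> {i. i < N \<and> (\<forall>p. prime p \<and> p dvd N \<longrightarrow> [i = 1] (mod p))}"
    then show "\<exists>\<sigma> a. \<sigma> \<in> auto G \<and> hol_cycle G \<sigma> a \<and> idx \<sigma> a = i"
      unfolding idx_def using type_realize[OF ty, of i] by blast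
  next
    fix \<sigma> a \<sigma>' a'
    assume s: "\<sigma> \<in> auto G" "hol_cycle G \<sigma> a" and s': "\<sigma>' \<in> auto G" "hol_cycle G \<sigma>' a'"
    interpret S: hol_cycle G \<sigma> a by (rule s(2))
    interpret S': hol_cycle G \<sigma>' a' by (rule s'(2))
    let ?w = "\<sigma> a \<otimes> a" and ?w' = "\<sigma>' a' \<otimes> a'"
    show "idx \<sigma> a = idx \<sigma>' a' \<longleftrightarrow>
      (\<exists>\<alpha>\<in>auto G. \<alpha> a = a' \<and> (\<forall>x\<in>carrier G. \<alpha> (\<sigma> x) = \<sigma>' (\<alpha> x)))"
    proof
      assume eq: "idx \<sigma> a = idx \<sigma>' a'"
      define i where "i = idx \<sigma> a"
      have sw: "\<sigma> ?w = ?w [^] i" "\<sigma>' ?w' = ?w' [^] i"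
        using T(2)[OF s(2)] T(2)[OF s'(2)] eq unfolding i_def idx_def by simp_all
      have i1: "\<And>p. prime p \<Longrightarrow> p dvd N \<Longrightarrow> [i = 1] (mod p)"
        unfolding i_def idx_def using T(4)[OF s(2)] .
      obtain e where e: "metacyclic G ?w a N t0 e" "[e = \<epsilon>] (mod 2 ^ (v - 1))" "[e * (i + 1) = 2] (mod n')"
        using T(1)[OF s(2)] unfolding i_def idx_def by blast
      obtain e' where e': "metacyclic G ?w' a' N t0 e'" "[e' = \<epsilon>] (mod 2 ^ (v - 1))" "[e' * (i + 1) = 2] (mod n')"
        using T(1)[OF s'(2)] eq unfolding i_def idx_def by auto
      have "coprime (i + 1) n'"
        using coprime_Suc_of_cong_one[of n' i] i1 n'_odd by (simp add: N_def)
      moreover have "[e' * (i + 1) = e * (i + 1)] (mod n')"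
        using e(3) e'(3) cong_sym cong_trans by blast
      ultimately have "[e' = e] (mod n')"
        using cong_mult_rcancel_nat by blast
      moreover have "[e' = e] (mod 2 ^ (v - 1))"
        using e(2) e'(2) cong_sym cong_trans by blast
      ultimately have "[e' = e] (mod N)" using cong_N_iff by blast
      then have e'': "metacyclic G ?w' a' N t0 e"
        by (rule metacyclic.change_params[OF e'(1) cong_refl])
      interpret M: metacyclic G ?w a N t0 e by (rule e(1))
      obtain f where f: "f \<in> iso G G" "f ?w = ?w'" "f a = a'"
        using e(1) e'' by (rule metacyclic_iso)
      define \<alpha> where "\<alpha> = restrict f (carrier G)"
      have \<alpha>: "\<alpha> \<in> auto G" unfolding \<alpha>_def using G f(1) by (rule restrict_iso_auto)
      interpret \<alpha>: group_hom G G \<alpha>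
        using autoD(1)[OF \<alpha>] G by (simp add: group_hom_def group_hom_axioms_def)
      have \<alpha>a: "\<alpha> a = a'" by (simp add: \<alpha>_def f(3))
      have \<alpha>w: "\<alpha> ?w = ?w'" unfolding \<alpha>_def using f(2) M.w_closed by (simp only: restrict_apply') 
      have "\<alpha> (\<sigma> x) = \<sigma>' (\<alpha> x)" if "x \<in> carrier G" for x
      proof -
        have "(\<alpha> \<circ> \<sigma>) x = (\<sigma>' \<circ> \<alpha>) x"
        proof (rule M.hom_unique[of "\<alpha> \<circ> \<sigma>" G "\<sigma>' \<circ> \<alpha>"])
          show "\<alpha> \<circ> \<sigma> \<in> hom G G" using S.hom \<alpha>.homh by (rule Group.hom_compose)
          show "\<sigma>' \<circ> \<alpha> \<in> hom G G" using \<alpha>.homh S'.hom by (rule Group.hom_compose)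
          show "(\<alpha> \<circ> \<sigma>) ?w = (\<sigma>' \<circ> \<alpha>) ?w"
            unfolding o_apply sw(1) \<alpha>.hom_nat_pow[OF M.w_closed] \<alpha>w sw(2) ..
          \<comment> \<open>Both sides are the image of \<sigma>(a) a; cancelling a' gives the
            relation on a.\<close>
          have "\<alpha> (\<sigma> a) \<otimes> a' = \<sigma>' a' \<otimes> a'"
            using \<alpha>w \<alpha>.hom_mult[of "\<sigma> a" a] \<alpha>a by simp
          then show "(\<alpha> \<circ> \<sigma>) a = (\<sigma>' \<circ> \<alpha>) a" by (simp add: \<alpha>a)
        qed (use that G in auto)
        then show ?thesis by simp
      qed
      then show "\<exists>\<alpha>\<in>auto G. \<alpha> a = a' \<and> (\<forall>x\<in>carrier G. \<alpha> (\<sigma> x) = \<sigma>' (\<alpha> x))"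
        using \<alpha> \<alpha>a by blast
    next
      assume "\<exists>\<alpha>\<in>auto G. \<alpha> a = a' \<and> (\<forall>x\<in>carrier G. \<alpha> (\<sigma> x) = \<sigma>' (\<alpha> x))"
      then obtain \<alpha> where \<alpha>: "\<alpha> \<in> auto G" "\<alpha> a = a'" "\<And>x. x \<in> carrier G \<Longrightarrow> \<alpha> (\<sigma> x) = \<sigma>' (\<alpha> x)"
        by blast
      interpret \<alpha>: group_hom G G \<alpha>
        using autoD(1)[OF \<alpha>(1)] G by (simp add: group_hom_def group_hom_axioms_def)
      have w: "?w \<in> carrier G" by simp
      have \<alpha>w: "\<alpha> ?w = ?w'" using \<alpha> by simp
      have "\<sigma>' ?w' = ?w' [^] i \<longleftrightarrow> \<sigma> ?w = ?w [^] i" for i :: nat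
      proof -
        have "\<sigma>' ?w' = ?w' [^] i \<longleftrightarrow> \<alpha> (\<sigma> ?w) = \<alpha> (?w [^] i)"
          unfolding \<alpha>(3)[OF w] \<alpha>.hom_nat_pow[OF w] \<alpha>w ..
        also have "\<dots> \<longleftrightarrow> \<sigma> ?w = ?w [^] i"
          using autoD(3)[OF \<alpha>(1)] inj_on_eq_iff[of \<alpha> "carrier G" "\<sigma> ?w" "?w [^] i"]
          by (simp add: bij_betw_def)
        finally show ?thesis .
      qed
      then show "idx \<sigma> a = idx \<sigma>' a'" unfolding idx_def by simp
    qed
  qed
qed

end

section \<open>Counting the admissible exponents\<close>

lemma card_cong_one:
  fixes m M :: nat
  assumes "m dvd M" "M > 0"
  shows "card {i. i < M \<and> [i = 1] (mod m)} = M div m"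
proof -
  obtain q where q: "M = m * q" using assms(1) by blast
  have m: "m > 0" using assms(2) q by (cases m) auto
  \<comment> \<open>\<open>1 mod m\<close> and not 1, since for m = 1 the representative is
    0.\<close>
  have "{i. i < M \<and> [i = 1] (mod m)} = (\<lambda>j. m * j + 1 mod m) ` {..<q}"
  proof
    show "{i. i < M \<and> [i = 1] (mod m)} \<subseteq> (\<lambda>j. m * j + 1 mod m) ` {..<q}"
    proof
      fix i assume i: "i \<in> {i. i < M \<and> [i = 1] (mod m)}"
      then have "i = m * (i div m) + 1 mod m"
        unfolding cong_def by (metis (mono_tags) mem_Collect_eq mult_div_mod_eq)
      moreover have "i div m < q" using i q m by (simp add: less_mult_imp_div_less mult.commute)
      ultimately show "i \<in> (\<lambda>j. m * j + 1 mod m) ` {..<q}" by blast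
    qed
    show "(\<lambda>j. m * j + 1 mod m) ` {..<q} \<subseteq> {i. i < M \<and> [i = 1] (mod m)}"
    proof clarify
      fix j assume j: "j < q"
      have "1 mod m < m" using m by simp
      then have "m * j + 1 mod m < m * Suc j" by simp
      also have "\<dots> \<le> M" using j q by (metis Suc_leI mult_le_mono2)
      finally show "m * j + 1 mod m < M \<and> [m * j + 1 mod m = 1] (mod m)"
        by (simp add: cong_def)
    qed
  qed
  moreover have "inj_on (\<lambda>j. m * j + 1 mod m) {..<q}"
    using m by (auto simp: inj_on_def)
  ultimately show ?thesis using m q by (simp add: card_image)
qed

lemma cong_radical_iff:
  assumes "n > 0"
  shows "[i = 1] (mod radical n) \<longleftrightarrow> (\<forall>p. prime p \<and> p dvd n \<longrightarrow> [i = 1] (mod p))"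
proof
  assume a: "[i = 1] (mod radical n)"
  show "\<forall>p. prime p \<and> p dvd n \<longrightarrow> [i = 1] (mod p)"
  proof (intro allI impI)
    fix p assume "prime p \<and> p dvd n"
    then have "p \<in> prime_factors n" using assms by (simp add: in_prime_factors_iff)
    then have "p dvd radical n" unfolding radical_def by (intro dvd_prodI) auto
    then show "[i = 1] (mod p)" using a cong_dvd_modulus_nat by blast
  qed
next
  assume a: "\<forall>p. prime p \<and> p dvd n \<longrightarrow> [i = 1] (mod p)"
  show "[i = 1] (mod radical n)"
    unfolding radical_def
  proof (rule coprime_cong_prod_nat)
    fix p q assume "p \<in> prime_factors n" "q \<in> prime_factors n" "p \<noteq> q"
    then show "coprime p q" by (intro primes_coprime) (auto simp: in_prime_factors_iff)
  qed (use a in \<open>auto simp: in_prime_factors_iff\<close>)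
qed

lemma radical_dvd: "n > 0 \<Longrightarrow> radical n dvd n"
proof -
  assume n: "n > 0"
  have "radical n dvd (\<Prod>p\<in>prime_factors n. p ^ multiplicity p n)"
    unfolding radical_def
  proof (rule prod_dvd_prod)
    fix p assume "p \<in> prime_factors n"
    then have "multiplicity p n > 0"
      using n by (simp add: prime_multiplicity_gt_zero_iff in_prime_factors_iff)
    then show "p dvd p ^ multiplicity p n" by (simp add: dvd_power)
  qed
  also have "\<dots> = n" using n prime_factorization_nat[of n] by simp
  finally show ?thesis .
qed

text \<open>As n / 2 is still even, n and n / 2 have the same primes. Moreover
  \<open>2 * radical n\<close> is 4 times an odd number, so a congruence modulo it splits into one
  modulo the radical and one modulo 4.\<close>

lemma radical_double:
  assumes "4 dvd n" "n > 0"
  shows "radical n dvd n div 2" "2 * radical n dvd n"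
    and "[i = 1] (mod 2 * radical n) \<longleftrightarrow> [i = 1] (mod radical n) \<and> [i = 1] (mod 4)"
proof -
  define N where "N = n div 2"
  have nN: "n = 2 * N" and Neven: "even N" using assms(1) by (auto simp: N_def)
  have Npos: "N > 0" using assms(2) nN by simp
  have "prime_factors n = prime_factors N"
  proof -
    have "p dvd n \<longleftrightarrow> p dvd N" if "prime p" for p
    proof
      assume "p dvd n"
      then have "p dvd 2 \<or> p dvd N" using nN that prime_dvd_mult_nat by blast
      then show "p dvd N" using Neven that primes_dvd_imp_eq[of p 2] two_is_prime_nat by blast
    qed (simp add: nN)
    then show ?thesis using assms(2) Npos by (auto simp: in_prime_factors_iff)
  qed
  then have rad: "radical n = radical N" by (simp add: radical_def)
  then show "radical n dvd n div 2" using radical_dvd[OF Npos] by (simp add: N_def)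
  then show "2 * radical n dvd n" using nN N_def by (metis dvd_refl mult_dvd_mono)
  have two: "2 \<in> prime_factors n" using assms(2) nN by (simp add: in_prime_factors_iff)
  define r where "r = (\<Prod>p\<in>prime_factors n - {2}. p)"
  have r: "radical n = 2 * r"
    unfolding radical_def r_def using two by (simp add: prod.remove)
  have "coprime 4 r"
    unfolding r_def
  proof (rule prod_coprime_right)
    fix p assume p: "p \<in> prime_factors n - {2}"
    then have "coprime 2 p" by (intro primes_coprime) (auto simp: in_prime_factors_iff)
    then have "coprime (2 ^ 2) p" by (simp only: coprime_power_left_iff) simp
    then show "coprime 4 p" by simp
  qed
  show "[i = 1] (mod 2 * radical n) \<longleftrightarrow> [i = 1] (mod radical n) \<and> [i = 1] (mod 4)"
  proof
    assume a: "[i = 1] (mod 2 * radical n)"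
    have "4 dvd 2 * radical n" using r by simp
    then show "[i = 1] (mod radical n) \<and> [i = 1] (mod 4)"
      using a cong_dvd_modulus_nat[OF a] by simp
  next
    assume a: "[i = 1] (mod radical n) \<and> [i = 1] (mod 4)"
    then have "[i = 1] (mod r)" using r cong_dvd_modulus_nat[of i 1 "radical n" r] by simp
    then have "[i = 1] (mod 4 * r)" using a \<open>coprime 4 r\<close> coprime_cong_mult_nat by blast
    then show "[i = 1] (mod 2 * radical n)" using r by simp
  qed
qed

lemma card_lcg_unit:
  assumes "n > 0"
  shows "card {i. i < n \<and> lcg_unit n i} = (if 4 dvd n then n div (2 * radical n) else n div radical n)"
proof (cases "4 dvd n")
  case True
  have "{i. i < n \<and> lcg_unit n i} = {i. i < n \<and> [i = 1] (mod 2 * radical n)}"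
    unfolding lcg_unit_def radical_double(3)[OF True assms] cong_radical_iff[OF assms] using True by auto
  then show ?thesis
    using card_cong_one[OF radical_double(2)[OF True assms] assms] True by simp
next
  case False
  have "{i. i < n \<and> lcg_unit n i} = {i. i < n \<and> [i = 1] (mod radical n)}"
    unfolding lcg_unit_def cong_radical_iff[OF assms] using False by auto
  then show ?thesis
    using card_cong_one[OF radical_dvd[OF assms] assms] False by simp
qed

text \<open>n / 2 and n have the same primes, so one residue class modulo \<open>radical n\<close>
  is counted below n / 2.\<close>

lemma card_type_index:
  assumes "4 dvd n" "n > 0"
  shows "card {i. i < n div 2 \<and> (\<forall>p. prime p \<and> p dvd n div 2 \<longrightarrow> [i = 1] (mod p))} = n div (2 * radical n)"
proof -
  have N: "n div 2 > 0" using assms by auto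
  have nN: "n = 2 * (n div 2)" "even (n div 2)" using assms(1) by auto
  have "prime p \<and> p dvd n div 2 \<longleftrightarrow> prime p \<and> p dvd n" for p
  proof
    assume a: "prime p \<and> p dvd n"
    then have "p dvd 2 \<or> p dvd n div 2" using nN(1) prime_dvd_mult_nat by metis
    then show "prime p \<and> p dvd n div 2"
      using nN(2) a primes_dvd_imp_eq[of p 2] two_is_prime_nat by blast
  next
    assume "prime p \<and> p dvd n div 2"
    then show "prime p \<and> p dvd n" using nN(1) by (metis dvd_mult)
  qed
  then have "{i. i < n div 2 \<and> (\<forall>p. prime p \<and> p dvd n div 2 \<longrightarrow> [i = 1] (mod p))}
      = {i. i < n div 2 \<and> [i = 1] (mod radical n)}"
    unfolding cong_radical_iff[OF assms(2)] by simp
  then show ?thesis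
    using card_cong_one[OF radical_double(1)[OF assms] N] by (simp add: div_mult2_eq)
qed

section \<open>Dihedral and quaternion groups\<close>

lemma DirProd_pow:
  assumes "group G" "group H"
  shows "(a, b) [^]\<^bsub>G \<times>\<times> H\<^esub> (k::nat) = (a [^]\<^bsub>G\<^esub> k, b [^]\<^bsub>H\<^esub> k)"
proof -
  interpret G: group G by (rule assms)
  interpret H: group H by (rule assms)
  interpret P: group "G \<times>\<times> H" using assms by (rule DirProd_group)
  show ?thesis by (induction k) simp_all
qed

text \<open>Pairs \<open>(a, s)\<close> stand for \<open>x\<^sup>a y\<^sup>s\<close> with \<open>x\<close> of order \<open>m\<close>, \<open>y x y\<^sup>-\<^sup>1 = x\<^sup>-\<^sup>1\<close> and \<open>y\<^sup>2 = x\<^sup>q\<close>;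
  associativity forces \<open>x\<^sup>q = x\<^sup>-\<^sup>q\<close>.\<close>

definition inverting_extension :: "int \<Rightarrow> int \<Rightarrow> (int \<times> int) monoid" where
  "inverting_extension m q =
     \<lparr>carrier = {0..<m} \<times> {0..<2},
      monoid.mult = (\<lambda>(a, s) (b, t).
                ((a + (if s = 0 then b else - b) + (if s = 1 \<and> t = 1 then q else 0)) mod m,
                 (s + t) mod 2)),
      one = (0, 0)\<rparr>"

lemma dihedral_eq_inverting_extension:
  "dihedral_group v = inverting_extension (2 ^ (v - 1)) 0"
  by (simp add: dihedral_group_def inverting_extension_def Let_def)

lemma quaternion_eq_inverting_extension:
  "quaternion_group v = inverting_extension (2 ^ (v - 1)) (2 ^ (v - 1) div 2)"
  by (simp add: quaternion_group_def inverting_extension_def Let_def)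

lemma carrier_inverting_extension:
  "carrier (inverting_extension m q) = {0..<m} \<times> {0..<2}"
  by (simp add: inverting_extension_def)

lemma one_inverting_extension: "\<one>\<^bsub>inverting_extension m q\<^esub> = (0, 0)"
  by (simp add: inverting_extension_def)

lemma mult_inverting_extension:
  "(a, s) \<otimes>\<^bsub>inverting_extension m q\<^esub> (b, t) =
    ((a + (if s = 0 then b else - b) + (if s = 1 \<and> t = 1 then q else 0)) mod m, (s + t) mod 2)"
  by (simp add: inverting_extension_def)

lemma group_inverting_extension:
  assumes "m > 0" "m dvd 2 * q"
  shows "group (inverting_extension m q)"
proof (rule groupI)
  have two: "s = 0 \<or> s = 1" if "s \<in> {0..<2}" for s :: int
    using that by auto
  show "\<one>\<^bsub>inverting_extension m q\<^esub> \<in> carrier (inverting_extension m q)"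
    using assms by (simp add: one_inverting_extension carrier_inverting_extension)
  fix x assume "x \<in> carrier (inverting_extension m q)"
  then obtain a s where x: "x = (a, s)" "0 \<le> a" "a < m" "s = 0 \<or> s = 1"
    using two by (auto simp: carrier_inverting_extension)
  show "\<one>\<^bsub>inverting_extension m q\<^esub> \<otimes>\<^bsub>inverting_extension m q\<^esub> x = x"
    using x by (auto simp: one_inverting_extension mult_inverting_extension)
  show "\<exists>y\<in>carrier (inverting_extension m q). y \<otimes>\<^bsub>inverting_extension m q\<^esub> x = \<one>\<^bsub>inverting_extension m q\<^esub>"
  proof (cases "s = 0")
    case True
    then show ?thesis
      using x assms by (intro bexI[of _ "((- a) mod m, 0)"])
        (auto simp: one_inverting_extension mult_inverting_extension carrier_inverting_extension mod_simps)
  next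
    case False
    have "((a - q) mod m - a + q) mod m = 0"
      using mod_add_left_eq[of "a - q" m "q - a"] by (simp add: algebra_simps)
    then show ?thesis
      using False x assms by (intro bexI[of _ "((a - q) mod m, 1)"])
        (auto simp: one_inverting_extension mult_inverting_extension carrier_inverting_extension mod_simps)
  qed
  fix y assume "y \<in> carrier (inverting_extension m q)"
  then obtain b t where y: "y = (b, t)" "0 \<le> b" "b < m" "t = 0 \<or> t = 1"
    using two by (auto simp: carrier_inverting_extension)
  show "x \<otimes>\<^bsub>inverting_extension m q\<^esub> y \<in> carrier (inverting_extension m q)"
    using x y assms by (simp add: mult_inverting_extension carrier_inverting_extension)
  fix z assume "z \<in> carrier (inverting_extension m q)"
  then obtain c u where z: "z = (c, u)" "0 \<le> c" "c < m" "u = 0 \<or> u = 1"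
    using two by (auto simp: carrier_inverting_extension)
  \<comment> \<open>The case s = t = u = 1 of associativity, where y^3 is bracketed in two ways;
    this uses that m divides 2 q.\<close>
  have q: "(a + q + c - b) mod m = (a + c - (q + b)) mod m"
  proof -
    have "m dvd (a + q + c - b) - (a + c - (q + b))" using assms(2) by (simp add: algebra_simps)
    then show ?thesis by (simp add: mod_eq_dvd_iff)
  qed
  have r: "(q + r mod m - c) mod m = (q + r - c) mod m" for r
    by (metis mod_add_right_eq mod_diff_left_eq)
  show "x \<otimes>\<^bsub>inverting_extension m q\<^esub> y \<otimes>\<^bsub>inverting_extension m q\<^esub> z =
      x \<otimes>\<^bsub>inverting_extension m q\<^esub> (y \<otimes>\<^bsub>inverting_extension m q\<^esub> z)"
    using x(4) y(4) z(4) q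
    by (elim disjE) (simp_all add: x(1) y(1) z(1) mult_inverting_extension mod_simps r algebra_simps)
qed

text \<open>w pairs x with the generator of the odd cyclic factor and has order m n' = N, as m and
  n' are coprime. Conjugation by y inverts the first component and fixes the second, which is the
  exponent t0.\<close>

lemma (in split_order) has_type_inverting_extension:
  assumes q: "(2::int) ^ (v - 1) dvd 2 * q" and e: "[int e = q] (mod 2 ^ (v - 1))" "n' dvd e"
  shows "has_type (inverting_extension (2 ^ (v - 1)) q \<times>\<times> cyc n') N t0 e"
proof -
  define m where "m = (2::nat) ^ (v - 1)"
  define E where "E = inverting_extension (int m) q"
  have m2: "m \<ge> 2" unfolding m_def two_power by simp
  have n'0: "n' > 0" using n'_odd by (cases n') auto
  have gE: "group E" unfolding E_def using m2 q by (intro group_inverting_extension) (auto simp: m_def)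
  interpret E: group E by (rule gE)
  interpret C: group "cyc n'" by simp
  interpret P: group "E \<times>\<times> cyc n'" using gE by (intro DirProd_group) auto
  have powE: "(1, 0) [^]\<^bsub>E\<^esub> (k::nat) = (int k mod int m, 0)" for k
  proof (induction k)
    case 0
    show ?case by (simp add: E_def one_inverting_extension)
  next
    case (Suc k)
    then show ?case by (simp add: E_def mult_inverting_extension mod_simps add.commute)
  qed
  \<comment> \<open>\<open>1 mod int n'\<close> rather than 1, because n' may be 1.\<close>
  define w where "w = ((1::int, 0::int), 1 mod int n')"
  define y where "y = ((0::int, 1::int), 0::int)"
  have poww: "w [^]\<^bsub>E \<times>\<times> cyc n'\<^esub> (k::nat) = ((int k mod int m, 0), int k mod int n')" for k
    unfolding w_def using gE by (simp add: DirProd_pow powE mod_simps)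
  have powwy: "w [^]\<^bsub>E \<times>\<times> cyc n'\<^esub> (k::nat) \<otimes>\<^bsub>E \<times>\<times> cyc n'\<^esub> y = ((int k mod int m, 1), int k mod int n')" for k
    unfolding poww y_def by (simp add: E_def mult_inverting_extension)
  have wc: "w \<in> carrier (E \<times>\<times> cyc n')"
    using m2 n'0 by (simp add: w_def E_def carrier_inverting_extension carrier_integer_mod_group)
  have yc: "y \<in> carrier (E \<times>\<times> cyc n')"
    using m2 n'0 by (simp add: y_def E_def carrier_inverting_extension carrier_integer_mod_group)
  have cop: "coprime m n'" unfolding m_def by (rule coprime_2)
  have Nm: "N = m * n'" by (simp add: N_def m_def)
  have mc: "metacyclic (E \<times>\<times> cyc n') w y N t0 e"
  proof unfold_locales
    show "N > 0" by (rule N_pos)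
    show "w \<in> carrier (E \<times>\<times> cyc n')" "y \<in> carrier (E \<times>\<times> cyc n')" by (fact wc, fact yc)
    show "w [^]\<^bsub>E \<times>\<times> cyc n'\<^esub> k = \<one>\<^bsub>E \<times>\<times> cyc n'\<^esub> \<longleftrightarrow> N dvd k" for k :: nat
    proof -
      have "w [^]\<^bsub>E \<times>\<times> cyc n'\<^esub> k = \<one>\<^bsub>E \<times>\<times> cyc n'\<^esub> \<longleftrightarrow> int k mod int m = 0 \<and> int k mod int n' = 0"
        unfolding poww by (simp add: E_def one_inverting_extension)
      also have "\<dots> \<longleftrightarrow> m dvd k \<and> n' dvd k"
        by (simp add: mod_0_imp_dvd zmod_int[symmetric] dvd_eq_mod_eq_0)
      also have "\<dots> \<longleftrightarrow> N dvd k"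
        unfolding Nm using cop by (meson divides_mult dvd_mult_left dvd_mult_right)
      finally show ?thesis .
    qed
    show "carrier (E \<times>\<times> cyc n') \<subseteq> range (\<lambda>k::nat. w [^]\<^bsub>E \<times>\<times> cyc n'\<^esub> k) \<union>
        range (\<lambda>k::nat. w [^]\<^bsub>E \<times>\<times> cyc n'\<^esub> k \<otimes>\<^bsub>E \<times>\<times> cyc n'\<^esub> y)"
    proof
      fix x assume "x \<in> carrier (E \<times>\<times> cyc n')"
      then obtain a s b where x: "x = ((a, s), b)" "0 \<le> a" "a < int m" "0 \<le> b" "b < int n'"
        and "0 \<le> s" "s < 2"
        using n'0 by (auto simp: E_def carrier_inverting_extension carrier_integer_mod_group)
      then have s: "s = 0 \<or> s = 1" by auto
      obtain k where k: "[k = nat a] (mod m)" "[k = nat b] (mod n')"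
        using binary_chinese_remainder_nat[OF cop] by blast
      have "int k mod int m = a" "int k mod int n' = b"
        using k x by (simp_all add: cong_def flip: zmod_int)
      then show "x \<in> range (\<lambda>k::nat. w [^]\<^bsub>E \<times>\<times> cyc n'\<^esub> k) \<union>
        range (\<lambda>k::nat. w [^]\<^bsub>E \<times>\<times> cyc n'\<^esub> k \<otimes>\<^bsub>E \<times>\<times> cyc n'\<^esub> y)"
        using x(1) s unfolding powwy unfolding poww by auto
    qed
    show "y \<notin> range (\<lambda>k::nat. w [^]\<^bsub>E \<times>\<times> cyc n'\<^esub> k)"
      unfolding poww by (auto simp: y_def)
    have "(- 1) mod int m = int t0 mod int m"
    proof -
      have "int m dvd int (t0 + 1)" using t0(1) unfolding m_def by (simp only: int_dvd_int_iff)
      then have "int m dvd (- 1) - int t0" by (metis dvd_minus_iff minus_diff_eq of_nat_add of_nat_1 diff_minus_eq_add)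
      then show ?thesis by (simp add: mod_eq_dvd_iff)
    qed
    moreover have "1 mod int n' = int t0 mod int n'"
      using t0(2) by (metis cong_def of_nat_1 zmod_int)
    ultimately show "y \<otimes>\<^bsub>E \<times>\<times> cyc n'\<^esub> w = w [^]\<^bsub>E \<times>\<times> cyc n'\<^esub> t0 \<otimes>\<^bsub>E \<times>\<times> cyc n'\<^esub> y"
      unfolding powwy by (simp add: y_def w_def E_def mult_inverting_extension)
    have "q mod int m = int e mod int m"
      using e(1) by (simp add: cong_def m_def)
    moreover have "int e mod int n' = 0"
      using e(2) by (simp flip: zmod_int)
    ultimately show "y \<otimes>\<^bsub>E \<times>\<times> cyc n'\<^esub> y = w [^]\<^bsub>E \<times>\<times> cyc n'\<^esub> e"
      unfolding poww by (simp add: y_def E_def mult_inverting_extension)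
  qed
  then have "has_type (E \<times>\<times> cyc n') N t0 e" unfolding has_type_def by blast
  then show ?thesis by (simp add: E_def m_def)
qed

lemma (in split_order) has_type_dihedral: "has_type (dihedral_group v \<times>\<times> cyc n') N t0 0"
  unfolding dihedral_eq_inverting_extension by (rule has_type_inverting_extension) auto

text \<open>\<open>N div 2\<close> is 2^(v - 2) modulo 2^(v - 1), the exponent of y^2 in Q, and 0
  modulo n'.\<close>

lemma (in split_order) has_type_quaternion:
  "has_type (quaternion_group v \<times>\<times> cyc n') N t0 (N div 2)"
proof -
  have two: "(2::int) ^ (v - 1) = 2 * 2 ^ (v - 2)"
    using arg_cong[OF two_power, of int] by simp
  have "[int (N div 2) = 2 ^ (v - 1) div 2] (mod 2 ^ (v - 1))"
    using half_N_cong cong_int_iff[of "N div 2" "2 ^ (v - 2)" "2 ^ (v - 1)"] two by simp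
  moreover have "n' dvd N div 2" by (simp add: half_N)
  moreover have "(2::int) ^ (v - 1) dvd 2 * (2 ^ (v - 1) div 2)" using two by simp
  ultimately show ?thesis
    unfolding quaternion_eq_inverting_extension by (intro has_type_inverting_extension)
qed

lemma (in split_order) has_type_cyc_prod:
  assumes "v = 2"
  shows "has_type (cyc 2 \<times>\<times> cyc N) N t0 0"
proof -
  have N1: "N > 1" using N_pos N_even by (cases "N = 1") auto
  interpret P: group "cyc 2 \<times>\<times> cyc N" by (intro DirProd_group) auto
  \<comment> \<open>For v = 2 the residue 1 satisfies the two congruences that define t0.\<close>
  have t1: "[t0 = 1] (mod N)"
  proof -
    have "[1 = t0] (mod N)" unfolding t_cong_iff using assms by simp
    then show ?thesis by (rule cong_sym)
  qed
  define w where "w = (0::int, 1::int)"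
  define y where "y = (1::int, 0::int)"
  have poww: "w [^]\<^bsub>cyc 2 \<times>\<times> cyc N\<^esub> (k::nat) = (0, int k mod int N)" for k
    unfolding w_def by (simp add: DirProd_pow)
  have powwy: "w [^]\<^bsub>cyc 2 \<times>\<times> cyc N\<^esub> (k::nat) \<otimes>\<^bsub>cyc 2 \<times>\<times> cyc N\<^esub> y = (1, int k mod int N)" for k
    unfolding poww y_def by simp
  have "metacyclic (cyc 2 \<times>\<times> cyc N) w y N t0 0"
  proof unfold_locales
    show "N > 0" by (rule N_pos)
    show "w \<in> carrier (cyc 2 \<times>\<times> cyc N)" "y \<in> carrier (cyc 2 \<times>\<times> cyc N)"
      using N1 by (auto simp: w_def y_def carrier_integer_mod_group)
    show "w [^]\<^bsub>cyc 2 \<times>\<times> cyc N\<^esub> k = \<one>\<^bsub>cyc 2 \<times>\<times> cyc N\<^esub> \<longleftrightarrow> N dvd k" for k :: nat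
      unfolding poww by (simp add: dvd_eq_mod_eq_0 flip: zmod_int)
    show "carrier (cyc 2 \<times>\<times> cyc N) \<subseteq> range (\<lambda>k::nat. w [^]\<^bsub>cyc 2 \<times>\<times> cyc N\<^esub> k) \<union>
        range (\<lambda>k::nat. w [^]\<^bsub>cyc 2 \<times>\<times> cyc N\<^esub> k \<otimes>\<^bsub>cyc 2 \<times>\<times> cyc N\<^esub> y)"
    proof
      fix x assume "x \<in> carrier (cyc 2 \<times>\<times> cyc N)"
      then obtain s b where x: "x = (s, b)" "0 \<le> b" "b < int N" and "0 \<le> s" "s < 2"
        using N1 by (auto simp: carrier_integer_mod_group)
      then have s: "s = 0 \<or> s = 1" by auto
      have "int (nat b) mod int N = b" using x by simp
      then show "x \<in> range (\<lambda>k::nat. w [^]\<^bsub>cyc 2 \<times>\<times> cyc N\<^esub> k) \<union>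
        range (\<lambda>k::nat. w [^]\<^bsub>cyc 2 \<times>\<times> cyc N\<^esub> k \<otimes>\<^bsub>cyc 2 \<times>\<times> cyc N\<^esub> y)"
        using x(1) s range_eqI[of x "\<lambda>k. (0, int k mod int N)" "nat b"]
          range_eqI[of x "\<lambda>k. (1, int k mod int N)" "nat b"] unfolding powwy unfolding poww by auto
    qed
    show "y \<notin> range (\<lambda>k::nat. w [^]\<^bsub>cyc 2 \<times>\<times> cyc N\<^esub> k)"
      unfolding poww by (auto simp: y_def)
    have "int t0 mod int N = 1 mod int N"
      using t1 by (metis cong_def of_nat_1 zmod_int)
    then show "y \<otimes>\<^bsub>cyc 2 \<times>\<times> cyc N\<^esub> w = w [^]\<^bsub>cyc 2 \<times>\<times> cyc N\<^esub> t0 \<otimes>\<^bsub>cyc 2 \<times>\<times> cyc N\<^esub> y"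
      unfolding powwy by (simp add: w_def y_def)
    show "y \<otimes>\<^bsub>cyc 2 \<times>\<times> cyc N\<^esub> y = w [^]\<^bsub>cyc 2 \<times>\<times> cyc N\<^esub> (0::nat)"
      unfolding poww by (simp add: y_def)
  qed
  then show ?thesis unfolding has_type_def by blast
qed

section \<open>Sums over isomorphism classes\<close>

lemma nat_representative:
  assumes K: "group K" "finite (carrier K)"
  obtains G where "G \<in> groups_of_order (order K)" "K \<cong> G"
proof -
  interpret K: group K by (rule K(1))
  obtain f where f: "bij_betw f (carrier K) {0..<order K}"
    using ex_bij_betw_finite_nat[OF K(2)] by (auto simp: order_def)
  define k where "k = inv_into (carrier K) f"
  have kf: "k (f x) = x" if "x \<in> carrier K" for x
    unfolding k_def using f that by (intro inv_into_f_f) (auto simp: bij_betw_def)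
  define G :: "nat monoid" where
    "G = \<lparr>carrier = {..<order K}, monoid.mult = (\<lambda>x y. f (k x \<otimes>\<^bsub>K\<^esub> k y)), one = f \<one>\<^bsub>K\<^esub>\<rparr>"
  have bij: "bij_betw f (carrier K) (carrier G)"
    using f by (simp add: G_def atLeast0LessThan)
  have "f \<in> iso K G"
    using bij kf by (auto simp: iso_def hom_def G_def bij_betw_def)
  moreover from this have "group (G\<lparr>one := f \<one>\<^bsub>K\<^esub>\<rparr>)" by (rule K.iso_imp_img_group)
  then have "group G" by (simp add: G_def)
  ultimately show thesis
    using that[of G] by (auto simp: groups_of_order_def is_iso_def G_def)
qed

abbreviation iso_rel :: "nat \<Rightarrow> (nat monoid \<times> nat monoid) set" where
  "iso_rel n \<equiv> {(G, H). G \<in> groups_of_order n \<and> H \<in> groups_of_order n \<and> G \<cong> H}"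

lemma equiv_iso_rel: "equiv (groups_of_order n) (iso_rel n)"
proof (rule equivI)
  show "iso_rel n \<subseteq> groups_of_order n \<times> groups_of_order n" by auto
  show "refl_on (groups_of_order n) (iso_rel n)" by (auto simp: refl_on_def iso_refl)
  show "sym (iso_rel n)" by (auto simp: sym_def groups_of_order_def group.iso_sym)
  show "trans (iso_rel n)" by (auto simp: trans_def intro: iso_trans)
qed

text \<open>The set of groups itself can be infinite, because the multiplication is arbitrary
  outside the carrier. The class depends only on the table on the carrier, and there are finitely
  many tables.\<close>

lemma finite_iso_classes: "finite (iso_classes n)"
proof -
  define tab where "tab = (\<lambda>G :: nat monoid. restrict (\<lambda>(x, y). x \<otimes>\<^bsub>G\<^esub> y) ({..<n} \<times> {..<n}))"
  define pick where "pick = (\<lambda>t. SOME G. G \<in> groups_of_order n \<and> tab G = t)"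
  have "tab G \<in> ({..<n} \<times> {..<n}) \<rightarrow>\<^sub>E {..<n}" if "G \<in> groups_of_order n" for G
  proof -
    interpret group G using that by (simp add: groups_of_order_def)
    have "carrier G = {..<n}" using that by (simp add: groups_of_order_def)
    then show ?thesis using m_closed by (auto simp: tab_def)
  qed
  then have "tab ` groups_of_order n \<subseteq> ({..<n} \<times> {..<n}) \<rightarrow>\<^sub>E {..<n}" by blast
  then have fin: "finite (tab ` groups_of_order n)"
    by (rule finite_subset) (simp add: finite_PiE)
  have "iso_classes n \<subseteq> (\<lambda>t. iso_rel n `` {pick t}) ` (tab ` groups_of_order n)"
  proof
    fix C assume "C \<in> iso_classes n"
    then obtain G where G: "G \<in> groups_of_order n" "C = iso_rel n `` {G}"
      by (auto simp: iso_classes_def elim: quotientE)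
    have "pick (tab G) \<in> groups_of_order n \<and> tab (pick (tab G)) = tab G"
      unfolding pick_def by (rule someI[of _ G]) (simp add: G(1))
    then have p: "pick (tab G) \<in> groups_of_order n" "tab (pick (tab G)) = tab G" by auto
    have "x \<otimes>\<^bsub>pick (tab G)\<^esub> y = x \<otimes>\<^bsub>G\<^esub> y" if "x < n" "y < n" for x y
      using fun_cong[OF p(2), of "(x, y)"] that by (simp add: tab_def)
    then have "(\<lambda>x. x) \<in> iso G (pick (tab G))"
      using G(1) p(1) by (auto simp: iso_def hom_def groups_of_order_def bij_betw_def)
    then have "(G, pick (tab G)) \<in> iso_rel n" using G(1) p(1) by (auto simp: is_iso_def)
    then have "C = iso_rel n `` {pick (tab G)}"
      unfolding G(2) by (rule equiv_class_eq[OF equiv_iso_rel])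
    then show "C \<in> (\<lambda>t. iso_rel n `` {pick t}) ` (tab ` groups_of_order n)" using G(1) by blast
  qed
  then show ?thesis using fin finite_surj by blast
qed

text \<open>T contains one group from each class that contributes; all others add 0. Since P is only
  known for some member of a class, the last hypothesis speaks of a second group G'.\<close>

lemma sum_iso_classes:
  fixes f :: "nat monoid \<Rightarrow> nat"
  assumes T: "finite T" "T \<subseteq> groups_of_order n" "\<And>K. K \<in> T \<Longrightarrow> P K"
    and distinct: "\<And>K L. K \<in> T \<Longrightarrow> L \<in> T \<Longrightarrow> K \<cong> L \<Longrightarrow> K = L"
    and val: "\<And>K G. K \<in> T \<Longrightarrow> G \<in> groups_of_order n \<Longrightarrow> K \<cong> G \<Longrightarrow> f G = val"
    and zero: "\<And>G G'. G \<in> groups_of_order n \<Longrightarrow> P G' \<Longrightarrow> G' \<in> groups_of_order n \<Longrightarrow> G' \<cong> G \<Longrightarrow> f G \<noteq> 0 \<Longrightarrow>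
      \<exists>K\<in>T. K \<cong> G"
  shows "(\<Sum>C \<in> {C \<in> iso_classes n. \<exists>G \<in> C. P G}. f (SOME G. G \<in> C)) = card T * val"
proof -
  define cls where "cls = (\<lambda>K. iso_rel n `` {K})"
  let ?S = "{C \<in> iso_classes n. \<exists>G \<in> C. P G}"
  have mem: "G \<in> cls K \<longleftrightarrow> K \<in> groups_of_order n \<and> G \<in> groups_of_order n \<and> K \<cong> G" for G K
    by (auto simp: cls_def)
  have self: "K \<in> cls K" if "K \<in> groups_of_order n" for K
    using that by (simp add: mem iso_refl)
  have sub: "cls ` T \<subseteq> ?S"
  proof clarify
    fix K assume K: "K \<in> T"
    then have "K \<in> groups_of_order n" using T(2) by blast
    then show "cls K \<in> iso_classes n \<and> (\<exists>G\<in>cls K. P G)"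
      unfolding iso_classes_def using self T(3)[OF K] quotientI[of K "groups_of_order n" "iso_rel n"]
      by (auto simp only: cls_def)
  qed
  have "f (SOME G. G \<in> C) = 0" if C: "C \<in> ?S - cls ` T" for C
  proof (rule ccontr)
    assume nz: "f (SOME G. G \<in> C) \<noteq> 0"
    obtain K where K: "K \<in> groups_of_order n" "C = cls K"
      using C by (auto simp: iso_classes_def cls_def elim: quotientE)
    define G where "G = (SOME G. G \<in> C)"
    have "G \<in> C" unfolding G_def using self[OF K(1)] K(2) by (intro someI[of "\<lambda>G. G \<in> C" K]) simp
    then have G: "G \<in> groups_of_order n" "K \<cong> G" by (auto simp: K(2) mem)
    obtain G' where G': "G' \<in> groups_of_order n" "K \<cong> G'" "P G'" using C by (auto simp: K(2) mem)
    have "G' \<cong> K" using group.iso_sym[of K G'] K(1) G'(2) by (simp add: groups_of_order_def)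
    then have "G' \<cong> G" using G(2) by (rule iso_trans)
    then obtain L where L: "L \<in> T" "L \<cong> G" using zero[OF G(1) G'(3,1)] nz by (auto simp: G_def)
    have "G \<cong> K" using group.iso_sym[of K G] K(1) G(2) by (simp add: groups_of_order_def)
    with L(2) have "L \<cong> K" by (rule iso_trans)
    then have "cls L = cls K"
      using L(1) T(2) K(1) unfolding cls_def by (intro equiv_class_eq[OF equiv_iso_rel]) auto
    then show False using C L(1) K(2) by blast
  qed
  then have "(\<Sum>C\<in>?S. f (SOME G. G \<in> C)) = (\<Sum>C\<in>cls ` T. f (SOME G. G \<in> C))"
    using sub finite_iso_classes[of n] by (intro sum.mono_neutral_right) auto
  also have "\<dots> = (\<Sum>K\<in>T. f (SOME G. G \<in> cls K))"
  proof (rule sum.reindex_cong[of cls])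
    show "inj_on cls T"
    proof (rule inj_onI)
      fix K L assume KL: "K \<in> T" "L \<in> T" "cls K = cls L"
      then have "L \<in> cls K" using self T(2) by blast
      then show "K = L" using distinct[OF KL(1,2)] by (simp add: mem)
    qed
  qed auto
  also have "\<dots> = (\<Sum>K\<in>T. val)"
  proof (rule sum.cong[OF refl])
    fix K assume K: "K \<in> T"
    then have "K \<in> cls K" using self T(2) by blast
    then have "(SOME G. G \<in> cls K) \<in> cls K" by (rule someI)
    then have "(SOME G. G \<in> cls K) \<in> groups_of_order n \<and> K \<cong> (SOME G. G \<in> cls K)"
      unfolding mem[of "SOME G. G \<in> cls K" K] by blast
    then show "f (SOME G. G \<in> cls K) = val" using val[OF K] by blast
  qed
  finally show ?thesis by simp
qed

section \<open>The classes that contribute to the sums\<close>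

lemma nilpotent_if_comm_group:
  fixes G (structure)
  assumes "comm_group G"
  shows "nilpotent_group G"
proof -
  interpret comm_group G by (rule assms)
  have "inv h \<otimes> inv k \<otimes> h \<otimes> k = \<one>" if "h \<in> carrier G" "k \<in> carrier G" for h k
  proof -
    have "inv h \<otimes> inv k \<otimes> h \<otimes> k = inv (k \<otimes> h) \<otimes> (h \<otimes> k)"
      using that by (simp add: inv_mult_group m_assoc)
    also have "h \<otimes> k = k \<otimes> h" using that by (rule m_comm)
    finally show ?thesis using that by simp
  qed
  then have "{inv h \<otimes> inv k \<otimes> h \<otimes> k |h k. h \<in> carrier G \<and> k \<in> carrier G} = {\<one>}"
    by (auto intro!: exI[of _ "\<one>"])
  then have "lower_central G 1 = {\<one>}"
    using generate_one by (simp add: commutator_subgroup_def)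
  then show ?thesis using is_group unfolding nilpotent_group_def by blast
qed

lemma nilpotent_group_iso:
  assumes "nilpotent_group G" "G \<cong> K" "group K"
  shows "nilpotent_group K"
proof -
  obtain f where "f \<in> iso G K" using assms(2) by (auto simp: is_iso_def)
  then show ?thesis
    using nilpotent_group_hom_image[OF assms(1,3), of f] by (simp add: iso_def bij_betw_def)
qed

text \<open>By \<open>order_generator\<close> with s = 1 the element a has order n.\<close>

lemma (in hol_cycle) nilpotent_cyclic:
  assumes "nilpotent_group G" "\<not> 4 dvd n"
  shows "cyclic_gen G a n"
proof -
  have ord: "a [^] q = \<one> \<longleftrightarrow> n dvd q" for q :: nat
    using order_generator[OF assms(1), of 1 q] assms(2) by simp
  have "inj_on (\<lambda>k. a [^] k) {..<n}"
    by (auto simp: inj_on_def pow_eq_pow_iff[OF a_closed ord] cong_def)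
  then have "card ((\<lambda>k. a [^] k) ` {..<n}) = card (carrier G)"
    by (simp add: card_image order_def)
  then have "(\<lambda>k. a [^] k) ` {..<n} = carrier G"
    using fin by (intro card_subset_eq) auto
  then have "carrier G \<subseteq> range (\<lambda>k::nat. a [^] k)" by blast
  then show ?thesis using ord n_pos by unfold_locales auto
qed

text \<open>The parity of e decides: an odd e makes the group cyclic, an even e leads to the
  dihedral or quaternion type.\<close>

lemma (in split_order) nilpotent_classification:
  assumes cyc: "hol_cycle G \<sigma> a" and nil: "nilpotent_group G" and ord: "order G = 2 * N"
  shows "cyclic_gen G a (2 * N) \<or> (\<exists>\<epsilon>. good_eps \<epsilon> \<and> has_type G N t0 \<epsilon>)"
proof -
  interpret hol_cycle G \<sigma> a by (rule cyc)
  have four: "4 dvd n" using ord N_even by auto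
  have N2: "n div 2 = N" using ord by simp
  obtain t e j where S: "metacyclic G (g 2) a N t e"
    "[e * (j + 1) = 1 + t] (mod N)"
    "\<forall>p. prime p \<longrightarrow> p dvd N \<longrightarrow> [t = 1] (mod p) \<and> [j = 1] (mod p)"
    using metacyclic_structure[OF nil four] unfolding N2 by blast
  interpret M: metacyclic G "g 2" a N t e by (rule S(1))
  have S3: "\<And>p. prime p \<Longrightarrow> p dvd N \<Longrightarrow> [t = 1] (mod p) \<and> [j = 1] (mod p)"
    using S(3) by blast
  note ar = parameters_cong[OF M.t_sq M.t_e S(2) S3]
  show ?thesis
  proof (cases "even e")
    case False
    then show ?thesis using ar(2) M.cyclic_if_coprime N_even by blast
  next
    case True
    then have t: "[t = t0] (mod N)"
      and e: "2 ^ (v - 1) dvd e \<or> 3 \<le> v \<and> [e = 2 ^ (v - 2)] (mod 2 ^ (v - 1))"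
      using ar(3) by blast+
    have M0: "metacyclic G (g 2) a N t0 e" using t by (rule M.change_params) simp
    show ?thesis
      using e dihedral_type_if[OF M0] quaternion_type_if[OF M0] unfolding good_eps_def by blast
  qed
qed

lemma e_HG_nonzero:
  assumes "cyclic_gen Gam c n" "group G" "e_HG Gam G \<noteq> 0"
  obtains \<sigma> a where "hol_cycle G \<sigma> a"
proof -
  have "reg_embeddings Gam G \<noteq> {}"
    using assms(3) by (auto simp: e_HG_def)
  then obtain \<beta> where "\<beta> \<in> reg_embeddings Gam G" by blast
  then show thesis using embedding_cycle[OF assms(1,2)] that by metis
qed

lemma cyclic_gen_transfer:
  assumes "cyclic_gen K w n" "K \<cong> G" "group G"
  obtains w' where "cyclic_gen G w' n"
proof -
  obtain f where "f \<in> iso K G" using assms(2) by (auto simp: is_iso_def)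
  then show thesis using that cyclic_gen_iso_image[OF assms(1) _ assms(3)] by blast
qed

lemma cyclic_gen_imp_iso:
  assumes "cyclic_gen K w n" "cyclic_gen G w' n"
  shows "K \<cong> G"
  using cyclic_gen_iso[OF assms] by (auto simp: is_iso_def)

lemma split_order_exists:
  assumes "2 \<le> v" "odd n'"
  obtains t0 where "split_order v n' (2 ^ (v - 1) * n') t0"
proof -
  have "coprime ((2::nat) ^ (v - 1)) n'" using assms(2) by simp
  \<comment> \<open>\<open>2 ^ (v - 1) - 1\<close> stands for -1.\<close>
  then obtain t0 where t0: "[t0 = 2 ^ (v - 1) - 1] (mod 2 ^ (v - 1))" "[t0 = 1] (mod n')"
    using binary_chinese_remainder_nat by blast
  have "[t0 + 1 = (2 ^ (v - 1) - 1) + 1] (mod 2 ^ (v - 1))"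
    using t0(1) by (intro cong_add) auto
  then have "2 ^ (v - 1) dvd t0 + 1" by (simp add: cong_def dvd_eq_mod_eq_0)
  then have "split_order v n' (2 ^ (v - 1) * n') t0"
    using assms t0(2) by unfold_locales auto
  then show thesis by (rule that)
qed

lemma groups_of_orderD:
  assumes "G \<in> groups_of_order n"
  shows "group G" "order G = n" "finite (carrier G)"
  using assms by (auto simp: groups_of_order_def order_def)

text \<open>P will be nilpotency or commutativity, so both sums are evaluated at once; only the
  cyclic class contributes.\<close>

lemma sum_classes_not_4_dvd:
  assumes Gam: "cyclic_gen Gam c n" and n4: "\<not> 4 dvd n"
    and P: "\<And>G. P G \<Longrightarrow> nilpotent_group G" "\<And>G. comm_group G \<Longrightarrow> P G"
  shows "(\<Sum>C \<in> {C \<in> iso_classes n. \<exists>G \<in> C. P G}. e_HG Gam (SOME G. G \<in> C)) = n div radical n"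
proof -
  interpret Gam: cyclic_gen Gam c n by (rule Gam)
  have "finite (carrier Gam)" unfolding Gam.carrier_eq by simp
  then obtain K where K: "K \<in> groups_of_order n" "Gam \<cong> K"
    using nat_representative[OF Gam.is_group] Gam.order_eq by auto
  obtain w where w: "cyclic_gen K w n"
    using cyclic_gen_transfer[OF Gam K(2) groups_of_orderD(1)[OF K(1)]] by blast
  have "(\<Sum>C \<in> {C \<in> iso_classes n. \<exists>G \<in> C. P G}. e_HG Gam (SOME G. G \<in> C)) = card {K} * (n div radical n)"
  proof (rule sum_iso_classes)
    show "{K} \<subseteq> groups_of_order n" using K(1) by simp
    show "P L" if "L \<in> {K}" for L
      using that P(2) comm_group_if_cyclic_gen[OF w] by simp
    show "e_HG Gam G = n div radical n"
      if L: "L \<in> {K}" "G \<in> groups_of_order n" "L \<cong> G" for L G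
    proof -
      obtain w' where "cyclic_gen G w' n"
        using cyclic_gen_transfer[OF w _ groups_of_orderD(1)[OF L(2)]] L by auto
      then show ?thesis
        using e_HG_cyclic[OF Gam] card_lcg_unit[OF Gam.N_pos] n4 by simp
    qed
    show "\<exists>K\<in>{K}. K \<cong> G"
      if G: "G \<in> groups_of_order n" "P G'" "G' \<in> groups_of_order n" "G' \<cong> G" "e_HG Gam G \<noteq> 0" for G G'
    proof -
      note gG = groups_of_orderD[OF G(1)]
      have nil: "nilpotent_group G"
        using nilpotent_group_iso[OF P(1)[OF G(2)] G(4) gG(1)] .
      obtain \<sigma> a where h: "hol_cycle G \<sigma> a" using e_HG_nonzero[OF Gam gG(1) G(5)] by blast
      have "cyclic_gen G a n"
        using hol_cycle.nilpotent_cyclic[OF h nil] n4 gG(2) by simp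
      with w have "K \<cong> G" by (rule cyclic_gen_imp_iso)
      then show ?thesis by simp
    qed
  qed auto
  then show ?thesis by simp
qed

context split_order
begin

text \<open>E lists the non-cyclic types that satisfy P. With the cyclic class they are all that
  contribute, each with the same number, whence the factor \<open>Suc (card E)\<close>.\<close>

lemma sum_nilpotent_classes:
  assumes Gam: "cyclic_gen Gam c (2 * N)"
    and P: "\<And>G. P G \<Longrightarrow> nilpotent_group G" "\<And>G. comm_group G \<Longrightarrow> P G"
    and E: "finite E" "\<And>\<epsilon>. \<epsilon> \<in> E \<Longrightarrow> good_eps \<epsilon>"
      "\<And>\<epsilon> G. \<epsilon> \<in> E \<Longrightarrow> has_type G N t0 \<epsilon> \<Longrightarrow> P G"
      "\<And>\<epsilon> G. good_eps \<epsilon> \<Longrightarrow> has_type G N t0 \<epsilon> \<Longrightarrow> P G \<Longrightarrow> \<epsilon> \<in> E"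
  shows "(\<Sum>C \<in> {C \<in> iso_classes (2 * N). \<exists>G \<in> C. P G}. e_HG Gam (SOME G. G \<in> C)) =
    Suc (card E) * (2 * N div (2 * radical (2 * N)))"
proof -
  interpret Gam: cyclic_gen Gam c "2 * N" by (rule Gam)
  have four: "4 dvd 2 * N" using N_even by auto
  have pos: "2 * N > 0" using N_pos by simp
  have "finite (carrier Gam)" unfolding Gam.carrier_eq by simp
  then obtain K where K: "K \<in> groups_of_order (2 * N)" "Gam \<cong> K"
    using nat_representative[OF Gam.is_group] Gam.order_eq by auto
  obtain w where w: "cyclic_gen K w (2 * N)"
    using cyclic_gen_transfer[OF Gam K(2) groups_of_orderD(1)[OF K(1)]] by blast
  \<comment> \<open>The explicit dihedral and quaternion products show that every good type
    occurs.\<close>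
  have rep: "\<exists>G. G \<in> groups_of_order (2 * N) \<and> has_type G N t0 \<epsilon>" if eps: "good_eps \<epsilon>" for \<epsilon>
  proof -
    have "\<exists>G :: ((int \<times> int) \<times> int) monoid. has_type G N t0 \<epsilon>"
      using eps has_type_dihedral has_type_quaternion unfolding good_eps_def by blast
    then obtain G :: "((int \<times> int) \<times> int) monoid" where G: "has_type G N t0 \<epsilon>" by blast
    have ord: "order G = 2 * N" and gG: "group G"
      using has_type_order[OF G] has_type_group[OF G] .
    have "finite (carrier G)" using ord pos unfolding order_def by (metis card.infinite less_irrefl)
    then obtain L where L: "L \<in> groups_of_order (2 * N)" "G \<cong> L"
      using nat_representative[OF gG] ord by auto
    have "has_type L N t0 \<epsilon>" using has_type_iso[OF G L(2) groups_of_orderD(1)[OF L(1)]] .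
    then show ?thesis using L(1) by blast
  qed
  define R where "R = (\<lambda>\<epsilon>. SOME G. G \<in> groups_of_order (2 * N) \<and> has_type G N t0 \<epsilon>)"
  have R: "R \<epsilon> \<in> groups_of_order (2 * N)" "has_type (R \<epsilon>) N t0 \<epsilon>" if "good_eps \<epsilon>" for \<epsilon>
    using someI_ex[OF rep[OF that]] unfolding R_def by auto
  have type_inj: "\<epsilon> = \<epsilon>'"
    if "good_eps \<epsilon>" "good_eps \<epsilon>'" "has_type G N t0 \<epsilon>" "has_type G N t0 \<epsilon>'" for \<epsilon> \<epsilon>' and G :: "nat monoid"
    using that type_exclusive[of G] unfolding good_eps_def by auto
  have K_notin: "K \<noteq> R \<epsilon>" if "good_eps \<epsilon>" for \<epsilon>
    using type_not_cyclic[OF R(2)[OF that] that] w by auto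
  have injR: "inj_on R E"
  proof (rule inj_onI)
    fix \<epsilon> \<epsilon>' assume e: "\<epsilon> \<in> E" "\<epsilon>' \<in> E" "R \<epsilon> = R \<epsilon>'"
    then show "\<epsilon> = \<epsilon>'"
      using type_inj[of \<epsilon> \<epsilon>' "R \<epsilon>"] R(2)[OF E(2)[OF e(1)]] R(2)[OF E(2)[OF e(2)]] E(2) by simp
  qed
  have not_iso: "\<not> K \<cong> R \<epsilon>" "\<not> R \<epsilon> \<cong> K" if eps: "good_eps \<epsilon>" for \<epsilon>
  proof -
    show "\<not> K \<cong> R \<epsilon>"
      using cyclic_gen_transfer[OF w _ groups_of_orderD(1)[OF R(1)[OF eps]]]
        type_not_cyclic[OF R(2)[OF eps] eps] by blast
    then show "\<not> R \<epsilon> \<cong> K"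
      using group.iso_sym[OF groups_of_orderD(1)[OF R(1)[OF eps]]] by blast
  qed
  have "(\<Sum>C \<in> {C \<in> iso_classes (2 * N). \<exists>G \<in> C. P G}. e_HG Gam (SOME G. G \<in> C)) =
      card (insert K (R ` E)) * (2 * N div (2 * radical (2 * N)))"
  proof (rule sum_iso_classes)
    show "finite (insert K (R ` E))" using E(1) by simp
    show "insert K (R ` E) \<subseteq> groups_of_order (2 * N)" using K(1) R(1) E(2) by auto
    show "P L" if "L \<in> insert K (R ` E)" for L
      using that P(2) comm_group_if_cyclic_gen[OF w] E(3)[OF _ R(2)] E(2) by auto
    show "L = M" if LM: "L \<in> insert K (R ` E)" "M \<in> insert K (R ` E)" "L \<cong> M" for L M
    proof (cases "L = K \<or> M = K")
      case True
      then show ?thesis using LM not_iso E(2) by blast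
    next
      case False
      then obtain \<epsilon> \<epsilon>' where e: "\<epsilon> \<in> E" "\<epsilon>' \<in> E" "L = R \<epsilon>" "M = R \<epsilon>'" using LM by blast
      have M: "has_type M N t0 \<epsilon>"
        using has_type_iso[OF R(2)[OF E(2)[OF e(1)]], of M] LM(3) e(3,4)
          groups_of_orderD(1)[OF R(1)[OF E(2)[OF e(2)]]] by simp
      have "\<epsilon> = \<epsilon>'"
        using type_inj[OF E(2)[OF e(1)] E(2)[OF e(2)] M] R(2)[OF E(2)[OF e(2)]] e(4) by simp
      then show ?thesis using e by simp
    qed
    show "e_HG Gam G = 2 * N div (2 * radical (2 * N))"
      if L: "L \<in> insert K (R ` E)" "G \<in> groups_of_order (2 * N)" "L \<cong> G" for L G
    proof (cases "L = K")
      case True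
      then obtain w' where "cyclic_gen G w' (2 * N)"
        using cyclic_gen_transfer[OF w _ groups_of_orderD(1)[OF L(2)]] L(3) by blast
      then show ?thesis
        using e_HG_cyclic[OF Gam] card_lcg_unit[OF pos] four by simp
    next
      case False
      then obtain \<epsilon> where e: "\<epsilon> \<in> E" "L = R \<epsilon>" using L(1) by blast
      have "has_type G N t0 \<epsilon>"
        using has_type_iso[OF R(2)[OF E(2)[OF e(1)]], of G] L(3) e(2) groups_of_orderD(1)[OF L(2)] by simp
      then show ?thesis
        using e_HG_type[OF Gam _ E(2)[OF e(1)]] card_type_index[OF four pos] by simp
    qed
    show "\<exists>L\<in>insert K (R ` E). L \<cong> G"
      if G: "G \<in> groups_of_order (2 * N)" "P G'" "G' \<in> groups_of_order (2 * N)" "G' \<cong> G" "e_HG Gam G \<noteq> 0" for G G'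
    proof -
      note gG = groups_of_orderD[OF G(1)]
      note gG' = groups_of_orderD[OF G(3)]
      have nil: "nilpotent_group G"
        using nilpotent_group_iso[OF P(1)[OF G(2)] G(4) gG(1)] .
      obtain \<sigma> a where h: "hol_cycle G \<sigma> a" using e_HG_nonzero[OF Gam gG(1) G(5)] by blast
      show ?thesis
        using nilpotent_classification[OF h nil gG(2)]
      proof
        assume "cyclic_gen G a (2 * N)"
        with w have "K \<cong> G" by (rule cyclic_gen_imp_iso)
      then show ?thesis by simp
      next
        assume "\<exists>\<epsilon>. good_eps \<epsilon> \<and> has_type G N t0 \<epsilon>"
        then obtain \<epsilon> where e: "good_eps \<epsilon>" "has_type G N t0 \<epsilon>" by blast
        have "G \<cong> G'" using group.iso_sym[OF gG'(1) G(4)] .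
        then have "has_type G' N t0 \<epsilon>" using has_type_iso[OF e(2)] gG'(1) by blast
        then have "\<epsilon> \<in> E" using E(4)[OF e(1)] G(2) by blast
        moreover have "R \<epsilon> \<cong> G" using has_type_imp_iso[OF R(2)[OF e(1)] e(2)] .
        ultimately show ?thesis by blast
      qed
    qed
  qed
  moreover have "card (insert K (R ` E)) = Suc (card E)"
  proof -
    have "K \<notin> R ` E" using K_notin E(2) by blast
    then show ?thesis using E(1) injR by (simp add: card_image)
  qed
  ultimately show ?thesis by simp
qed

end

theorem theorem2:
  fixes Gam :: "'c monoid" and n :: nat
  assumes "group Gam" and "cyclic_group Gam"
    and "finite (carrier Gam)" and "card (carrier Gam) = n"
  shows
    "(\<not> 4 dvd n \<longrightarrow>
        e_nil Gam = n div radical n \<and> e_ab Gam = n div radical n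
        \<and> e_HG Gam Gam = n div radical n)
   \<and> (n mod 8 = 4 \<longrightarrow>
        e_nil Gam = n div radical n \<and> e_ab Gam = n div radical n
        \<and> e_HG Gam Gam = n div (2 * radical n)
        \<and> e_HG Gam (cyc 2 \<times>\<times> cyc (n div 2)) = n div (2 * radical n))
   \<and> (\<forall>v n'. n = 2 ^ v * n' \<and> odd n' \<and> 3 \<le> v \<longrightarrow>
        e_nil Gam = 3 * n div (2 * radical n)
        \<and> e_ab Gam = n div (2 * radical n)
        \<and> e_HG Gam Gam = n div (2 * radical n)
        \<and> e_HG Gam (dihedral_group v \<times>\<times> cyc n') = n div (2 * radical n)
        \<and> e_HG Gam (quaternion_group v \<times>\<times> cyc n') = n div (2 * radical n))"
proof -
  have ordn: "order Gam = n" using assms(4) by (simp add: order_def)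
  obtain c where c: "cyclic_gen Gam c n"
    using cyclic_group_gen[OF assms(1-3)] ordn by auto
  have n0: "n > 0" using cyclic_gen.N_pos[OF c] .
  have self: "e_HG Gam Gam = (if 4 dvd n then n div (2 * radical n) else n div radical n)"
    using e_HG_cyclic[OF c c] card_lcg_unit[OF n0] by simp
  have comm_nil: "nilpotent_group G" if "comm_group G" for G :: "nat monoid"
    using that by (rule nilpotent_if_comm_group)
  show ?thesis
  proof (intro conjI impI allI)
    assume n4: "\<not> 4 dvd n"
    show "e_nil Gam = n div radical n"
      unfolding e_nil_def assms(4)
      using sum_classes_not_4_dvd[OF c n4, of nilpotent_group] comm_nil by blast
    show "e_ab Gam = n div radical n"
      unfolding e_ab_def assms(4)
      using sum_classes_not_4_dvd[OF c n4, of comm_group] comm_nil by blast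
    show "e_HG Gam Gam = n div radical n" using self n4 by simp
  next
    assume n8: "n mod 8 = 4"
    define n' where "n' = n div 4"
    have n': "n = 4 * n'" "odd n'" using n8 unfolding n'_def by presburger+
    obtain t0 where "split_order 2 n' (2 ^ (2 - 1) * n') t0"
      using split_order_exists[of 2 n'] n'(2) by auto
    then interpret split_order 2 n' "2 * n'" t0 by simp
    have N: "2 * (2 * n') = n" using n' by simp
    have c': "cyclic_gen Gam c (2 * (2 * n'))" using c N by simp
    have n4: "4 dvd n" using n' by simp
    have geps: "good_eps \<epsilon> \<longleftrightarrow> \<epsilon> = 0" for \<epsilon> by (simp add: good_eps_def)
    \<comment> \<open>\<open>2 * radical n\<close> divides n, so doubling the quotient is
      exact.\<close>
    have two: "2 * (n div (2 * radical n)) = n div radical n"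
      using div_mult_swap[OF radical_double(2)[OF n4 n0], of 2] by simp
    have sum: "(\<Sum>C \<in> {C \<in> iso_classes n. \<exists>G \<in> C. P G}. e_HG Gam (SOME G. G \<in> C)) = n div radical n"
      if P: "\<And>G. P G \<Longrightarrow> nilpotent_group G" "\<And>G. comm_group G \<Longrightarrow> P G" for P :: "nat monoid \<Rightarrow> bool"
    proof -
      \<comment> \<open>For v = 2 the only non-cyclic type is abelian, so E = {0} serves for both
        choices of P.\<close>
      have "(\<Sum>C \<in> {C \<in> iso_classes (2 * (2 * n')). \<exists>G \<in> C. P G}. e_HG Gam (SOME G. G \<in> C)) =
        Suc (card {0::nat}) * (2 * (2 * n') div (2 * radical (2 * (2 * n'))))"
      proof (rule sum_nilpotent_classes[OF c' P])
        fix \<epsilon> and G :: "nat monoid" assume "\<epsilon> \<in> {0::nat}" "has_type G (2 * n') t0 \<epsilon>"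
        then show "P G" using comm_group_type_iff[of G \<epsilon>] P(2) by blast
      qed (auto simp: geps)
      then show ?thesis unfolding N using two by simp
    qed
    show "e_nil Gam = n div radical n"
      unfolding e_nil_def assms(4) using sum[of nilpotent_group] comm_nil by blast
    show "e_ab Gam = n div radical n"
      unfolding e_ab_def assms(4) using sum[of comm_group] comm_nil by blast
    show "e_HG Gam Gam = n div (2 * radical n)" using self n4 by simp
    have "n div 2 = 2 * n'" using n' by simp
    then show "e_HG Gam (cyc 2 \<times>\<times> cyc (n div 2)) = n div (2 * radical n)"
      using e_HG_type[OF c' has_type_cyc_prod[OF refl]] card_type_index[OF n4 n0] geps by simp
  next
    fix v n' assume vn: "n = 2 ^ v * n' \<and> odd n' \<and> 3 \<le> v"
    define N where "N = 2 ^ (v - 1) * n'"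
    obtain t0 where "split_order v n' N t0"
      using split_order_exists[of v n'] vn unfolding N_def by auto
    then interpret split_order v n' N t0 .
    have N: "2 * N = n" using vn by (cases v) (auto simp: N_def)
    have c': "cyclic_gen Gam c (2 * N)" using c N by simp
    have n4: "4 dvd n" using N N_even by auto
    have geps: "good_eps \<epsilon> \<longleftrightarrow> \<epsilon> \<in> {0, N div 2}" for \<epsilon> using vn by (simp add: good_eps_def)
    have half: "N div 2 \<noteq> 0" using N_pos N_even by auto
    have count: "e_HG Gam G = n div (2 * radical n)" if "has_type G N t0 \<epsilon>" "good_eps \<epsilon>" for \<epsilon> and G :: "((int \<times> int) \<times> int) monoid"
      using e_HG_type[OF c' that] card_type_index[OF n4 n0] N by auto
    \<comment> \<open>Three classes: cyclic, dihedral type and quaternion type.\<close>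
    have "e_nil Gam = Suc (card {0, N div 2}) * (n div (2 * radical n))"
      unfolding e_nil_def assms(4) N[symmetric]
    proof (rule sum_nilpotent_classes[OF c'])
      fix \<epsilon> and G :: "nat monoid" assume "has_type G N t0 \<epsilon>"
      then show "nilpotent_group G" by (rule nilpotent_type)
    qed (auto simp: geps comm_nil)
    also have "\<dots> = 3 * (n div (2 * radical n))"
      using half by simp
    also have "\<dots> = 3 * n div (2 * radical n)"
      using radical_double(2)[OF n4 n0] by (rule div_mult_swap)
    finally show "e_nil Gam = 3 * n div (2 * radical n)" .
    \<comment> \<open>For v > 2 neither non-cyclic type is abelian, so E is empty.\<close>
    have "e_ab Gam = Suc (card ({} :: nat set)) * (n div (2 * radical n))"
      unfolding e_ab_def assms(4) N[symmetric]
    proof (rule sum_nilpotent_classes[OF c'])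
      fix \<epsilon> and G :: "nat monoid" assume "has_type G N t0 \<epsilon>" "comm_group G"
      then show "\<epsilon> \<in> {}" using comm_group_type_iff[of G \<epsilon>] vn by simp
    qed (auto simp: comm_nil)
    then show "e_ab Gam = n div (2 * radical n)" by simp
    show "e_HG Gam Gam = n div (2 * radical n)" using self n4 by simp
    show "e_HG Gam (dihedral_group v \<times>\<times> cyc n') = n div (2 * radical n)"
      using count[OF has_type_dihedral] geps by simp
    show "e_HG Gam (quaternion_group v \<times>\<times> cyc n') = n div (2 * radical n)"
      using count[OF has_type_quaternion] geps by simp
  qed
qed

end
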